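(* Let $g:V_\Gamma\to\mathbb R$ be an L-convex function on a modular complex $\boldsymbol\Gamma=(\Gamma,o,h)$. For a vertex $p\in V_\Gamma$, the following conditions are equivalent: (1) $g(p)\le g(q)$ holds for every $q\in V_\Gamma$. (2) $g(p)\le g(q)$ holds for every $q\in V_\Gamma$ with $p\sqsubseteq q$ or $q\sqsubseteq p$; that is, $g(p)=\min\{g(q):q\in\mathcal L_p^+\}=\min\{g(q):q\in\mathcal L^-_p\}$.
   Context: Modular complexes. Graphs are finite, simple, undirected, connected; $d_\Gamma$ is the unit-length shortest path metric and $d_{\Gamma,h}$ the shortest path metric for edge-length $h$. $\Gamma$ is modular if any vertices $p_1,p_2,p_3$ have a median, i.e. a vertex $m$ with $d_\Gamma(p_i,p_j)=d_\Gamma(p_i,m)+d_\Gamma(m,p_j)$ for $i<j$. For an orientation $o$, $p\swarrow_o q$ means edge $pq$ is oriented from $q$ to $p$; $o$ is admissible if for every 4-cycle $uv,vv',v'u',u'u$: $u\swarrow_o v\iff u'\swarrow_o v'$. Edges $e,e'$ are projective if there is a sequence $e=e_0,\dots,e_m=e'$ of edges such that $e_i,e_{i+1}$ belong to a common 4-cycle and share no vertex; orbits are the classes of this equivalence relation; $h$ on edges is orbit-invariant if constant on each orbit, positive if all values are $>0$. A modular complex is a triple $\boldsymbol\Gamma=(\Gamma,o,h)$: a modular graph, an admissible orientation, a positive orbit-invariant function. $\preceq_o$ is the transitive (reflexive) closure of $\swarrow_o$ (a partial order on $V_\Gamma$). For each subgraph $B$ isomorphic to a cube (hypercube) graph, $B$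 oriented by $o$ is the Hasse diagram of a Boolean lattice; $(p,q)$ is ($o$-)Boolean, $p\sqsubseteq q$, if $p$ and $q$ are the minimum and maximum of the Boolean lattice of some cube subgraph, or $p=q$. $\mathcal L^+_p=\mathcal L^+_p(\boldsymbol\Gamma):=\{q:p\sqsubseteq q\}$, ordered by $\preceq_o$; $\mathcal L^-_p:=\{q:q\sqsubseteq p\}$. 2-subdivision. $\boldsymbol\Gamma^*=(\Gamma^*,o^*,h^* )$: vertices are the Boolean pairs $(p,q)$, written $q/p$; $q/p$ and $q'/p'$ are adjacent iff ($p=p'$ and $qq'$ is an edge of $\Gamma$) or ($q=q'$ and $pp'$ is an edge); $q/p\swarrow_{o^*}q'/p'$ if $p=p'$ and $q\swarrow_oq'$, or $q=q'$ and $p'\swarrow_op$; $h^*$ of such an edge is $h(qq')/2$, resp. $h(pp')/2$. $\boldsymbol\Gamma^*$ is again a modular complex. The neighborhood semilattice of $p\in V_\Gamma$ is $\mathcal L^*_p:=\mathcal L^+_{p/p}(\boldsymbol\Gamma^* )$, a modular semilattice (defined below), with valuation $v^*_p(x):=d_{\Gamma^*,h^*}(x,p/p)$. L-convexity. For $g:V_\Gamma\to\mathbb R$ put $\overline g(q/p):=(g(p)+g(q))/2$ on $V_{\Gamma^*}$. $g$ is L-convex on $\boldsymbol\Gamma$ if for every $p\in V_\Gamma$ the restriction of $\overline g$ to $\mathcal L_p^*$ is submodular with respect to $v_p^*$. Submodularity. A modular semilattice is a finite meet-semilattice $\mathcal L$ (minimum $\mathbf 0$) in which every $[\mathbf 0,p]$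 is a modular lattice and $a\vee b\vee c$ exists whenever the pairwise joins exist. A valuation is $v:\mathcal L\to\mathbb R$, strictly increasing, with $v(p)+v(q)=v(p\wedge q)+v(p\vee q)$ when $p\vee q$ exists; $v[p,q]:=v(q)-v(p)$. $d$ is the shortest path metric of the covering graph with length $v(q)-v(p)$ on an edge where $q$ covers $p$; $I(p,q):=\{u:d(p,u)+d(u,q)=d(p,q)\}$. For $u\in I(p,q)$, $v(u;p,q):=(v[p\wedge q,u\wedge p],v[p\wedge q,u\wedge q])\in\mathbb R^2_+$; $\operatorname{Conv}I(p,q)$ is the convex hull of these points. $\mathcal E(p,q)$ is the set of $u\in I(p,q)$ such that $z=v(u;p,q)$ is an extreme point of $\operatorname{Conv}I(p,q)$ with $z+\epsilon\notin\operatorname{Conv}I(p,q)$ for all strictly positive vectors $\epsilon$. $C(u;p,q):=\{w\in\mathbb R^2_+:\langle w,v(u;p,q)\rangle=\max_{u'\in I(p,q)}\langle w,v(u';p,q)\rangle\}$. For a closed convex cone $C=\{(x,y)\in\mathbb R^2_+:-x\sin\alpha+y\cos\alpha\le0,-x\sin\beta+y\cos\beta\ge0\}$, $0\le\beta\le\alpha\le\pi/2$, $[C]:=\frac{\sin\alpha}{\cos\alpha+\sin\alpha}-\frac{\sin\beta}{\cos\beta+\sin\beta}$; $[\{0\}]:=0$. $f:\mathcal L\to\mathbb R\cup\{\infty\}$ is submodular if $f(p)+f(q)\ge f(p\wedge q)+\sum_{u\in\mathcal E(p,q)}[C(u;p,q)]f(u)$ for all $p,q$. *)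

theory Defs
  imports
    "HOL-Analysis.Analysis"
    "HOL-Algebra.Lattice"
    "Graph_Theory.Graph_Theory"
begin

text \<open>
  A finite simple undirected graph is a \<^locale>\<open>pair_graph\<close>: every undirected edge
  \<open>uv\<close> is represented by the two arcs \<open>(u,v)\<close> and \<open>(v,u)\<close>.  Edge lengths are functions on
  undirected edges, i.e. on two-element vertex sets; their values elsewhere play no role.
\<close>

definition graph_edges :: "'a pair_pre_digraph \<Rightarrow> 'a set set" where
  "graph_edges G = {{u, v} | u v. (u, v) \<in> parcs G}"

definition edge_weight :: "('a set \<Rightarrow> real) \<Rightarrow> ('a \<times> 'a) weight_fun" where
  "edge_weight h = (\<lambda>(u, v). h {u, v})"

definition graph_dist :: "'a pair_pre_digraph \<Rightarrow> ('a \<times> 'a) weight_fun \<Rightarrow> 'a \<Rightarrow> 'a \<Rightarrow> real" where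
  "graph_dist G w u v = real_of_ereal (wf_digraph.\<mu> (with_proj G) w u v)"


section \<open>Modular complexes\<close>

definition is_median :: "'a pair_pre_digraph \<Rightarrow> 'a \<Rightarrow> 'a \<Rightarrow> 'a \<Rightarrow> 'a \<Rightarrow> bool" where
  "is_median G p1 p2 p3 m \<longleftrightarrow>
     (let d = graph_dist G (\<lambda>_. 1) in
       m \<in> pverts G \<and>
       d p1 p2 = d p1 m + d m p2 \<and>
       d p1 p3 = d p1 m + d m p3 \<and>
       d p2 p3 = d p2 m + d m p3)"

text \<open>The qualified name keeps graph connectedness apart from topological connectedness.\<close>

definition modular_graph :: "'a pair_pre_digraph \<Rightarrow> bool" where
  "modular_graph G \<longleftrightarrow>
     pair_graph G \<and> Digraph_Component.connected (with_proj G) \<and>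
     (\<forall>p1\<in>pverts G. \<forall>p2\<in>pverts G. \<forall>p3\<in>pverts G. \<exists>m. is_median G p1 p2 p3 m)"

definition four_cycle :: "'a pair_pre_digraph \<Rightarrow> 'a \<Rightarrow> 'a \<Rightarrow> 'a \<Rightarrow> 'a \<Rightarrow> bool" where
  "four_cycle G u v v' u' \<longleftrightarrow>
     distinct [u, v, v', u'] \<and> {(u, v), (v, v'), (v', u'), (u', u)} \<subseteq> parcs G"

text \<open>
  In an orientation \<open>ori\<close>, the pair \<open>(p,q)\<close> stands for \<open>p \<swarrow> q\<close>, i.e. the edge \<open>pq\<close> is oriented
  from \<open>q\<close> to \<open>p\<close>, so that \<open>p\<close> is the lower end.
\<close>

definition orientation :: "'a pair_pre_digraph \<Rightarrow> 'a rel \<Rightarrow> bool" where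
  "orientation G ori \<longleftrightarrow>
     ori \<subseteq> parcs G \<and> (\<forall>(p, q)\<in>parcs G. (p, q) \<in> ori \<longleftrightarrow> (q, p) \<notin> ori)"

definition admissible :: "'a pair_pre_digraph \<Rightarrow> 'a rel \<Rightarrow> bool" where
  "admissible G ori \<longleftrightarrow>
     orientation G ori \<and>
     (\<forall>u v v' u'. four_cycle G u v v' u' \<longrightarrow> ((u, v) \<in> ori \<longleftrightarrow> (u', v') \<in> ori))"

definition opposite_edges :: "'a pair_pre_digraph \<Rightarrow> 'a set rel" where
  "opposite_edges G =
     {(e, e'). \<exists>u v v' u'. four_cycle G u v v' u' \<and>
        e \<in> {{u, v}, {v, v'}, {v', u'}, {u', u}} \<and>
        e' \<in> {{u, v}, {v, v'}, {v', u'}, {u', u}} \<and> e \<inter> e' = {}}"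

definition projective :: "'a pair_pre_digraph \<Rightarrow> 'a set \<Rightarrow> 'a set \<Rightarrow> bool" where
  "projective G e e' \<longleftrightarrow>
     e \<in> graph_edges G \<and> e' \<in> graph_edges G \<and> (e, e') \<in> (opposite_edges G)\<^sup>*"

definition orbit_invariant :: "'a pair_pre_digraph \<Rightarrow> ('a set \<Rightarrow> real) \<Rightarrow> bool" where
  "orbit_invariant G h \<longleftrightarrow> (\<forall>e e'. projective G e e' \<longrightarrow> h e = h e')"

definition modular_complex :: "'a pair_pre_digraph \<Rightarrow> 'a rel \<Rightarrow> ('a set \<Rightarrow> real) \<Rightarrow> bool" where
  "modular_complex G ori h \<longleftrightarrow>
     modular_graph G \<and> admissible G ori \<and>
     orbit_invariant G h \<and> (\<forall>e\<in>graph_edges G. 0 < h e)"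


section \<open>Boolean pairs\<close>

definition cube_graph :: "nat \<Rightarrow> nat set pair_pre_digraph" where
  "cube_graph n =
     \<lparr> pverts = Pow {..<n},
       parcs = {(A, B). A \<subseteq> {..<n} \<and> B \<subseteq> {..<n} \<and> card ((A - B) \<union> (B - A)) = 1} \<rparr>"

definition cube_subgraph :: "'a pair_pre_digraph \<Rightarrow> 'a pair_pre_digraph \<Rightarrow> bool" where
  "cube_subgraph B G \<longleftrightarrow>
     subgraph (with_proj B) (with_proj G) \<and>
     (\<exists>n. digraph_iso (with_proj (cube_graph n)) (with_proj B))"

text \<open>
  The order of a cube subgraph \<open>B\<close> is the one having \<open>B\<close>, oriented by \<open>ori\<close>, as its Hasse diagram,
  that is, the reflexive transitive closure of the orientation restricted to the edges of \<open>B\<close>.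
\<close>

definition boolean_pair :: "'a pair_pre_digraph \<Rightarrow> 'a rel \<Rightarrow> 'a \<Rightarrow> 'a \<Rightarrow> bool" where
  "boolean_pair G ori p q \<longleftrightarrow>
     p \<in> pverts G \<and> q \<in> pverts G \<and>
     (p = q \<or>
      (\<exists>B. cube_subgraph B G \<and> p \<in> pverts B \<and> q \<in> pverts B \<and>
         (\<forall>x\<in>pverts B. (p, x) \<in> (ori \<inter> parcs B)\<^sup>* \<and> (x, q) \<in> (ori \<inter> parcs B)\<^sup>*)))"

definition Lplus :: "'a pair_pre_digraph \<Rightarrow> 'a rel \<Rightarrow> 'a \<Rightarrow> 'a set" where
  "Lplus G ori p = {q. boolean_pair G ori p q}"

definition Lminus :: "'a pair_pre_digraph \<Rightarrow> 'a rel \<Rightarrow> 'a \<Rightarrow> 'a set" where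
  "Lminus G ori p = {q. boolean_pair G ori q p}"

definition Lplus_order :: "'a pair_pre_digraph \<Rightarrow> 'a rel \<Rightarrow> 'a \<Rightarrow> 'a gorder" where
  "Lplus_order G ori p =
     \<lparr> carrier = Lplus G ori p, eq = (=), le = (\<lambda>x y. (x, y) \<in> ori\<^sup>*) \<rparr>"


section \<open>The 2-subdivision\<close>

text \<open>The vertex written \<open>q/p\<close> is represented by the pair \<open>(p, q)\<close> (with \<open>p\<close> below \<open>q\<close>).\<close>

definition subdiv_graph :: "'a pair_pre_digraph \<Rightarrow> 'a rel \<Rightarrow> ('a \<times> 'a) pair_pre_digraph" where
  "subdiv_graph G ori =
     \<lparr> pverts = {(p, q). boolean_pair G ori p q},
       parcs = {((p, q), (p', q')). boolean_pair G ori p q \<and> boolean_pair G ori p' q' \<and>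
                 (p = p' \<and> (q, q') \<in> parcs G \<or> q = q' \<and> (p, p') \<in> parcs G)} \<rparr>"

definition subdiv_ori :: "'a pair_pre_digraph \<Rightarrow> 'a rel \<Rightarrow> ('a \<times> 'a) rel" where
  "subdiv_ori G ori =
     {((p, q), (p', q')). ((p, q), (p', q')) \<in> parcs (subdiv_graph G ori) \<and>
        (p = p' \<and> (q, q') \<in> ori \<or> q = q' \<and> (p', p) \<in> ori)}"

text \<open>
  An edge \<open>e\<close> joining \<open>q/p\<close> and \<open>q'/p'\<close> projects to \<open>{p, p'}\<close> and \<open>{q, q'}\<close>, exactly one of which
  is a singleton.
\<close>

definition subdiv_length :: "('a set \<Rightarrow> real) \<Rightarrow> ('a \<times> 'a) set \<Rightarrow> real" where
  "subdiv_length h e = (if is_singleton (fst ` e) then h (snd ` e) / 2 else h (fst ` e) / 2)"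

definition nbhd_semilattice :: "'a pair_pre_digraph \<Rightarrow> 'a rel \<Rightarrow> 'a \<Rightarrow> ('a \<times> 'a) gorder" where
  "nbhd_semilattice G ori p = Lplus_order (subdiv_graph G ori) (subdiv_ori G ori) (p, p)"

definition nbhd_valuation ::
    "'a pair_pre_digraph \<Rightarrow> 'a rel \<Rightarrow> ('a set \<Rightarrow> real) \<Rightarrow> 'a \<Rightarrow> 'a \<times> 'a \<Rightarrow> real" where
  "nbhd_valuation G ori h p x =
     graph_dist (subdiv_graph G ori) (edge_weight (subdiv_length h)) x (p, p)"


section \<open>Submodular functions\<close>

text \<open>
  The notions of this section concern a modular semilattice \<open>L\<close> with valuation \<open>v\<close>; the definitions
  themselves only use the order, binary meets and \<open>v\<close>.
\<close>

definition covers :: "'a gorder \<Rightarrow> 'a \<Rightarrow> 'a \<Rightarrow> bool" where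
  "covers L p q \<longleftrightarrow>
     p \<in> carrier L \<and> q \<in> carrier L \<and> p \<sqsubset>\<^bsub>L\<^esub> q \<and>
     \<not> (\<exists>r\<in>carrier L. p \<sqsubset>\<^bsub>L\<^esub> r \<and> r \<sqsubset>\<^bsub>L\<^esub> q)"

definition covering_graph :: "'a gorder \<Rightarrow> 'a pair_pre_digraph" where
  "covering_graph L =
     \<lparr> pverts = carrier L, parcs = {(p, q). covers L p q \<or> covers L q p} \<rparr>"

definition semilattice_dist :: "'a gorder \<Rightarrow> ('a \<Rightarrow> real) \<Rightarrow> 'a \<Rightarrow> 'a \<Rightarrow> real" where
  "semilattice_dist L v =
     graph_dist (covering_graph L) (\<lambda>(p, q). if covers L p q then v q - v p else v p - v q)"

definition metric_interval :: "'a gorder \<Rightarrow> ('a \<Rightarrow> real) \<Rightarrow> 'a \<Rightarrow> 'a \<Rightarrow> 'a set" where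
  "metric_interval L v p q =
     {u \<in> carrier L.
        semilattice_dist L v p u + semilattice_dist L v u q = semilattice_dist L v p q}"

definition val_point :: "'a gorder \<Rightarrow> ('a \<Rightarrow> real) \<Rightarrow> 'a \<Rightarrow> 'a \<Rightarrow> 'a \<Rightarrow> real \<times> real" where
  "val_point L v p q u =
     (v (u \<sqinter>\<^bsub>L\<^esub> p) - v (p \<sqinter>\<^bsub>L\<^esub> q), v (u \<sqinter>\<^bsub>L\<^esub> q) - v (p \<sqinter>\<^bsub>L\<^esub> q))"

definition conv_interval :: "'a gorder \<Rightarrow> ('a \<Rightarrow> real) \<Rightarrow> 'a \<Rightarrow> 'a \<Rightarrow> (real \<times> real) set" where
  "conv_interval L v p q = convex hull (val_point L v p q ` metric_interval L v p q)"

definition extremal_set :: "'a gorder \<Rightarrow> ('a \<Rightarrow> real) \<Rightarrow> 'a \<Rightarrow> 'a \<Rightarrow> 'a set" where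
  "extremal_set L v p q =
     {u \<in> metric_interval L v p q.
        val_point L v p q u extreme_point_of conv_interval L v p q \<and>
        (\<forall>\<epsilon>1>0. \<forall>\<epsilon>2>0. val_point L v p q u + (\<epsilon>1, \<epsilon>2) \<notin> conv_interval L v p q)}"

definition normal_cone2 :: "'a gorder \<Rightarrow> ('a \<Rightarrow> real) \<Rightarrow> 'a \<Rightarrow> 'a \<Rightarrow> 'a \<Rightarrow> (real \<times> real) set" where
  "normal_cone2 L v p q u =
     {w. 0 \<le> fst w \<and> 0 \<le> snd w \<and>
         w \<bullet> val_point L v p q u = (MAX u'\<in>metric_interval L v p q. w \<bullet> val_point L v p q u')}"

definition angular_cone :: "real \<Rightarrow> real \<Rightarrow> (real \<times> real) set" where
  "angular_cone \<alpha> \<beta> =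
     {(x, y). 0 \<le> x \<and> 0 \<le> y \<and>
        - x * sin \<alpha> + y * cos \<alpha> \<le> 0 \<and> - x * sin \<beta> + y * cos \<beta> \<ge> 0}"

text \<open>
  The description is definite: \<open>angular_cone \<alpha> \<beta>\<close> consists of the directions with angle in
  \<open>[\<beta>, \<alpha>]\<close>, so it determines both angles and is never \<open>{0}\<close>.
\<close>

definition cone_measure :: "(real \<times> real) set \<Rightarrow> real" where
  "cone_measure C =
     (if C = {0} then 0
      else THE r. \<exists>\<alpha> \<beta>. 0 \<le> \<beta> \<and> \<beta> \<le> \<alpha> \<and> \<alpha> \<le> pi / 2 \<and> C = angular_cone \<alpha> \<beta> \<and>
             r = sin \<alpha> / (cos \<alpha> + sin \<alpha>) - sin \<beta> / (cos \<beta> + sin \<beta>))"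

definition submodular :: "'a gorder \<Rightarrow> ('a \<Rightarrow> real) \<Rightarrow> ('a \<Rightarrow> ereal) \<Rightarrow> bool" where
  "submodular L v f \<longleftrightarrow>
     (\<forall>p\<in>carrier L. f p \<noteq> - \<infinity>) \<and>
     (\<forall>p\<in>carrier L. \<forall>q\<in>carrier L.
        f p + f q \<ge> f (p \<sqinter>\<^bsub>L\<^esub> q) +
          (\<Sum>u\<in>extremal_set L v p q. ereal (cone_measure (normal_cone2 L v p q u)) * f u))"


section \<open>L-convexity\<close>

definition subdiv_ext :: "('a \<Rightarrow> real) \<Rightarrow> 'a \<times> 'a \<Rightarrow> real" where
  "subdiv_ext g = (\<lambda>(p, q). (g p + g q) / 2)"

definition L_convex :: "'a pair_pre_digraph \<Rightarrow> 'a rel \<Rightarrow> ('a set \<Rightarrow> real) \<Rightarrow> ('a \<Rightarrow> real) \<Rightarrow> bool" where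
  "L_convex G ori h g \<longleftrightarrow>
     (\<forall>p\<in>pverts G.
        submodular (nbhd_semilattice G ori p) (nbhd_valuation G ori h p)
          (\<lambda>x. ereal (subdiv_ext g x)))"

end

theory Submission
  imports Defs
begin

text \<open>
  Let \<open>p\<close> be a local minimum and suppose \<open>g q < g p\<close>.  Join \<open>p\<close> to \<open>q\<close> by a path whose steps are Boolean
  pairs and whose maximal value \<open>M\<close> is as small as possible.  At a vertex \<open>r\<close> of value \<open>M\<close> the two path
  neighbours are elements \<open>x, y\<close> of the neighborhood semilattice of \<open>r\<close>, with values \<open>\<le> M\<close> and \<open>< M\<close>.
  The coefficients \<open>[C(u;x,y)]\<close> are nonnegative with sum 1, so submodularity yields either
  \<open>f (x \<sqinter> y) < M\<close> or some \<open>u \<in> I(x,y)\<close> other than \<open>x, y\<close> with \<open>f u < M\<close>; by induction on the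
  distance, \<open>x\<close> and \<open>y\<close> are joined by a chain of comparable elements with values \<open>< M\<close>.  It projects to a
  detour around \<open>r\<close>, so \<open>M\<close> was not minimal unless \<open>M = g p\<close>, and then the first step of the path leads
  to a Boolean neighbour of \<open>p\<close> with a smaller value.

  That the neighborhood semilattices are modular rests on the convexity of the principal filters and
  ideals of \<open>\<preceq>\<close> in the modular graph: gates give meets and joins, and medians give the Helly property.
\<close>

section \<open>Weighted walks and graph distances\<close>

text \<open>Two definitions resist direct use. A Boolean pair asks for some cube subgraph, and
  nothing in that visibly passes to subintervals, meets or joins; it is replaced by the condition
  that \<open>q\<close> is the join of the atoms of [p,q], which is self-dual and from which a cube
  can be rebuilt. The neighborhood semilattice is given by cubes and shortest paths of the
  2-subdivision. Its axioms are not derived from modularity of the 2-subdivision; instead it is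
  computed explicitly: its elements are the Boolean intervals containing \<open>p\<close>, ordered
  by inclusion, and its valuation has a closed form.

  The coefficients have sum 1 because [C] is the length that the cone cuts out of the segment x + y
  = 1, and the normal cones of a finite planar set tile the quadrant up to rays.\<close>

inductive weighted_walk :: "'a pair_pre_digraph \<Rightarrow> ('a \<times> 'a) weight_fun \<Rightarrow> 'a \<Rightarrow> real \<Rightarrow> 'a \<Rightarrow> bool"
  for G w where
  weighted_walk_Nil: "u \<in> pverts G \<Longrightarrow> weighted_walk G w u 0 u"
| weighted_walk_Cons: "(u, u') \<in> parcs G \<Longrightarrow> weighted_walk G w u' r v \<Longrightarrow>
    weighted_walk G w u (w (u, u') + r) v"

lemma weighted_walk_awalk:
  assumes "pair_wf_digraph G" "weighted_walk G w u r v"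
  shows "\<exists>p. pre_digraph.awalk (with_proj G) u p v \<and> wf_digraph.awalk_cost w p = r"
proof -
  interpret pair_wf_digraph G by fact
  from assms(2) show ?thesis
  proof induction
    case (weighted_walk_Nil u)
    then show ?case by (intro exI[of _ "[]"]) (simp add: awalk_Nil_iff)
  next
    case (weighted_walk_Cons u u' r v)
    then obtain p where "awalk u' p v" "awalk_cost w p = r" by auto
    with weighted_walk_Cons(1) show ?case
      by (intro exI[of _ "(u, u') # p"]) (auto simp: awalk_Cons_iff)
  qed
qed

lemma awalk_weighted_walk:
  assumes "pair_wf_digraph G" "pre_digraph.awalk (with_proj G) u p v"
  shows "weighted_walk G w u (wf_digraph.awalk_cost w p) v"
proof -
  interpret pair_wf_digraph G by fact
  from assms(2) show ?thesis
  proof (induction p arbitrary: u)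
    case Nil
    then show ?case by (auto simp: awalk_Nil_iff intro: weighted_walk_Nil)
  next
    case (Cons e p)
    then show ?case
      by (cases e) (auto simp: awalk_Cons_iff intro!: weighted_walk_Cons)
  qed
qed

lemma graph_dist_eqI:
  assumes wf: "pair_wf_digraph G" and walk: "weighted_walk G w u r v"
    and least: "\<And>s. weighted_walk G w u s v \<Longrightarrow> r \<le> s"
  shows "graph_dist G w u v = r"
proof -
  interpret pair_wf_digraph G by fact
  obtain p where p: "awalk u p v" "awalk_cost w p = r"
    using weighted_walk_awalk[OF wf walk] by auto
  have "\<mu> w u v = ereal r"
    unfolding \<mu>_def
  proof (rule INF_eqI)
    fix q assume "q \<in> {p. awalk u p v}"
    then show "ereal r \<le> ereal (awalk_cost w q)"
      using least awalk_weighted_walk[OF wf] by auto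
  next
    fix y assume "\<And>q. q \<in> {p. awalk u p v} \<Longrightarrow> y \<le> ereal (awalk_cost w q)"
    then show "y \<le> ereal r" using p by auto
  qed
  then show ?thesis unfolding graph_dist_def by simp
qed

lemma weighted_walk_potential:
  assumes "weighted_walk G w u r v"
    and "\<And>a b. (a, b) \<in> parcs G \<Longrightarrow> \<phi> a \<le> \<phi> b + w (a, b)"
  shows "\<phi> u \<le> \<phi> v + r"
  using assms(1)
proof induction
  case (weighted_walk_Cons u u' r v)
  then show ?case using assms(2)[of u u'] by simp
qed simp

lemma weighted_walk_trans:
  "weighted_walk G w u r v \<Longrightarrow> weighted_walk G w v s x \<Longrightarrow> weighted_walk G w u (r + s) x"
proof (induction rule: weighted_walk.induct)
  case (weighted_walk_Cons u u' r v)
  then show ?case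
    using weighted_walk.weighted_walk_Cons[of u u' G w "r + s" x] by (simp add: add.assoc)
qed simp

text \<open>A dual certificate for shortest paths: a potential that drops by at most the weight
  along every arc bounds all walk costs from below, so a walk attaining the potential difference is
  optimal. Both the metric of a semilattice and the valuation of a neighborhood semilattice are
  computed this way.\<close>

lemma graph_dist_potential:
  assumes "pair_wf_digraph G" "weighted_walk G w u (\<phi> u - \<phi> v) v"
    and "\<And>a b. (a, b) \<in> parcs G \<Longrightarrow> \<phi> a \<le> \<phi> b + w (a, b)"
  shows "graph_dist G w u v = \<phi> u - \<phi> v"
proof (rule graph_dist_eqI[OF assms(1,2)])
  fix s assume "weighted_walk G w u s v"
  then have "\<phi> u \<le> \<phi> v + s" by (rule weighted_walk_potential) (rule assms(3))
  then show "\<phi> u - \<phi> v \<le> s" by simp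
qed

text \<open>A copy of the unit-length metric with values in \<open>nat\<close>, so that geodesics
  are relational powers and induction on distance is available. It stands for
  \<open>graph_dist\<close> on reachable pairs only; without a walk the \<open>LEAST\<close> is
  unspecified.\<close>

definition udist :: "'a pair_pre_digraph \<Rightarrow> 'a \<Rightarrow> 'a \<Rightarrow> nat" where
  "udist G u v = (LEAST n. (u, v) \<in> parcs G ^^ n)"

lemma udist_le: "(u, v) \<in> parcs G ^^ n \<Longrightarrow> udist G u v \<le> n"
  unfolding udist_def by (rule Least_le)

lemma weighted_walk_unit_relpow:
  "weighted_walk G (\<lambda>_. 1) u r v \<Longrightarrow> \<exists>n. r = real n \<and> (u, v) \<in> parcs G ^^ n"
proof (induction rule: weighted_walk.induct)
  case (weighted_walk_Nil u)
  then show ?case by (intro exI[of _ 0]) simp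
next
  case (weighted_walk_Cons u u' r v)
  then obtain n where "r = real n" "(u', v) \<in> parcs G ^^ n" by auto
  with weighted_walk_Cons(1) show ?case
    using relpow_Suc_I2[of u u' "parcs G" v n] by (intro exI[of _ "Suc n"]) simp
qed

lemma relpow_weighted_walk_unit:
  assumes "pair_wf_digraph G" "u \<in> pverts G" "(u, v) \<in> parcs G ^^ n"
  shows "weighted_walk G (\<lambda>_. 1) u (real n) v"
  using assms(2,3)
proof (induction n arbitrary: u)
  case 0
  then show ?case by (auto intro: weighted_walk_Nil)
next
  case (Suc n)
  interpret pair_wf_digraph G by fact
  obtain u' where u': "(u, u') \<in> parcs G" "(u', v) \<in> parcs G ^^ n"
    using relpow_Suc_D2[OF Suc.prems(2)] by blast
  then have "u' \<in> pverts G" by (auto dest: in_arcsD2)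
  from weighted_walk_Cons[OF u'(1) Suc.IH[OF this u'(2)]] show ?case by simp
qed

lemma graph_dist_unit:
  assumes "pair_wf_digraph G" "u \<in> pverts G" "(u, v) \<in> (parcs G)\<^sup>*"
  shows "graph_dist G (\<lambda>_. 1) u v = real (udist G u v)"
proof (rule graph_dist_eqI[OF assms(1)])
  have "\<exists>n. (u, v) \<in> parcs G ^^ n" using assms(3) by (simp add: rtrancl_power)
  then have "(u, v) \<in> parcs G ^^ udist G u v" unfolding udist_def by (rule LeastI_ex)
  then show "weighted_walk G (\<lambda>_. 1) u (real (udist G u v)) v"
    by (rule relpow_weighted_walk_unit[OF assms(1,2)])
next
  fix s assume "weighted_walk G (\<lambda>_. 1) u s v"
  then show "real (udist G u v) \<le> s"
    by (auto dest!: weighted_walk_unit_relpow intro: udist_le)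
qed

section \<open>The metric of a valued modular semilattice\<close>

text \<open>The axioms of a modular semilattice with valuation, in the form in which they are used.
  The identity for \<open>v\<close> and its strictness encode modularity of the intervals; the
  triple condition speaks of upper bounds because \<open>join_ex\<close> turns bounds into
  joins.\<close>

locale valued_semilattice = lower_semilattice L for L :: "'a gorder" (structure) +
  fixes v :: "'a \<Rightarrow> real"
  assumes fin: "finite (carrier L)"
    and v_strict: "\<lbrakk>x \<sqsubset> y; x \<in> carrier L; y \<in> carrier L\<rbrakk> \<Longrightarrow> v x < v y"
    and join_ex: "\<lbrakk>x \<in> carrier L; y \<in> carrier L; z \<in> carrier L; x \<sqsubseteq> z; y \<sqsubseteq> z\<rbrakk> \<Longrightarrow>
      \<exists>j\<in>carrier L. x \<sqsubseteq> j \<and> y \<sqsubseteq> j \<and> (\<forall>w\<in>carrier L. x \<sqsubseteq> w \<longrightarrow> y \<sqsubseteq> w \<longrightarrow> j \<sqsubseteq> w) \<and>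
        v j + v (x \<sqinter> y) = v x + v y"
    and triple_bound: "\<lbrakk>x \<in> carrier L; y \<in> carrier L; z \<in> carrier L;
      \<exists>a\<in>carrier L. x \<sqsubseteq> a \<and> y \<sqsubseteq> a; \<exists>a\<in>carrier L. y \<sqsubseteq> a \<and> z \<sqsubseteq> a;
      \<exists>a\<in>carrier L. x \<sqsubseteq> a \<and> z \<sqsubseteq> a\<rbrakk> \<Longrightarrow> \<exists>a\<in>carrier L. x \<sqsubseteq> a \<and> y \<sqsubseteq> a \<and> z \<sqsubseteq> a"
begin

lemma v_mono: "\<lbrakk>x \<sqsubseteq> y; x \<in> carrier L; y \<in> carrier L\<rbrakk> \<Longrightarrow> v x \<le> v y"
  using v_strict[of x y] by (cases "x = y") (auto simp: lless_eq)

lemma v_eq_imp_eq: "\<lbrakk>x \<sqsubseteq> y; v x = v y; x \<in> carrier L; y \<in> carrier L\<rbrakk> \<Longrightarrow> x = y"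
  using v_strict[of x y] by (auto simp: lless_eq)

lemma meet_comm: "\<lbrakk>x \<in> carrier L; y \<in> carrier L\<rbrakk> \<Longrightarrow> x \<sqinter> y = y \<sqinter> x"
  by (intro le_antisym meet_le meet_left meet_right meet_closed)

lemma meet_eq_left: "\<lbrakk>x \<sqsubseteq> y; x \<in> carrier L; y \<in> carrier L\<rbrakk> \<Longrightarrow> x \<sqinter> y = x"
  by (intro le_antisym meet_le meet_left meet_closed) auto

lemma meet_le1: "\<lbrakk>x \<sqsubseteq> z; x \<in> carrier L; y \<in> carrier L; z \<in> carrier L\<rbrakk> \<Longrightarrow> x \<sqinter> y \<sqsubseteq> z"
  and meet_le2: "\<lbrakk>y \<sqsubseteq> z; x \<in> carrier L; y \<in> carrier L; z \<in> carrier L\<rbrakk> \<Longrightarrow> x \<sqinter> y \<sqsubseteq> z"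
  by (meson le_trans meet_left meet_right meet_closed)+

lemma v_supermodular:
  assumes "x \<sqsubseteq> z" "y \<sqsubseteq> z" "x \<in> carrier L" "y \<in> carrier L" "z \<in> carrier L"
  shows "v x + v y \<le> v z + v (x \<sqinter> y)"
proof -
  obtain j where j: "j \<in> carrier L" "x \<sqsubseteq> j" "y \<sqsubseteq> j" "j \<sqsubseteq> z" "v j + v (x \<sqinter> y) = v x + v y"
    using join_ex[of x y z] assms by blast
  with v_mono[of j z] assms show ?thesis by auto
qed

text \<open>The cost of descending from \<open>x\<close> to the meet and climbing to
  \<open>y\<close>; \<open>semilattice_dist_eq\<close> shows that no path of the covering graph is
  shorter.\<close>

definition sdist :: "'a \<Rightarrow> 'a \<Rightarrow> real" where
  "sdist x y = v x + v y - 2 * v (x \<sqinter> y)"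

text \<open>The meet with \<open>x\<close> grows, by monotonicity, and its value grows by at most v
  z - v y, by supermodularity below \<open>z\<close> applied to x \<sqinter> z and
  \<open>y\<close>.\<close>

lemma sdist_step_up:
  assumes "y \<sqsubseteq> z" "x \<in> carrier L" "y \<in> carrier L" "z \<in> carrier L"
  shows "\<bar>sdist x y - sdist x z\<bar> \<le> v z - v y"
proof -
  have c: "x \<sqinter> y \<in> carrier L" "x \<sqinter> z \<in> carrier L" using assms by auto
  have "x \<sqinter> y \<sqsubseteq> x \<sqinter> z"
    using assms c by (meson meet_le meet_left meet_right le_trans)
  then have "v (x \<sqinter> y) \<le> v (x \<sqinter> z)" using c by (intro v_mono)
  moreover have "v (x \<sqinter> z) + v y \<le> v z + v ((x \<sqinter> z) \<sqinter> y)"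
    using assms c by (intro v_supermodular) (auto intro: meet_right)
  moreover have "v ((x \<sqinter> z) \<sqinter> y) \<le> v (x \<sqinter> y)"
    using assms c by (intro v_mono meet_le) (auto intro: meet_right meet_le1 meet_left)
  ultimately show ?thesis unfolding sdist_def by linarith
qed

definition cov_weight :: "('a \<times> 'a) weight_fun" where
  "cov_weight = (\<lambda>(p, q). if covers L p q then v q - v p else v p - v q)"

lemma covers_asym: "covers L x y \<Longrightarrow> \<not> covers L y x"
  unfolding covers_def by (auto simp: lless_eq intro: le_antisym)

lemma wf_covering_graph: "pair_wf_digraph (covering_graph L)"
  by unfold_locales (auto simp: covering_graph_def covers_def)

text \<open>Splitting at an intermediate element shrinks the interval on both sides, so the walk
  follows a maximal chain and its cost telescopes. Both directions are carried along because a
  shortest path goes down to the meet and then up.\<close>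

lemma walk_up:
  assumes "x \<sqsubseteq> y" "x \<in> carrier L" "y \<in> carrier L"
  shows "weighted_walk (covering_graph L) cov_weight x (v y - v x) y
    \<and> weighted_walk (covering_graph L) cov_weight y (v y - v x) x"
  using assms
proof (induction "card {z \<in> carrier L. x \<sqsubseteq> z \<and> z \<sqsubseteq> y}" arbitrary: x y rule: less_induct)
  case less
  show ?case
  proof (cases "x = y")
    case True
    then show ?thesis using less.prems by (auto intro: weighted_walk_Nil simp: covering_graph_def)
  next
    case ne: False
    show ?thesis
    proof (cases "covers L x y")
      case True
      have "weighted_walk (covering_graph L) cov_weight x (cov_weight (x, y) + 0) y"
        and "weighted_walk (covering_graph L) cov_weight y (cov_weight (y, x) + 0) x"
        using True less.prems
        by (intro weighted_walk_Cons weighted_walk_Nil; simp add: covering_graph_def)+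
      then show ?thesis using True covers_asym[OF True] by (simp add: cov_weight_def)
    next
      case False
      then obtain r where r: "r \<in> carrier L" "x \<sqsubset> r" "r \<sqsubset> y"
        using less.prems ne unfolding covers_def by (auto simp: lless_eq)
      let ?I = "\<lambda>x y. {z \<in> carrier L. x \<sqsubseteq> z \<and> z \<sqsubseteq> y}"
      have f: "finite (?I x y)" using fin by simp
      have xr: "x \<sqsubseteq> r" "x \<noteq> r" "r \<sqsubseteq> y" "r \<noteq> y" using r by (auto simp: lless_eq)
      have "?I x r \<subset> ?I x y"
        using xr r less.prems by (blast intro: le_trans le_antisym refl)
      then have "card (?I x r) < card (?I x y)" by (rule psubset_card_mono[OF f])
      from less.hyps[OF this xr(1) less.prems(2) r(1)]
      have 1: "weighted_walk (covering_graph L) cov_weight x (v r - v x) r"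
        "weighted_walk (covering_graph L) cov_weight r (v r - v x) x" by auto
      have "?I r y \<subset> ?I x y"
        using xr r less.prems by (blast intro: le_trans le_antisym refl)
      then have "card (?I r y) < card (?I x y)" by (rule psubset_card_mono[OF f])
      from less.hyps[OF this xr(3) r(1) less.prems(3)]
      have 2: "weighted_walk (covering_graph L) cov_weight r (v y - v r) y"
        "weighted_walk (covering_graph L) cov_weight y (v y - v r) r" by auto
      show ?thesis
        using weighted_walk_trans[OF 1(1) 2(1)] weighted_walk_trans[OF 2(2) 1(2)] by simp
    qed
  qed
qed

lemma semilattice_dist_eq:
  assumes "x \<in> carrier L" "y \<in> carrier L"
  shows "semilattice_dist L v x y = sdist x y"
proof -
  have c: "x \<sqinter> y \<in> carrier L" using assms by auto
  have yy: "y \<sqinter> y = y" using assms by (intro meet_eq_left) auto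
  have "graph_dist (covering_graph L) cov_weight x y = sdist y x - sdist y y"
  proof (rule graph_dist_potential[OF wf_covering_graph, of _ _ "sdist y"])
    have "weighted_walk (covering_graph L) cov_weight x (v x - v (x \<sqinter> y) + (v y - v (x \<sqinter> y))) y"
      using walk_up[of "x \<sqinter> y" x] walk_up[of "x \<sqinter> y" y] assms c meet_left meet_right
      by (blast intro: weighted_walk_trans)
    then show "weighted_walk (covering_graph L) cov_weight x (sdist y x - sdist y y) y"
      unfolding sdist_def yy meet_comm[OF assms(2,1)] by (simp add: algebra_simps)
  next
    fix a b assume "(a, b) \<in> parcs (covering_graph L)"
    then show "sdist y a \<le> sdist y b + cov_weight (a, b)"
      using sdist_step_up[of a b y] sdist_step_up[of b a y] assms covers_asym[of b a]
      by (auto simp: covering_graph_def cov_weight_def covers_def lless_eq)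
  qed
  then show ?thesis
    unfolding semilattice_dist_def sdist_def yy meet_comm[OF assms(2,1)] cov_weight_def by simp
qed

lemma sdist_pos:
  assumes "x \<in> carrier L" "y \<in> carrier L" "x \<noteq> y"
  shows "0 < sdist x y"
proof -
  have m: "x \<sqinter> y \<in> carrier L" "x \<sqinter> y \<sqsubseteq> x" "x \<sqinter> y \<sqsubseteq> y"
    using assms by (auto intro: meet_left meet_right)
  have "v (x \<sqinter> y) \<noteq> v x \<or> v (x \<sqinter> y) \<noteq> v y"
    using assms m v_eq_imp_eq by metis
  with v_mono[OF m(2)] v_mono[OF m(3)] m assms show ?thesis unfolding sdist_def by linarith
qed

lemma metric_interval_alt:
  assumes "x \<in> carrier L" "y \<in> carrier L"
  shows "metric_interval L v x y = {u \<in> carrier L. sdist x u + sdist u y = sdist x y}"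
  unfolding metric_interval_def using assms by (auto simp: semilattice_dist_eq)

text \<open>The equation is the valuation identity for u \<sqinter> x and u \<sqinter> y with join
  \<open>u\<close> and meet x \<sqinter> y: the interval consists of joins of an element of
  [x \<sqinter> y, x] and one of [x \<sqinter> y, y].\<close>

lemma metric_interval_iff:
  assumes "x \<in> carrier L" "y \<in> carrier L" "u \<in> carrier L"
  shows "u \<in> metric_interval L v x y \<longleftrightarrow> v u + v (x \<sqinter> y) = v (u \<sqinter> x) + v (u \<sqinter> y)"
  using assms by (auto simp: metric_interval_alt sdist_def meet_comm)

lemma finite_metric_interval [simp]: "finite (metric_interval L v x y)"
  using fin by (auto simp: metric_interval_def)

text \<open>The meet of u \<sqinter> x and u \<sqinter> y lies below x \<sqinter> y, and
  supermodularity below \<open>u\<close> gives it at least the same value; strictness makes the two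
  equal.\<close>

lemma metric_interval_meet_le:
  assumes "x \<in> carrier L" "y \<in> carrier L" "u \<in> metric_interval L v x y"
  shows "x \<sqinter> y \<sqsubseteq> u"
proof -
  have u: "u \<in> carrier L" using assms(3) by (simp add: metric_interval_def)
  have c: "u \<sqinter> x \<in> carrier L" "u \<sqinter> y \<in> carrier L" "x \<sqinter> y \<in> carrier L"
    "(u \<sqinter> x) \<sqinter> (u \<sqinter> y) \<in> carrier L"
    using assms u by auto
  have le: "u \<sqinter> x \<sqsubseteq> u" "u \<sqinter> x \<sqsubseteq> x" "u \<sqinter> y \<sqsubseteq> u" "u \<sqinter> y \<sqsubseteq> y"
    "(u \<sqinter> x) \<sqinter> (u \<sqinter> y) \<sqsubseteq> u \<sqinter> x" "(u \<sqinter> x) \<sqinter> (u \<sqinter> y) \<sqsubseteq> u \<sqinter> y"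
    using assms u c by (auto intro: meet_left meet_right)
  have "(u \<sqinter> x) \<sqinter> (u \<sqinter> y) \<sqsubseteq> x \<sqinter> y"
    using assms u c le by (meson meet_le le_trans)
  moreover have "v ((u \<sqinter> x) \<sqinter> (u \<sqinter> y)) \<ge> v (x \<sqinter> y)"
    using v_supermodular[OF le(1,3)] assms metric_interval_iff[of x y u] u c by linarith
  ultimately have "(u \<sqinter> x) \<sqinter> (u \<sqinter> y) = x \<sqinter> y"
    using c v_mono[of "(u \<sqinter> x) \<sqinter> (u \<sqinter> y)" "x \<sqinter> y"]
    by (intro v_eq_imp_eq) auto
  then show ?thesis using le c u by (metis le_trans)
qed

text \<open>The join \<open>w\<close> of \<open>c\<close> and \<open>e\<close> has no larger traces
  than \<open>c\<close> and \<open>e\<close>: supermodularity below \<open>w\<close> bounds the sum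
  of the values of w \<sqinter> x and w \<sqinter> y by v c + v e, while these traces lie above
  \<open>c\<close> and \<open>e\<close>.\<close>

lemma metric_interval_joinI:
  assumes "x \<in> carrier L" "y \<in> carrier L" "c \<in> carrier L" "e \<in> carrier L" "z \<in> carrier L"
    and "x \<sqinter> y \<sqsubseteq> c" "c \<sqsubseteq> x" "x \<sqinter> y \<sqsubseteq> e" "e \<sqsubseteq> y" "c \<sqsubseteq> z" "e \<sqsubseteq> z"
  shows "\<exists>w\<in>metric_interval L v x y. w \<sqinter> x = c \<and> w \<sqinter> y = e"
proof -
  have m: "x \<sqinter> y \<in> carrier L" "c \<sqinter> e \<in> carrier L" using assms by auto
  obtain w where w: "w \<in> carrier L" "c \<sqsubseteq> w" "e \<sqsubseteq> w" "v w + v (c \<sqinter> e) = v c + v e"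
    using join_ex[of c e z] assms by blast
  have wc: "w \<sqinter> x \<in> carrier L" "w \<sqinter> y \<in> carrier L" "(w \<sqinter> x) \<sqinter> (w \<sqinter> y) \<in> carrier L"
    using assms w by auto
  have "c \<sqinter> e \<sqsubseteq> x \<sqinter> y"
    using assms m by (meson meet_le meet_left meet_right le_trans)
  moreover have "x \<sqinter> y \<sqsubseteq> c \<sqinter> e" using assms m by (intro meet_le)
  ultimately have ce: "c \<sqinter> e = x \<sqinter> y" using m le_antisym by blast
  have cw: "c \<sqsubseteq> w \<sqinter> x" "e \<sqsubseteq> w \<sqinter> y" using assms w by (auto intro: meet_le)
  have "v (w \<sqinter> x) + v (w \<sqinter> y) \<le> v w + v ((w \<sqinter> x) \<sqinter> (w \<sqinter> y))"
    using w wc assms by (intro v_supermodular) (auto intro: meet_left)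
  moreover have "v ((w \<sqinter> x) \<sqinter> (w \<sqinter> y)) \<le> v (x \<sqinter> y)"
    using w wc m assms by (intro v_mono meet_le) (auto intro: meet_right meet_le1 meet_le2)
  moreover have "v c \<le> v (w \<sqinter> x)" "v e \<le> v (w \<sqinter> y)" using cw wc assms by (auto intro: v_mono)
  ultimately have eq: "v (w \<sqinter> x) = v c" "v (w \<sqinter> y) = v e"
    using w(4) unfolding ce by linarith+
  then have "w \<sqinter> x = c" "w \<sqinter> y = e"
    using v_eq_imp_eq[OF cw(1)] v_eq_imp_eq[OF cw(2)] wc assms by auto
  moreover have "w \<in> metric_interval L v x y"
    using metric_interval_iff[of x y w] assms w eq ce by auto
  ultimately show ?thesis by blast
qed

text \<open>Let \<open>u = a \<squnion> b\<close> and \<open>u' = a' \<squnion> b'\<close> have the same value point.  Then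
  \<open>(a \<sqinter> a') \<squnion> (b \<squnion> b')\<close> and \<open>(a \<squnion> a') \<squnion> (b \<sqinter> b')\<close> exist, and the midpoint of their value points
  is that of \<open>u\<close>; extremality makes the exchange trivial.\<close>

lemma extremal_set_inj:
  assumes xy: "x \<in> carrier L" "y \<in> carrier L"
  shows "inj_on (val_point L v x y) (extremal_set L v x y)"
proof (rule inj_onI)
  fix u u'
  assume u: "u \<in> extremal_set L v x y" and u': "u' \<in> extremal_set L v x y"
    and eq: "val_point L v x y u = val_point L v x y u'"
  let ?I = "metric_interval L v x y" and ?P = "val_point L v x y"
  have I: "u \<in> ?I" "u' \<in> ?I" using u u' by (auto simp: extremal_set_def)
  then have uc: "u \<in> carrier L" "u' \<in> carrier L" by (auto simp: metric_interval_def)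
  define a b a' b' where ab: "a = u \<sqinter> x" "b = u \<sqinter> y" "a' = u' \<sqinter> x" "b' = u' \<sqinter> y"
  have c: "a \<in> carrier L" "b \<in> carrier L" "a' \<in> carrier L" "b' \<in> carrier L"
    "x \<sqinter> y \<in> carrier L" "a \<sqinter> a' \<in> carrier L" "b \<sqinter> b' \<in> carrier L"
    using ab uc xy by auto
  have le: "a \<sqsubseteq> u" "b \<sqsubseteq> u" "a' \<sqsubseteq> u'" "b' \<sqsubseteq> u'" "a \<sqsubseteq> x" "a' \<sqsubseteq> x" "b \<sqsubseteq> y" "b' \<sqsubseteq> y"
    "a \<sqinter> a' \<sqsubseteq> a" "a \<sqinter> a' \<sqsubseteq> a'" "b \<sqinter> b' \<sqsubseteq> b" "b \<sqinter> b' \<sqsubseteq> b'"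
    using ab uc xy c by (auto intro: meet_left meet_right)
  have "x \<sqinter> y \<sqsubseteq> u" "x \<sqinter> y \<sqsubseteq> u'" using metric_interval_meet_le xy I by auto
  then have m: "x \<sqinter> y \<sqsubseteq> a" "x \<sqinter> y \<sqsubseteq> b" "x \<sqinter> y \<sqsubseteq> a'" "x \<sqinter> y \<sqsubseteq> b'"
    using ab uc xy c by (auto intro!: meet_le meet_left meet_right)
  then have m2: "x \<sqinter> y \<sqsubseteq> a \<sqinter> a'" "x \<sqinter> y \<sqsubseteq> b \<sqinter> b'" using c by (auto intro: meet_le)
  have veq: "v a = v a'" "v b = v b'" using eq ab by (auto simp: val_point_def)
  \<comment> \<open>The pairwise bounds are \<open>u\<close>, \<open>y\<close> and
    \<open>u'\<close>; for the second exchange they are \<open>u\<close>, \<open>x\<close> and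
    \<open>u'\<close>.\<close>
  have "\<exists>z\<in>carrier L. a \<sqinter> a' \<sqsubseteq> z \<and> b \<sqsubseteq> z \<and> b' \<sqsubseteq> z"
  proof (rule triple_bound)
    show "\<exists>z\<in>carrier L. a \<sqinter> a' \<sqsubseteq> z \<and> b \<sqsubseteq> z" using le c uc le_trans[of "a \<sqinter> a'" a u] by blast
    show "\<exists>z\<in>carrier L. b \<sqsubseteq> z \<and> b' \<sqsubseteq> z" using le xy by blast
    show "\<exists>z\<in>carrier L. a \<sqinter> a' \<sqsubseteq> z \<and> b' \<sqsubseteq> z" using le c uc le_trans[of "a \<sqinter> a'" a' u'] by blast
  qed (use c in auto)
  then obtain z1 where z1: "z1 \<in> carrier L" "a \<sqinter> a' \<sqsubseteq> z1" "b \<sqsubseteq> z1" "b' \<sqsubseteq> z1" by blast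
  obtain j1 where j1: "j1 \<in> carrier L" "b \<sqsubseteq> j1" "b' \<sqsubseteq> j1"
     "\<forall>w\<in>carrier L. b \<sqsubseteq> w \<longrightarrow> b' \<sqsubseteq> w \<longrightarrow> j1 \<sqsubseteq> w" "v j1 + v (b \<sqinter> b') = v b + v b'"
    using join_ex[of b b' y] c le xy by blast
  have "\<exists>z\<in>carrier L. a \<sqsubseteq> z \<and> a' \<sqsubseteq> z \<and> b \<sqinter> b' \<sqsubseteq> z"
  proof (rule triple_bound)
    show "\<exists>z\<in>carrier L. a \<sqsubseteq> z \<and> b \<sqinter> b' \<sqsubseteq> z" using le c uc le_trans[of "b \<sqinter> b'" b u] by blast
    show "\<exists>z\<in>carrier L. a \<sqsubseteq> z \<and> a' \<sqsubseteq> z" using le xy by blast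
    show "\<exists>z\<in>carrier L. a' \<sqsubseteq> z \<and> b \<sqinter> b' \<sqsubseteq> z" using le c uc le_trans[of "b \<sqinter> b'" b' u'] by blast
  qed (use c in auto)
  then obtain z2 where z2: "z2 \<in> carrier L" "a \<sqsubseteq> z2" "a' \<sqsubseteq> z2" "b \<sqinter> b' \<sqsubseteq> z2" by blast
  obtain j2 where j2: "j2 \<in> carrier L" "a \<sqsubseteq> j2" "a' \<sqsubseteq> j2"
     "\<forall>w\<in>carrier L. a \<sqsubseteq> w \<longrightarrow> a' \<sqsubseteq> w \<longrightarrow> j2 \<sqsubseteq> w" "v j2 + v (a \<sqinter> a') = v a + v a'"
    using join_ex[of a a' x] c le xy by blast
  have "\<exists>w\<in>?I. w \<sqinter> x = a \<sqinter> a' \<and> w \<sqinter> y = j1"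
    using j1 z1 c xy le m m2
    by (intro metric_interval_joinI[of _ _ _ _ z1]) (auto intro: le_trans[of _ a] le_trans[of _ b])
  then obtain w1 where w1: "w1 \<in> ?I" "w1 \<sqinter> x = a \<sqinter> a'" "w1 \<sqinter> y = j1" by blast
  have "\<exists>w\<in>?I. w \<sqinter> x = j2 \<and> w \<sqinter> y = b \<sqinter> b'"
    using j2 z2 c xy le m m2
    by (intro metric_interval_joinI[of _ _ _ _ z2]) (auto intro: le_trans[of _ a] le_trans[of _ b])
  then obtain w2 where w2: "w2 \<in> ?I" "w2 \<sqinter> x = j2" "w2 \<sqinter> y = b \<sqinter> b'" by blast
  have mid: "?P u = (1/2) *\<^sub>R (?P w1 + ?P w2)"
    unfolding val_point_def w1 w2 using j1(5) j2(5) veq ab by (simp add: field_simps)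
  have hull: "?P w1 \<in> conv_interval L v x y" "?P w2 \<in> conv_interval L v x y"
    using w1 w2 by (auto simp: conv_interval_def intro: hull_inc)
  have "?P w1 = ?P w2"
  proof (rule ccontr)
    assume ne: "?P w1 \<noteq> ?P w2"
    have "?P u = (1 - 1/2) *\<^sub>R ?P w1 + (1/2) *\<^sub>R ?P w2"
      unfolding mid by (simp add: scaleR_add_right)
    then have "?P u \<in> open_segment (?P w1) (?P w2)"
      using ne unfolding in_segment by (intro conjI exI[of _ "1/2"]) auto
    then show False using u hull by (auto simp: extremal_set_def extreme_point_of_def)
  qed
  then have "v (a \<sqinter> a') = v a" "v (b \<sqinter> b') = v b"
    unfolding val_point_def w1 w2 using j1(5) j2(5) veq by auto
  then have "a \<sqinter> a' = a" "a \<sqinter> a' = a'" "b \<sqinter> b' = b" "b \<sqinter> b' = b'"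
    using veq le c by (auto intro!: v_eq_imp_eq)
  then have aa: "a = a'" "b = b'" by auto
  have vu: "v u + v (x \<sqinter> y) = v a + v b" "v u' + v (x \<sqinter> y) = v a + v b"
    using metric_interval_iff xy uc I ab aa by auto
  \<comment> \<open>The join of \<open>a\<close> and \<open>b\<close> lies below both
    \<open>u\<close> and \<open>u'\<close> and has at least their value, hence it equals
    both.\<close>
  obtain j where j: "j \<in> carrier L" "j \<sqsubseteq> u" "j \<sqsubseteq> u'" "v j + v (a \<sqinter> b) = v a + v b"
    using join_ex[of a b u] c le uc aa by metis
  have "v (a \<sqinter> b) \<le> v (x \<sqinter> y)"
    using c le xy by (intro v_mono meet_le) (meson le_trans meet_left meet_right meet_closed)+
  then have "v u \<le> v j" "v u' \<le> v j" using j vu by auto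
  then show "u = u'"
    using v_eq_imp_eq[of j u] v_eq_imp_eq[of j u'] v_mono[of j u] v_mono[of j u'] j uc by fastforce
qed

end

section \<open>Planar normal cones\<close>

text \<open>The measure of a cone is the length of its trace on the segment \<open>x + y = 1\<close>: the direction with
  angle \<open>\<theta>\<close> meets this segment at height \<open>sin \<theta> / (cos \<theta> + sin \<theta>)\<close>.\<close>

definition cone_slice :: "(real \<times> real) set \<Rightarrow> real set" where
  "cone_slice C = {t. 0 \<le> t \<and> t \<le> 1 \<and> (1 - t, t) \<in> C}"

lemma cos_sin_pos:
  fixes \<theta> :: real
  assumes "0 \<le> \<theta>" "\<theta> \<le> pi / 2"
  shows "0 \<le> sin \<theta>" "0 \<le> cos \<theta>" "0 < cos \<theta> + sin \<theta>"
proof -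
  show s: "0 \<le> sin \<theta>" using assms by (intro sin_ge_zero) auto
  show c: "0 \<le> cos \<theta>" using assms by (intro cos_ge_zero) auto
  have "cos \<theta> + sin \<theta> \<noteq> 0"
  proof
    assume "cos \<theta> + sin \<theta> = 0"
    then have "sin \<theta> = 0" "cos \<theta> = 0" using s c by linarith+
    then show False using sin_cos_squared_add[of \<theta>] by simp
  qed
  then show "0 < cos \<theta> + sin \<theta>" using s c by linarith
qed

definition slice_height :: "real \<Rightarrow> real" where
  "slice_height \<theta> = sin \<theta> / (cos \<theta> + sin \<theta>)"

lemma slice_height_range:
  assumes "0 \<le> \<theta>" "\<theta> \<le> pi / 2"
  shows "0 \<le> slice_height \<theta>" "slice_height \<theta> \<le> 1"
  using cos_sin_pos[OF assms] by (auto simp: slice_height_def)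

lemma slice_height_surj:
  assumes "0 \<le> \<theta>" "\<theta> \<le> pi / 2" "slice_height \<theta> \<le> t" "t \<le> 1"
  shows "\<exists>\<alpha>\<ge>\<theta>. \<alpha> \<le> pi / 2 \<and> slice_height \<alpha> = t"
proof (rule IVT')
  show "continuous_on {\<theta>..pi / 2} slice_height"
    unfolding slice_height_def
  proof (intro continuous_intros ballI)
    fix x assume "x \<in> {\<theta>..pi / 2}"
    then show "cos x + sin x \<noteq> 0" using cos_sin_pos(3)[of x] assms(1) by simp
  qed
qed (use assms in \<open>auto simp: slice_height_def\<close>)

text \<open>On the segment both cone inequalities become affine in \<open>t\<close>, with thresholds
  \<open>slice_height \<alpha>\<close> and \<open>slice_height \<beta>\<close>.\<close>

lemma cone_slice_angular_cone:
  assumes "0 \<le> \<beta>" "\<beta> \<le> \<alpha>" "\<alpha> \<le> pi / 2"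
  shows "cone_slice (angular_cone \<alpha> \<beta>) = {slice_height \<beta>..slice_height \<alpha>}"
proof -
  have a: "0 < cos \<alpha> + sin \<alpha>" "0 < cos \<beta> + sin \<beta>" using cos_sin_pos(3) assms by auto
  have id: "- (1 - t) * s + t * c = t * (c + s) - s" for s c t :: real by algebra
  have "- (1 - t) * sin \<alpha> + t * cos \<alpha> \<le> 0 \<longleftrightarrow> t \<le> slice_height \<alpha>" for t
    unfolding id slice_height_def pos_le_divide_eq[OF a(1)] by linarith
  moreover have "- (1 - t) * sin \<beta> + t * cos \<beta> \<ge> 0 \<longleftrightarrow> slice_height \<beta> \<le> t" for t
    unfolding id slice_height_def pos_divide_le_eq[OF a(2)] by linarith
  ultimately have "(1 - t, t) \<in> angular_cone \<alpha> \<beta> \<longleftrightarrow>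
      0 \<le> 1 - t \<and> 0 \<le> t \<and> t \<le> slice_height \<alpha> \<and> slice_height \<beta> \<le> t" for t
    unfolding angular_cone_def mem_Collect_eq prod.case by blast
  moreover have "slice_height \<alpha> \<le> 1" "0 \<le> slice_height \<beta>"
    using assms by (intro slice_height_range; linarith)+
  ultimately have "t \<in> cone_slice (angular_cone \<alpha> \<beta>) \<longleftrightarrow> slice_height \<beta> \<le> t \<and> t \<le> slice_height \<alpha>" for t
    unfolding cone_slice_def mem_Collect_eq by (smt (verit))
  then show ?thesis by (simp add: set_eq_iff)
qed

text \<open>Every nonzero point of the quadrant is a positive multiple of exactly one point of the
  segment, so its ray is recovered from the slice; only the origin has to be supplied
  separately.\<close>

lemma cone_eq_if_slice_eq:
  assumes "\<And>C w. C \<in> {A, B} \<Longrightarrow> w \<in> C \<Longrightarrow> 0 \<le> fst w \<and> 0 \<le> snd w"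
    and "\<And>C. C \<in> {A, B} \<Longrightarrow> 0 \<in> C"
    and "\<And>C w r. C \<in> {A, B} \<Longrightarrow> w \<in> C \<Longrightarrow> 0 \<le> r \<Longrightarrow> r *\<^sub>R w \<in> C"
    and "cone_slice A = cone_slice B"
  shows "A = B"
proof -
  have "D \<subseteq> E" if DE: "D \<in> {A, B}" "E \<in> {A, B}" and s: "cone_slice D = cone_slice E" for D E
  proof
    fix w assume w: "w \<in> D"
    then have pos: "0 \<le> fst w" "0 \<le> snd w" using assms(1) DE by auto
    define r where "r = fst w + snd w"
    show "w \<in> E"
    proof (cases "r = 0")
      case True
      then have "w = 0" using pos by (auto simp: r_def prod_eq_iff)
      then show ?thesis using assms(2) DE by auto
    next
      case False
      then have r: "0 < r" using pos by (auto simp: r_def)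
      have eq: "(1 - snd w / r, snd w / r) = (1 / r) *\<^sub>R w"
        using r by (auto simp: prod_eq_iff field_simps r_def)
      then have "(1 - snd w / r, snd w / r) \<in> D"
        using assms(3)[OF DE(1) w, of "1 / r"] r by simp
      then have "snd w / r \<in> cone_slice D"
        using r pos by (auto simp: cone_slice_def r_def)
      then have "snd w / r \<in> cone_slice E" using s by simp
      then have "(1 / r) *\<^sub>R w \<in> E" unfolding cone_slice_def eq[symmetric] by blast
      from assms(3)[OF DE(2) this, of r] show ?thesis using r by simp
    qed
  qed
  then show ?thesis using assms(4) by blast
qed

text \<open>Resolves the definite description. Suitable angles exist by the intermediate value
  theorem; for uniqueness only the difference of the two heights matters, and the end points of the
  slice fix it. An empty slice means the cone {0}, whose value is 0 by definition.\<close>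

lemma cone_measure_eq:
  assumes pos: "\<And>w. w \<in> C \<Longrightarrow> 0 \<le> fst w \<and> 0 \<le> snd w" and zero: "0 \<in> C"
    and scale: "\<And>w r. w \<in> C \<Longrightarrow> 0 \<le> r \<Longrightarrow> r *\<^sub>R w \<in> C"
    and slice: "\<exists>s t. cone_slice C = {s..t}"
  shows "cone_measure C = measure lborel (cone_slice C)"
proof (cases "cone_slice C = {}")
  case True
  have "cone_slice {0 :: real \<times> real} = {}" by (auto simp: cone_slice_def zero_prod_def)
  then have "C = {0}"
    using True pos zero scale by (intro cone_eq_if_slice_eq) auto
  then show ?thesis using True by (simp add: cone_measure_def)
next
  case False
  then obtain s t where st: "cone_slice C = {s..t}" "s \<le> t" using slice by auto
  then have "s \<in> cone_slice C" "t \<in> cone_slice C" by auto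
  then have b: "0 \<le> s" "t \<le> 1" and sC: "(1 - s, s) \<in> C" by (auto simp: cone_slice_def)
  have "(1 - s, s) \<noteq> 0" by (auto simp: zero_prod_def)
  with sC have ne: "C \<noteq> {0}" by auto
  obtain \<beta> where \<beta>: "0 \<le> \<beta>" "\<beta> \<le> pi / 2" "slice_height \<beta> = s"
    using slice_height_surj[of 0 s] b st by (auto simp: slice_height_def)
  obtain \<alpha> where \<alpha>: "\<beta> \<le> \<alpha>" "\<alpha> \<le> pi / 2" "slice_height \<alpha> = t"
    using slice_height_surj[of \<beta> t] b st \<beta> by auto
  have C: "C = angular_cone \<alpha> \<beta>"
  proof (rule cone_eq_if_slice_eq)
    show "cone_slice C = cone_slice (angular_cone \<alpha> \<beta>)"
      using cone_slice_angular_cone[of \<beta> \<alpha>] \<alpha> \<beta> st by simp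
    fix D w and r :: real assume D: "D \<in> {C, angular_cone \<alpha> \<beta>}"
    then show "0 \<in> D" using zero by (auto simp: angular_cone_def zero_prod_def)
    assume w: "w \<in> D"
    then show "0 \<le> fst w \<and> 0 \<le> snd w" using D pos[of w] by (auto simp: angular_cone_def)
    assume r: "0 \<le> r"
    show "r *\<^sub>R w \<in> D"
    proof (cases "D = C")
      case True
      then show ?thesis using scale w r by simp
    next
      case False
      then have D: "D = angular_cone \<alpha> \<beta>" using D by simp
      obtain x y where xy: "w = (x, y)" by (cases w)
      have "r * (- x * sin \<alpha> + y * cos \<alpha>) \<le> 0" "0 \<le> r * (- x * sin \<beta> + y * cos \<beta>)"
        using w r xy by (auto simp: D angular_cone_def mult_le_0_iff)
      then show ?thesis
        using w r xy by (auto simp: D angular_cone_def algebra_simps)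
    qed
  qed
  have "cone_measure C = t - s"
    unfolding cone_measure_def if_not_P[OF ne]
  proof (rule the_equality)
    show "\<exists>\<alpha> \<beta>. 0 \<le> \<beta> \<and> \<beta> \<le> \<alpha> \<and> \<alpha> \<le> pi / 2 \<and> C = angular_cone \<alpha> \<beta> \<and>
        t - s = sin \<alpha> / (cos \<alpha> + sin \<alpha>) - sin \<beta> / (cos \<beta> + sin \<beta>)"
      using \<alpha> \<beta> C unfolding slice_height_def
      by (intro exI[of _ \<alpha>] exI[of _ \<beta>]) (auto simp: slice_height_def)
  next
    fix r
    assume "\<exists>\<alpha> \<beta>. 0 \<le> \<beta> \<and> \<beta> \<le> \<alpha> \<and> \<alpha> \<le> pi / 2 \<and> C = angular_cone \<alpha> \<beta> \<and>
        r = sin \<alpha> / (cos \<alpha> + sin \<alpha>) - sin \<beta> / (cos \<beta> + sin \<beta>)"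
    then obtain \<alpha>' \<beta>' where *: "0 \<le> \<beta>'" "\<beta>' \<le> \<alpha>'" "\<alpha>' \<le> pi / 2" "C = angular_cone \<alpha>' \<beta>'"
        "r = slice_height \<alpha>' - slice_height \<beta>'"
      unfolding slice_height_def by blast
    then have "{s..t} = {slice_height \<beta>'..slice_height \<alpha>'}"
      using cone_slice_angular_cone[of \<beta>' \<alpha>'] st by simp
    then show "r = t - s" using st(2) *(5) by (auto simp: Icc_eq_Icc)
  qed
  then show ?thesis using st by simp
qed

text \<open>The normal cone at \<open>z\<close> cut to the quadrant, for an arbitrary planar set and
  with the maximum replaced by inequalities, so that \<open>normal_cone2\<close> can be studied
  without reference to a lattice.\<close>

definition support_cone :: "(real \<times> real) set \<Rightarrow> real \<times> real \<Rightarrow> (real \<times> real) set" where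
  "support_cone Z z = {w. 0 \<le> fst w \<and> 0 \<le> snd w \<and> (\<forall>z'\<in>Z. w \<bullet> z' \<le> w \<bullet> z)}"

lemma inner_slice: "((1 - t, t) :: real \<times> real) \<bullet> z = fst z + t * (snd z - fst z)"
  by (cases z) (simp add: algebra_simps)

lemma cone_slice_support_cone:
  "cone_slice (support_cone Z z) =
    {0..1} \<inter> (\<Inter>z'\<in>Z. {t. fst z' + t * (snd z' - fst z') \<le> fst z + t * (snd z - fst z)})"
  by (auto simp: cone_slice_def support_cone_def inner_slice)

lemma cone_slice_support_cone_interval: "\<exists>s t. cone_slice (support_cone Z z) = {s..t}"
proof (subst connected_compact_interval_1[symmetric], intro conjI convex_connected)
  have "convex {t. fst z' + t * (snd z' - fst z') \<le> fst z + t * (snd z - fst z)}" for z'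
  proof -
    have "{t. fst z' + t * (snd z' - fst z') \<le> fst z + t * (snd z - fst z)} =
        {t. ((snd z' - fst z') - (snd z - fst z)) \<bullet> t \<le> fst z - fst z'}"
      by (auto simp: algebra_simps)
    then show ?thesis using convex_halfspace_le by metis
  qed
  then show "convex (cone_slice (support_cone Z z))"
    unfolding cone_slice_support_cone by (intro convex_Int convex_INT) auto
  have "closed {t. fst z' + t * (snd z' - fst z') \<le> fst z + t * (snd z - fst z)}" for z'
    by (intro closed_Collect_le continuous_intros)
  then show "compact (cone_slice (support_cone Z z))"
    unfolding cone_slice_support_cone by (intro compact_Int_closed closed_INT) auto
qed

lemma cone_measure_support_cone:
  "cone_measure (support_cone Z z) = measure lborel (cone_slice (support_cone Z z))"
proof (rule cone_measure_eq[OF _ _ _ cone_slice_support_cone_interval])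
  fix w and r :: real assume w: "w \<in> support_cone Z z" and r: "0 \<le> r"
  then have "r * (w \<bullet> z') \<le> r * (w \<bullet> z)" if "z' \<in> Z" for z'
    using w r that unfolding support_cone_def by (intro mult_left_mono) blast+
  then show "r *\<^sub>R w \<in> support_cone Z z"
    using w r by (auto simp: support_cone_def)
qed (auto simp: support_cone_def)

text \<open>Distinct points give distinct affine functions of \<open>t\<close>, and these agree at
  most once.\<close>

lemma slice_tie_null:
  fixes z z' :: "real \<times> real"
  assumes "z \<noteq> z'"
  shows "{t. (1 - t, t) \<bullet> z = (1 - t, t) \<bullet> z'} \<in> null_sets lborel"
proof -
  let ?k = "(snd z - fst z) - (snd z' - fst z')" and ?c = "fst z' - fst z"
  have eq: "{t. (1 - t, t) \<bullet> z = (1 - t, t) \<bullet> z'} = {t. t * ?k = ?c}"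
    by (auto simp: inner_slice algebra_simps)
  have "{t. t * ?k = ?c} \<subseteq> {?c / ?k}"
  proof (cases "?k = 0")
    case True
    then have "?c \<noteq> 0" using assms by (auto simp: prod_eq_iff)
    then show ?thesis using True by auto
  qed (auto simp: field_simps)
  then have "finite {t. t * ?k = ?c}" by (rule finite_subset) simp
  then show ?thesis unfolding eq by (intro finite_imp_null_set_lborel)
qed

text \<open>Every direction has a maximizer in \<open>Z\<close>, so the slices cover [0,1]; a
  direction shared by two slices is a tie, and ties form a null set.\<close>

lemma sum_cone_measure_support:
  assumes fin: "finite Z" and ne: "Z \<noteq> {}"
  shows "(\<Sum>z\<in>Z. cone_measure (support_cone Z z)) = 1"
proof -
  let ?T = "\<lambda>z. cone_slice (support_cone Z z)"
  have meas: "?T z \<in> sets lborel" for z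
    using cone_slice_support_cone_interval[of Z z] by auto
  have "(\<Union>z\<in>Z. ?T z) = {0..1}"
  proof
    show "{0..1} \<subseteq> (\<Union>z\<in>Z. ?T z)"
    proof
      fix t :: real assume t: "t \<in> {0..1}"
      let ?f = "\<lambda>z. (1 - t, t) \<bullet> z"
      have "Max (?f ` Z) \<in> ?f ` Z" using fin ne by (intro Max_in) auto
      then obtain z where z: "z \<in> Z" "?f z = Max (?f ` Z)" by auto
      then have "\<forall>z'\<in>Z. ?f z' \<le> ?f z" using fin by simp
      then have "t \<in> ?T z"
        using t unfolding cone_slice_def support_cone_def mem_Collect_eq fst_conv snd_conv by simp
      then show "t \<in> (\<Union>z\<in>Z. ?T z)" using z(1) by blast
    qed
  qed (auto simp: cone_slice_def)
  then have "measure lborel (\<Union>z\<in>Z. ?T z) = 1" by simp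
  also have "measure lborel (\<Union>z\<in>Z. ?T z) = (\<Sum>z\<in>Z. measure lborel (?T z))"
  proof (rule measure_UNION_AE[OF fin])
    show "?T z \<in> fmeasurable lborel" for z
      using cone_slice_support_cone_interval[of Z z]
      by (auto simp: fmeasurable_def emeasure_lborel_Icc_eq)
    show "pairwise (\<lambda>z z'. AE t in lborel. t \<notin> ?T z \<or> t \<notin> ?T z') Z"
    proof (rule pairwiseI)
      fix z z' assume "z \<in> Z" "z' \<in> Z" "z \<noteq> z'"
      from AE_not_in[OF slice_tie_null[OF this(3)]]
      show "AE t in lborel. t \<notin> ?T z \<or> t \<notin> ?T z'"
      proof (rule eventually_mono)
        fix t assume "t \<notin> {t. (1 - t, t) \<bullet> z = (1 - t, t) \<bullet> z'}"
        moreover have "(1 - t, t) \<bullet> z = (1 - t, t) \<bullet> z'" if "t \<in> ?T z" "t \<in> ?T z'"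
        proof (rule order_antisym)
          show "(1 - t, t) \<bullet> z \<le> (1 - t, t) \<bullet> z'"
            using that(2) \<open>z \<in> Z\<close> unfolding cone_slice_def support_cone_def by blast
          show "(1 - t, t) \<bullet> z' \<le> (1 - t, t) \<bullet> z"
            using that(1) \<open>z' \<in> Z\<close> unfolding cone_slice_def support_cone_def by blast
        qed
        ultimately show "t \<notin> ?T z \<or> t \<notin> ?T z'" by blast
      qed
    qed
  qed
  finally show ?thesis by (simp add: cone_measure_support_cone)
qed

lemma cone_measure_support_nonneg: "0 \<le> cone_measure (support_cone Z z)"
  by (simp add: cone_measure_support_cone)

text \<open>A slice of nonzero measure cannot consist of ties with the finitely many other points,
  so it contains a direction in which \<open>z\<close> alone is maximal.\<close>

lemma support_cone_unique_direction:
  assumes "finite Z" "z \<in> Z" "cone_measure (support_cone Z z) \<noteq> 0"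
  shows "\<exists>w :: real \<times> real. 0 \<le> fst w \<and> 0 \<le> snd w \<and> w \<noteq> 0 \<and> (\<forall>z'\<in>Z - {z}. w \<bullet> z' < w \<bullet> z)"
proof (rule ccontr)
  assume *: "\<not> ?thesis"
  let ?N = "\<Union>z'\<in>Z - {z}. {t. (1 - t, t) \<bullet> z = (1 - t, t) \<bullet> z'}"
  have null: "?N \<in> null_sets lborel"
  proof (rule null_sets_UN')
    show "countable (Z - {z})" using assms(1) by (auto intro: countable_finite)
    show "{t. (1 - t, t) \<bullet> z = (1 - t, t) \<bullet> z'} \<in> null_sets lborel" if "z' \<in> Z - {z}" for z'
      using that by (intro slice_tie_null) blast
  qed
  have "cone_slice (support_cone Z z) \<subseteq> ?N"
  proof
    fix t assume t: "t \<in> cone_slice (support_cone Z z)"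
    have "(1 - t, t) \<noteq> 0" by (auto simp: zero_prod_def)
    moreover have "0 \<le> t" "t \<le> 1" using t by (auto simp: cone_slice_def)
    ultimately obtain z' where z': "z' \<in> Z - {z}" "\<not> (1 - t, t) \<bullet> z' < (1 - t, t) \<bullet> z"
      using * by (metis diff_ge_0_iff_ge fst_conv snd_conv)
    moreover have "(1 - t, t) \<bullet> z' \<le> (1 - t, t) \<bullet> z"
      using t z'(1) unfolding cone_slice_def support_cone_def by blast
    ultimately have "(1 - t, t) \<bullet> z = (1 - t, t) \<bullet> z'" by linarith
    then show "t \<in> ?N" using z'(1) by blast
  qed
  moreover have "cone_slice (support_cone Z z) \<in> sets lborel"
    using cone_slice_support_cone_interval[of Z z] by auto
  ultimately have "cone_slice (support_cone Z z) \<in> null_sets lborel"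
    using null null_sets_subset by blast
  then show False using assms(3) by (simp add: cone_measure_support_cone measure_def null_setsD1)
qed

lemma inner_le_on_hull:
  fixes w :: "'a :: real_inner"
  assumes "\<And>z'. z' \<in> Z \<Longrightarrow> w \<bullet> z' \<le> c" "y \<in> convex hull Z"
  shows "w \<bullet> y \<le> c"
proof -
  have "convex hull Z \<subseteq> {y. w \<bullet> y \<le> c}"
    by (intro hull_minimal convex_halfspace_le subsetI CollectI assms(1))
  then show ?thesis using assms(2) by auto
qed

text \<open>Any other point of the hull has a nonzero part in the hull of Z - {z} and therefore a
  strictly smaller value; a proper convex combination of two such points cannot reach the value at
  \<open>z\<close>.\<close>

lemma unique_maximizer_extreme_point:
  fixes w :: "'a :: real_inner"
  assumes z: "z \<in> Z" and less: "\<And>z'. z' \<in> Z - {z} \<Longrightarrow> w \<bullet> z' < w \<bullet> z"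
  shows "z extreme_point_of (convex hull Z)"
proof -
  have *: "w \<bullet> y < w \<bullet> z" if y: "y \<in> convex hull Z" "y \<noteq> z" for y
  proof (cases "Z - {z} = {}")
    case True
    then have "Z = {z}" using z by auto
    then show ?thesis using y by simp
  next
    case False
    have "insert z (Z - {z}) = Z" using z by auto
    then have "y \<in> convex hull (insert z (Z - {z}))" using y by simp
    then have "y \<in> {(1 - u) *\<^sub>R z + u *\<^sub>R b | b u. 0 \<le> u \<and> u \<le> 1 \<and> b \<in> convex hull (Z - {z})}"
      unfolding convex_hull_insert_alt if_not_P[OF False] .
    then obtain b u where b: "y = (1 - u) *\<^sub>R z + u *\<^sub>R b" "0 \<le> u" "b \<in> convex hull (Z - {z})"
      by (elim CollectE exE conjE)
    have "u \<noteq> 0"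
    proof
      assume "u = 0"
      then show False using b(1) y(2) by simp
    qed
    have "convex {y. w \<bullet> y < w \<bullet> z}" by (rule convex_halfspace_lt)
    then have "convex hull (Z - {z}) \<subseteq> {y. w \<bullet> y < w \<bullet> z}"
      by (intro hull_minimal subsetI CollectI less)
    then have "w \<bullet> b < w \<bullet> z" using b(3) by auto
    then have "u * (w \<bullet> b) < u * (w \<bullet> z)"
      using \<open>u \<noteq> 0\<close> b(2) by (intro mult_strict_left_mono) auto
    moreover have "w \<bullet> y = (w \<bullet> z - u * (w \<bullet> z)) + u * (w \<bullet> b)"
      unfolding b(1) by (simp only: inner_add_right inner_scaleR_right left_diff_distrib mult_1)
    ultimately show ?thesis by linarith
  qed
  show ?thesis
    unfolding extreme_point_of_def
  proof (intro conjI ballI notI)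
    show "z \<in> convex hull Z" using z by (rule hull_inc)
    fix a b assume ab: "a \<in> convex hull Z" "b \<in> convex hull Z" "z \<in> open_segment a b"
    then obtain u where u: "a \<noteq> b" "0 < u" "u < 1" "z = (1 - u) *\<^sub>R a + u *\<^sub>R b"
      by (auto simp: in_segment)
    have "a \<noteq> z" "b \<noteq> z" using ab(3) by (auto simp: open_segment_def)
    then have "(1 - u) * (w \<bullet> a) < (1 - u) * (w \<bullet> z)" "u * (w \<bullet> b) < u * (w \<bullet> z)"
      using *[OF ab(1)] *[OF ab(2)] u by (intro mult_strict_left_mono; simp)+
    moreover have "w \<bullet> z = (1 - u) * (w \<bullet> a) + u * (w \<bullet> b)"
      unfolding arg_cong[OF u(4), of "\<lambda>x. w \<bullet> x"] by (simp only: inner_add_right inner_scaleR_right)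
    moreover have "(1 - u) * (w \<bullet> z) = w \<bullet> z - u * (w \<bullet> z)"
      by (simp only: left_diff_distrib mult_1)
    ultimately show False by linarith
  qed
qed

section \<open>Submodular functions\<close>

context valued_semilattice
begin

lemma normal_cone2_eq:
  assumes "u \<in> metric_interval L v x y"
  shows "normal_cone2 L v x y u =
    support_cone (val_point L v x y ` metric_interval L v x y) (val_point L v x y u)"
proof -
  let ?P = "val_point L v x y" and ?I = "metric_interval L v x y"
  have "m = Max S \<longleftrightarrow> (\<forall>s\<in>S. s \<le> m)" if "finite S" "m \<in> S" for S and m :: real
    using that by (auto intro!: Max_eqI[symmetric])
  from this[of "(\<lambda>u'. w \<bullet> ?P u') ` ?I" "w \<bullet> ?P u" for w]
  have "w \<bullet> ?P u = (MAX u'\<in>?I. w \<bullet> ?P u') \<longleftrightarrow> (\<forall>z'\<in>?P ` ?I. w \<bullet> z' \<le> w \<bullet> ?P u)" for w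
    using assms by simp
  then show ?thesis
    unfolding normal_cone2_def support_cone_def by (simp only:)
qed

text \<open>Injectivity turns the sum over elements into one over value points. Points outside the
  extremal set contribute 0: nonzero measure would give a nonzero direction w \<ge> 0 with a unique
  maximizer, which makes the point extreme and forbids shifting it by a strictly positive
  vector.\<close>

lemma sum_cone_measure_extremal:
  assumes xy: "x \<in> carrier L" "y \<in> carrier L"
  shows "(\<Sum>u\<in>extremal_set L v x y. cone_measure (normal_cone2 L v x y u)) = 1"
proof -
  let ?P = "val_point L v x y" and ?I = "metric_interval L v x y" and ?E = "extremal_set L v x y"
  let ?Z = "?P ` ?I"
  have x: "x \<in> ?I"
    using xy by (simp add: metric_interval_iff meet_eq_left meet_comm)
  have EI: "?E \<subseteq> ?I" by (auto simp: extremal_set_def)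
  have "(\<Sum>u\<in>?E. cone_measure (normal_cone2 L v x y u)) = (\<Sum>u\<in>?E. cone_measure (support_cone ?Z (?P u)))"
    using EI by (intro sum.cong) (auto simp: normal_cone2_eq)
  also have "\<dots> = (\<Sum>z\<in>?P ` ?E. cone_measure (support_cone ?Z z))"
    using extremal_set_inj[OF xy] by (simp add: sum.reindex)
  also have "\<dots> = (\<Sum>z\<in>?Z. cone_measure (support_cone ?Z z))"
  proof (rule sum.mono_neutral_left)
    show "?P ` ?E \<subseteq> ?Z" using EI by auto
    show "\<forall>z\<in>?Z - ?P ` ?E. cone_measure (support_cone ?Z z) = 0"
    proof (rule ballI, rule ccontr)
      fix z assume z: "z \<in> ?Z - ?P ` ?E" and nz: "cone_measure (support_cone ?Z z) \<noteq> 0"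
      obtain w where w: "0 \<le> fst w" "0 \<le> snd w" "w \<noteq> 0" "\<forall>z'\<in>?Z - {z}. w \<bullet> z' < w \<bullet> z"
        using support_cone_unique_direction[OF _ _ nz] z by auto
      have ext: "z extreme_point_of conv_interval L v x y"
        unfolding conv_interval_def
      proof (rule unique_maximizer_extreme_point)
        show "z \<in> ?Z" using z by blast
        show "w \<bullet> z' < w \<bullet> z" if "z' \<in> ?Z - {z}" for z' using w(4) that by blast
      qed
      have le: "w \<bullet> z' \<le> w \<bullet> z" if "z' \<in> ?Z" for z'
        using w(4) that by (cases "z' = z") (blast intro: less_imp_le order_refl)+
      have "z + (e1, e2) \<notin> conv_interval L v x y" if e: "0 < e1" "0 < e2" for e1 e2
      proof
        assume "z + (e1, e2) \<in> conv_interval L v x y"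
        then have "w \<bullet> (z + (e1, e2)) \<le> w \<bullet> z"
          unfolding conv_interval_def using le by (rule inner_le_on_hull[rotated])
        then have "w \<bullet> (e1, e2) \<le> 0" unfolding inner_add_right by linarith
        then have "fst w * e1 + snd w * e2 \<le> 0" by (cases w) simp
        moreover have "0 < fst w \<or> 0 < snd w" using w(1-3) by (auto simp: prod_eq_iff)
        then have "0 < fst w * e1 + snd w * e2"
        proof
          assume "0 < fst w"
          then show ?thesis using w(2) e by (intro add_pos_nonneg mult_pos_pos mult_nonneg_nonneg) auto
        next
          assume "0 < snd w"
          then show ?thesis using w(1) e by (intro add_nonneg_pos mult_pos_pos mult_nonneg_nonneg) auto
        qed
        ultimately show False by simp
      qed
      then have "z \<in> ?P ` ?E" using z ext by (auto simp: extremal_set_def)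
      then show False using z by blast
    qed
  qed auto
  also have "\<dots> = 1" using x by (intro sum_cone_measure_support) auto
  finally show ?thesis .
qed

lemma cone_measure_normal_nonneg:
  "u \<in> metric_interval L v x y \<Longrightarrow> 0 \<le> cone_measure (normal_cone2 L v x y u)"
  by (simp add: normal_cone2_eq cone_measure_support_nonneg)

lemma submodular_real:
  assumes "submodular L v (\<lambda>x. ereal (f x))" "x \<in> carrier L" "y \<in> carrier L"
  shows "f (x \<sqinter> y) + (\<Sum>u\<in>extremal_set L v x y. cone_measure (normal_cone2 L v x y u) * f u)
    \<le> f x + f y"
proof -
  have "ereal (f (x \<sqinter> y)) +
      (\<Sum>u\<in>extremal_set L v x y. ereal (cone_measure (normal_cone2 L v x y u)) * ereal (f u))
    \<le> ereal (f x) + ereal (f y)"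
    using assms unfolding submodular_def by blast
  then show ?thesis by (simp add: sum_ereal)
qed

text \<open>Only the target must lie below \<open>M\<close>, since a chain may start at an element
  of value exactly \<open>M\<close>.\<close>

definition level_step :: "('a \<Rightarrow> real) \<Rightarrow> real \<Rightarrow> 'a rel" where
  "level_step f M =
    {(x, y). x \<in> carrier L \<and> y \<in> carrier L \<and> (x \<sqsubseteq> y \<or> y \<sqsubseteq> x) \<and> f y < M}"

text \<open>A slice of length at least 1 is all of [0,1], so it contains t = 0, the direction (1,0).
  There \<open>y\<close> does at least as well as \<open>x\<close>, which says v x \<le> v (y
  \<sqinter> x).\<close>

lemma full_normal_cone_imp_le:
  assumes xy: "x \<in> carrier L" "y \<in> carrier L"
    and I: "y \<in> metric_interval L v x y" "x \<in> metric_interval L v x y"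
    and full: "1 \<le> cone_measure (normal_cone2 L v x y y)"
  shows "x \<sqsubseteq> y"
proof -
  let ?P = "val_point L v x y" and ?Z = "val_point L v x y ` metric_interval L v x y"
  obtain s t where st: "cone_slice (support_cone ?Z (?P y)) = {s..t}"
    using cone_slice_support_cone_interval by blast
  have "1 \<le> measure lborel {s..t}"
    using full unfolding normal_cone2_eq[OF I(1)] cone_measure_support_cone st .
  then have "1 \<le> t - s" by (cases "s \<le> t") auto
  moreover have "{s..t} \<subseteq> {0..1}" unfolding st[symmetric] by (auto simp: cone_slice_def)
  ultimately have "0 \<in> {s..t}" by auto
  then have "0 \<in> cone_slice (support_cone ?Z (?P y))" unfolding st .
  then have "(1 - 0, 0) \<bullet> ?P x \<le> (1 - 0, 0) \<bullet> ?P y"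
    using I(2) unfolding cone_slice_def support_cone_def by blast
  then have "v (x \<sqinter> x) \<le> v (y \<sqinter> x)" by (simp add: val_point_def)
  then have *: "v x \<le> v (y \<sqinter> x)" using xy by (simp add: meet_eq_left)
  have le: "y \<sqinter> x \<sqsubseteq> x" "y \<sqinter> x \<sqsubseteq> y" using xy by (auto intro: meet_left meet_right)
  have "y \<sqinter> x = x" using v_eq_imp_eq[OF le(1)] v_mono[OF le(1)] * xy by auto
  then show ?thesis using le(2) by simp
qed

text \<open>If neither \<open>x \<sqinter> y\<close> nor an element of \<open>\<E>(x,y)\<close> other than \<open>x\<close> and \<open>y\<close> has a value below \<open>M\<close>,
  then, the coefficients having sum 1, submodularity forces that of \<open>y\<close> to be 1.\<close>

lemma level_connected:
  assumes sub: "submodular L v (\<lambda>x. ereal (f x))"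
    and "x \<in> carrier L" "y \<in> carrier L" "f x \<le> M" "f y < M"
  shows "(x, y) \<in> (level_step f M)\<^sup>*"
  using assms(2-5)
\<comment> \<open>Distances are real; the number of pairs at smaller distance is a natural number
  that decreases with them.\<close>
proof (induction "card {(a, b) \<in> carrier L \<times> carrier L. sdist a b < sdist x y}"
    arbitrary: x y rule: less_induct)
  case less
  note xy = less.prems(1,2) and fx = less.prems(3) and fy = less.prems(4)
  let ?m = "x \<sqinter> y" and ?I = "metric_interval L v x y" and ?E = "extremal_set L v x y"
  define c where "c u = cone_measure (normal_cone2 L v x y u)" for u
  show ?case
  proof (cases "x \<sqsubseteq> y \<or> f ?m < M")
    case True
    have "?m \<in> carrier L" "?m \<sqsubseteq> x" "?m \<sqsubseteq> y" using xy by (auto intro: meet_left meet_right)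
    then have "(x, ?m) \<in> level_step f M \<and> (?m, y) \<in> level_step f M \<or> (x, y) \<in> level_step f M"
      using xy fy True by (auto simp: level_step_def)
    then show ?thesis by (blast intro: r_into_rtrancl rtrancl_trans)
  next
    case False
    have EI: "?E \<subseteq> ?I" by (auto simp: extremal_set_def)
    have I: "x \<in> ?I" "y \<in> ?I"
      using xy by (auto simp: metric_interval_iff meet_eq_left meet_comm)
    have finE: "finite ?E" using EI by (rule finite_subset) simp
    have c0: "0 \<le> c u" if "u \<in> ?E" for u
      using that EI unfolding c_def by (intro cone_measure_normal_nonneg) auto
    have c1: "(\<Sum>u\<in>?E. c u) = 1" unfolding c_def by (rule sum_cone_measure_extremal[OF xy])
    have cle: "c u \<le> 1" if "u \<in> ?E" for u
      using member_le_sum[OF that, of c] c0 c1 finE by auto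
    have subm: "f ?m + (\<Sum>u\<in>?E. c u * f u) \<le> f x + f y"
      unfolding c_def by (rule submodular_real[OF sub xy])
    have "\<exists>u\<in>?E - {x, y}. f u < M"
    proof (rule ccontr)
      assume "\<not> ?thesis"
      then have big: "M \<le> f u" if "u \<in> ?E" "u \<noteq> x" "u \<noteq> y" for u
        using that unfolding not_less[symmetric] by blast
      have ne: "x \<noteq> y" using False xy by auto
      \<comment> \<open>Coefficients continued by 0, as \<open>x\<close> and \<open>y\<close>
        themselves may fail to be extremal.\<close>
      define cx cy where "cx = (if x \<in> ?E then c x else 0)" and "cy = (if y \<in> ?E then c y else 0)"
      \<comment> \<open>Every \<open>f u\<close> is at least \<open>M\<close>, except that at
        \<open>x\<close> and \<open>y\<close> the exact value is kept.\<close>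
      have "(\<Sum>u\<in>?E. c u * (M - (if u = x then M - f x else 0) - (if u = y then M - f y else 0)))
          \<le> (\<Sum>u\<in>?E. c u * f u)"
        using big ne by (intro sum_mono mult_left_mono c0) auto
      also have "(\<Sum>u\<in>?E. c u * (M - (if u = x then M - f x else 0) - (if u = y then M - f y else 0)))
          = (\<Sum>u\<in>?E. c u * M) - (\<Sum>u\<in>?E. if u = x then c x * (M - f x) else 0)
            - (\<Sum>u\<in>?E. if u = y then c y * (M - f y) else 0)"
        unfolding sum_subtractf[symmetric] by (intro sum.cong) (auto simp: algebra_simps)
      also have "\<dots> = M - cx * (M - f x) - cy * (M - f y)"
        using finE c1 by (simp add: cx_def cy_def sum_distrib_right[symmetric])
      finally have "M + (M - cx * (M - f x) - cy * (M - f y)) \<le> f x + f y"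
        using subm False by linarith
      moreover have "cx * (M - f x) \<le> 1 * (M - f x)"
        using cle[of x] fx by (intro mult_right_mono) (auto simp: cx_def)
      \<comment> \<open>Since cx (M - f x) \<le> M - f x, what remains of the inequality is M - f y
        \<le> cy (M - f y), so that cy \<ge> 1; this also excludes the default value 0.\<close>
      moreover have "2 * M - A - B \<le> a + b \<Longrightarrow> A \<le> 1 * (M - a) \<Longrightarrow> 1 * (M - b) \<le> B"
        for A B a b :: real by simp
      ultimately have "1 * (M - f y) \<le> cy * (M - f y)" by (simp only: add_diff_eq mult_2)
      then have "1 \<le> cy" using fy by (intro mult_right_le_imp_le[of 1 "M - f y"]) auto
      then have "1 \<le> c y" by (auto simp: cy_def split: if_splits)
      then have "x \<sqsubseteq> y" unfolding c_def by (rule full_normal_cone_imp_le[OF xy I(2,1)])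
      then show False using False by simp
    qed
    then obtain u where u: "u \<in> ?I" "u \<noteq> x" "u \<noteq> y" "f u < M" using EI by blast
    then have uc: "u \<in> carrier L" and d: "sdist x u + sdist u y = sdist x y"
      using xy by (auto simp: metric_interval_alt)
    have lt: "sdist x u < sdist x y" "sdist u y < sdist x y"
      using d sdist_pos[OF xy(1) uc] sdist_pos[OF uc xy(2)] u by auto
    have card_less: "card {(a, b) \<in> carrier L \<times> carrier L. sdist a b < r} <
        card {(a, b) \<in> carrier L \<times> carrier L. sdist a b < sdist x y}"
      if "r < sdist x y" "a \<in> carrier L" "b \<in> carrier L" "r = sdist a b" for r a b
    proof (rule psubset_card_mono)
      show "finite {(a, b) \<in> carrier L \<times> carrier L. sdist a b < sdist x y}"
        by (rule finite_subset[of _ "carrier L \<times> carrier L"]) (auto simp: fin)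
      have "(a, b) \<in> {(a, b) \<in> carrier L \<times> carrier L. sdist a b < sdist x y}"
        "(a, b) \<notin> {(a, b) \<in> carrier L \<times> carrier L. sdist a b < r}" using that by auto
      then show "{(a, b) \<in> carrier L \<times> carrier L. sdist a b < r} \<subset>
          {(a, b) \<in> carrier L \<times> carrier L. sdist a b < sdist x y}"
        using that(1) by (auto intro: less_trans)
    qed
    have "(x, u) \<in> (level_step f M)\<^sup>*"
      by (rule less.hyps[OF card_less[OF lt(1) xy(1) uc HOL.refl] xy(1) uc fx u(4)])
    moreover have "(u, y) \<in> (level_step f M)\<^sup>*"
      by (rule less.hyps[OF card_less[OF lt(2) uc xy(2) HOL.refl] uc xy(2) less_imp_le[OF u(4)] fy])
    ultimately show ?thesis by (rule rtrancl_trans)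
  qed
qed

end

section \<open>Order and convexity in modular complexes\<close>

locale modular_cx =
  fixes G :: "'a pair_pre_digraph" and ori :: "'a rel" and h :: "'a set \<Rightarrow> real"
  assumes complex: "modular_complex G ori h"
begin

abbreviation "V \<equiv> pverts G"
abbreviation "E \<equiv> parcs G"
abbreviation "d \<equiv> udist G"
abbreviation "below x y \<equiv> (x, y) \<in> ori\<^sup>*"

lemma pair_graph: "pair_graph G"
  using complex by (simp add: modular_complex_def modular_graph_def)

lemma wf: "pair_wf_digraph G"
  using pair_graph by (simp add: pair_graph_def pair_digraph_def pair_fin_digraph_def)

lemma finite_V: "finite V"
  using pair_graph by (simp add: pair_graph_def pair_digraph_def pair_fin_digraph_def
    pair_fin_digraph_axioms_def)

lemma edge_V: "(u, v) \<in> E \<Longrightarrow> u \<in> V" "(u, v) \<in> E \<Longrightarrow> v \<in> V"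
  using pair_wf_digraph.wellformed'[OF wf] by auto

lemma sym_E: "sym E"
proof -
  have "symmetric (with_proj G)"
    using pair_graph by (simp add: pair_graph_def pair_pseudo_graph_def pair_sym_digraph_def
      pair_sym_digraph_axioms_def)
  then show ?thesis by (simp add: symmetric_def)
qed

lemma edge_sym: "(u, v) \<in> E \<Longrightarrow> (v, u) \<in> E"
  using sym_E by (rule symD)

lemma edge_irrefl: "(u, u) \<notin> E"
proof -
  have "pair_loopfree_digraph G" using pair_graph by (simp add: pair_graph_def pair_digraph_def)
  from pair_loopfree_digraph.pair_no_loops[OF this, of "(u, u)"] show ?thesis by auto
qed

lemma reach: "u \<in> V \<Longrightarrow> v \<in> V \<Longrightarrow> (u, v) \<in> E\<^sup>*"
proof -
  assume uv: "u \<in> V" "v \<in> V"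
  have "Digraph_Component.connected (with_proj G)"
    using complex by (simp add: modular_complex_def modular_graph_def)
  then have "u \<rightarrow>\<^sup>*\<^bsub>with_proj (mk_symmetric (with_proj G))\<^esub> v"
    using uv unfolding Digraph_Component.connected_def strongly_connected_def by simp
  then have "(u, v) \<in> (parcs (mk_symmetric (with_proj G)))\<^sup>*"
    unfolding reachable_def by (auto dest: rtrancl_on_rtranclI)
  moreover have "parcs (mk_symmetric (with_proj G)) = E"
    using edge_sym by (auto simp: parcs_mk_symmetric)
  ultimately show ?thesis by simp
qed

lemma relpow_dist: "u \<in> V \<Longrightarrow> v \<in> V \<Longrightarrow> (u, v) \<in> E ^^ d u v"
  using reach[of u v] unfolding udist_def rtrancl_power by (rule LeastI_ex)

lemma relpow_sym: "(u, v) \<in> E ^^ n \<Longrightarrow> (v, u) \<in> E ^^ n"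
proof (induction n arbitrary: v)
  case (Suc n)
  then obtain w where "(u, w) \<in> E ^^ n" "(w, v) \<in> E" by auto
  then show ?case using Suc.IH edge_sym relpow_Suc_I2 by metis
qed auto

lemma dist_sym: "d u v = d v u"
  unfolding udist_def using relpow_sym by (intro arg_cong[of _ _ Least] ext) blast

lemma dist_self [simp]: "d u u = 0"
  using udist_le[of u u 0 G] by simp

lemma dist_eq_0: "u \<in> V \<Longrightarrow> v \<in> V \<Longrightarrow> d u v = 0 \<longleftrightarrow> u = v"
  using relpow_dist[of u v] by auto

lemma dist_triangle: "u \<in> V \<Longrightarrow> v \<in> V \<Longrightarrow> w \<in> V \<Longrightarrow> d u w \<le> d u v + d v w"
  using relpow_dist[of u v] relpow_dist[of v w] by (intro udist_le) (auto simp: relpow_add)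

lemma dist_edge: "(u, v) \<in> E \<Longrightarrow> d u v = 1"
  using udist_le[of u v 1 G] dist_eq_0[of u v] edge_V[of u v] edge_irrefl[of u]
  by (cases "d u v = 0") auto

lemma edge_dist: "u \<in> V \<Longrightarrow> v \<in> V \<Longrightarrow> d u v = 1 \<Longrightarrow> (u, v) \<in> E"
  using relpow_dist[of u v] by simp

lemma dist_last:
  assumes "u \<in> V" "v \<in> V" "d u v = Suc n"
  shows "\<exists>w. (w, v) \<in> E \<and> d u w = n"
proof -
  obtain w where w: "(u, w) \<in> E ^^ n" "(w, v) \<in> E"
    using relpow_dist[OF assms(1,2)] assms(3) by auto
  have "d u w \<le> n" using udist_le[OF w(1)] .
  moreover have "Suc n \<le> d u w + 1"
    using dist_triangle[of u w v] assms w(2) edge_V[OF w(2)] dist_edge[OF w(2)] by simp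
  ultimately show ?thesis using w(2) by auto
qed

section \<open>Betweenness, bipartiteness and the quadrangle condition\<close>

definition btw :: "'a \<Rightarrow> 'a \<Rightarrow> 'a \<Rightarrow> bool" where
  "btw x w y \<longleftrightarrow> w \<in> V \<and> d x w + d w y = d x y"

lemma median:
  assumes "x \<in> V" "y \<in> V" "z \<in> V"
  shows "\<exists>m. btw x m y \<and> btw x m z \<and> btw y m z"
proof -
  obtain m where m: "is_median G x y z m"
    using complex assms unfolding modular_complex_def modular_graph_def by blast
  then have mV: "m \<in> V" by (simp add: is_median_def Let_def)
  have "graph_dist G (\<lambda>_. 1) a b = real (d a b)" if "a \<in> V" "b \<in> V" for a b
    using graph_dist_unit[OF wf] reach that by blast
  then have "real (d x y) = real (d x m + d m y)" "real (d x z) = real (d x m + d m z)"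
    "real (d y z) = real (d y m + d m z)"
    using m mV assms unfolding is_median_def Let_def of_nat_add by metis+
  then show ?thesis using mV unfolding btw_def of_nat_eq_iff by metis
qed

lemma btw_sym: "btw x w y \<longleftrightarrow> btw y w x"
  unfolding btw_def using dist_sym by (metis add.commute)

lemma btw_trans1:
  assumes "btw x w y" "btw x u w" "x \<in> V" "y \<in> V"
  shows "btw x u y" "btw u w y"
  using assms dist_triangle[of x u y] dist_triangle[of u w y] by (auto simp: btw_def)

lemma btw_trans2:
  assumes "btw x w y" "btw w u y" "x \<in> V" "y \<in> V"
  shows "btw x u y" "btw x w u"
  using btw_trans1[of y w x u] assms btw_sym by metis+

lemma btw_last:
  assumes "x \<in> V" "y \<in> V" "x \<noteq> y"
  shows "\<exists>w. (w, y) \<in> E \<and> btw x w y"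
proof -
  obtain n where n: "d x y = Suc n" using assms dist_eq_0 by (metis not0_implies_Suc)
  obtain w where "(w, y) \<in> E" "d x w = n" using dist_last[OF assms(1,2) n] by auto
  then show ?thesis using n dist_edge edge_V by (auto simp: btw_def)
qed

lemma btw_first:
  assumes "x \<in> V" "y \<in> V" "x \<noteq> y"
  shows "\<exists>w. (x, w) \<in> E \<and> btw x w y"
  using btw_last[of y x] assms edge_sym btw_sym by metis

text \<open>The median of \<open>u\<close>, \<open>v\<close> and \<open>z\<close> lies on the edge
  and so is one of its ends: modular graphs are bipartite.\<close>

lemma dist_edge_cases:
  assumes "(u, v) \<in> E" "z \<in> V"
  shows "d z u = Suc (d z v) \<or> d z v = Suc (d z u)"
proof -
  obtain m where m: "btw u m v" "btw u m z" "btw v m z"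
    using median[of u v z] assms edge_V by blast
  have V: "u \<in> V" "v \<in> V" "m \<in> V" using assms(1) edge_V m by (auto simp: btw_def)
  have "d u m + d m v = 1" using m(1) dist_edge[OF assms(1)] by (simp add: btw_def)
  then have "d u m = 0 \<or> d m v = 0" by linarith
  then have "m = u \<or> m = v" using V dist_eq_0[of u m] dist_eq_0[of m v] by auto
  then show ?thesis
    using m(2,3) dist_edge[OF assms(1)] dist_edge[OF edge_sym[OF assms(1)]] dist_sym[of z]
    by (auto simp: btw_def)
qed

text \<open>Bipartiteness excludes an edge between \<open>u\<close> and \<open>v\<close>, so they
  are at distance 2, and their median with \<open>z\<close> is the common neighbour.\<close>

lemma quadrangle:
  assumes "(u, w) \<in> E" "(v, w) \<in> E" "u \<noteq> v" "z \<in> V" "d z w = Suc (d z u)" "d z w = Suc (d z v)"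
  shows "\<exists>x. (x, u) \<in> E \<and> (x, v) \<in> E \<and> d z u = Suc (d z x)"
proof -
  have V: "u \<in> V" "v \<in> V" "w \<in> V" using assms edge_V by auto
  have "d u v \<le> 2"
    using dist_triangle[of u w v] V dist_edge[OF assms(1)] dist_edge[OF assms(2)] dist_sym[of w v]
    by simp
  moreover have "d u v \<noteq> 0" using V assms(3) dist_eq_0 by simp
  moreover have "d u v \<noteq> 1"
    using dist_edge_cases[of u v z] edge_dist[of u v] V assms by auto
  ultimately have duv: "d u v = 2" by simp
  obtain m where m: "btw u m v" "btw u m z" "btw v m z" using median[of u v z] V assms(4) by blast
  then have mV: "m \<in> V" by (simp add: btw_def)
  have eqs: "d u m + d m v = 2" "d u m + d m z = d u z" "d v m + d m z = d v z"
    using m duv by (auto simp: btw_def)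
  have "d u z = d v z" using assms(5,6) dist_sym by simp
  then have "d u m = 1" "d v m = 1" using eqs dist_sym[of v m] by auto
  then have "(m, u) \<in> E" "(m, v) \<in> E" using edge_dist V mV edge_sym by auto
  moreover have "d z u = Suc (d z m)" using eqs \<open>d u m = 1\<close> dist_sym[of z] by simp
  ultimately show ?thesis by blast
qed

lemma quadrangle_btw:
  assumes "(u, w) \<in> E" "(v, w) \<in> E" "u \<noteq> v" "z \<in> V" "btw z u w" "btw z v w"
  shows "\<exists>x. (x, u) \<in> E \<and> (x, v) \<in> E \<and> btw z x u \<and> btw z x v"
proof -
  have e: "d u w = 1" "d v w = 1" using assms dist_edge by auto
  obtain x where x: "(x, u) \<in> E" "(x, v) \<in> E" "d z u = Suc (d z x)"
    using quadrangle[OF assms(1-4)] assms(5,6) e by (auto simp: btw_def)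
  moreover have "d z u = d z v" using assms(5,6) e by (simp add: btw_def)
  ultimately show ?thesis using dist_edge edge_V by (auto simp: btw_def)
qed

section \<open>Admissible orientations and convexity of the order\<close>

lemma admissible: "admissible G ori"
  using complex by (simp add: modular_complex_def)

lemma orientation: "orientation G ori"
  using admissible by (simp add: admissible_def)

lemma ori_E: "(u, v) \<in> ori \<Longrightarrow> (u, v) \<in> E"
  using orientation by (auto simp: orientation_def)

lemma ori_V: "(u, v) \<in> ori \<Longrightarrow> u \<in> V" "(u, v) \<in> ori \<Longrightarrow> v \<in> V"
  by (blast dest: ori_E edge_V)+

lemma ori_asym: "(u, v) \<in> ori \<Longrightarrow> (v, u) \<notin> ori"
  using orientation ori_E[of u v] unfolding orientation_def by blast

lemma ori_total: "(u, v) \<in> E \<Longrightarrow> (u, v) \<in> ori \<or> (v, u) \<in> ori"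
  using orientation unfolding orientation_def by blast

lemma square_cycle:
  assumes "(u, v) \<in> E" "(v, v') \<in> E" "(v', u') \<in> E" "(u', u) \<in> E" "u \<noteq> v'" "v \<noteq> u'"
  shows "four_cycle G u v v' u'"
  using assms edge_irrefl by (auto simp: four_cycle_def)

lemma square:
  assumes "(u, v) \<in> E" "(v, v') \<in> E" "(v', u') \<in> E" "(u', u) \<in> E" "u \<noteq> v'" "v \<noteq> u'"
  shows "(u, v) \<in> ori \<longleftrightarrow> (u', v') \<in> ori"
  using admissible square_cycle[OF assms] by (auto simp: admissible_def)

text \<open>Admissibility survives reversal, so every order statement below yields its dual by
  instantiating the locale with the converse orientation.\<close>

lemma dual: "modular_cx G (ori\<inverse>) h"
proof
  have "(u, v) \<in> ori\<inverse> \<longleftrightarrow> (u', v') \<in> ori\<inverse>" if "four_cycle G u v v' u'" for u v v' u'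
  proof -
    have "four_cycle G v u u' v'"
      using that edge_sym by (auto simp: four_cycle_def)
    then show ?thesis using admissible by (auto simp: admissible_def)
  qed
  moreover have "orientation G (ori\<inverse>)"
    using edge_sym ori_E ori_asym ori_total unfolding orientation_def by blast
  ultimately have "admissible G (ori\<inverse>)" by (simp add: admissible_def)
  then show "modular_complex G (ori\<inverse>) h" using complex by (simp add: modular_complex_def)
qed

lemma below_V: "below u v \<Longrightarrow> u \<in> V \<Longrightarrow> v \<in> V"
  by (induction rule: rtrancl_induct) (blast dest: ori_V)+

lemma below_V': "below u v \<Longrightarrow> v \<in> V \<Longrightarrow> u \<in> V"
  by (induction rule: converse_rtrancl_induct) (blast dest: ori_V)+

text \<open>Suppose the last step, from \<open>x\<close> to \<open>v\<close>, comes back towards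
  \<open>u\<close>, and let \<open>y\<close> precede \<open>x\<close>. The quadrangle condition
  closes a square y, x, v, q with \<open>q\<close> one step nearer to \<open>u\<close> than
  \<open>y\<close>. Admissibility orients the edge from \<open>y\<close> to \<open>q\<close> like
  that from \<open>x\<close> to \<open>v\<close>, so a shorter directed path ends at
  \<open>q\<close> without being a geodesic, against the induction hypothesis.\<close>

lemma ori_relpow_dist: "(u, v) \<in> ori ^^ n \<Longrightarrow> u \<in> V \<Longrightarrow> d u v = n"
proof (induction n arbitrary: u v rule: less_induct)
  case (less n)
  show ?case
  proof (cases n)
    case 0
    then show ?thesis using less.prems by simp
  next
    case (Suc k)
    then obtain x where x: "(u, x) \<in> ori ^^ k" "(x, v) \<in> ori" using less.prems by auto
    have dx: "d u x = k" using less.IH[of k u x] Suc x less.prems by simp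
    have "d u v = Suc k \<or> k = Suc (d u v)"
      using dist_edge_cases[OF ori_E[OF x(2)] less.prems(2)] dx by auto
    moreover have False if k: "k = Suc (d u v)"
    proof -
      define j where "j = d u v"
      obtain y where y: "(u, y) \<in> ori ^^ j" "(y, x) \<in> ori" using x(1) k j_def by auto
      have dy: "d u y = j" using less.IH[of j u y] Suc k j_def y less.prems by simp
      have yv: "y \<noteq> v" using y(2) x(2) ori_asym by auto
      note e = ori_E[OF x(2)] ori_E[OF y(2)]
      obtain q where q: "(q, y) \<in> E" "(q, v) \<in> E" "d u y = Suc (d u q)"
        using quadrangle[of y x v u] e edge_sym yv less.prems(2) dx dy k j_def by auto
      have qx: "q \<noteq> x" using q dy dx k j_def by auto
      have "(y, x) \<in> ori \<longleftrightarrow> (q, v) \<in> ori"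
        using square[of y x v q] e q edge_sym yv qx by auto
      moreover have "(x, v) \<in> ori \<longleftrightarrow> (y, q) \<in> ori"
        using square[of x v q y] e q edge_sym yv qx by auto
      ultimately have "(u, q) \<in> ori ^^ Suc j" using x y by auto
      then have "d u q = Suc j" using less.IH[of "Suc j" u q] Suc k j_def less.prems by simp
      then show False using q dy by simp
    qed
    ultimately show ?thesis using Suc by auto
  qed
qed

lemma below_relpow: "below u v \<Longrightarrow> u \<in> V \<Longrightarrow> (u, v) \<in> ori ^^ d u v"
  using ori_relpow_dist by (auto simp: rtrancl_power)

lemma below_dist_add: "below x y \<Longrightarrow> below y z \<Longrightarrow> x \<in> V \<Longrightarrow> d x z = d x y + d y z"
  using below_relpow[of x y] below_relpow[of y z] below_V[of x y]
  by (intro ori_relpow_dist) (auto simp: relpow_add)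

lemma below_btw: "below x y \<Longrightarrow> below y z \<Longrightarrow> x \<in> V \<Longrightarrow> btw x y z"
  using below_dist_add[of x y z] below_V[of x y] by (auto simp: btw_def)

lemma below_antisym: "below x y \<Longrightarrow> below y x \<Longrightarrow> x \<in> V \<Longrightarrow> x = y"
  using below_dist_add[of x y x] below_V[of x y] dist_eq_0[of x y] by auto

lemma below_edge: "below x y \<Longrightarrow> x \<in> V \<Longrightarrow> d x y = 1 \<Longrightarrow> (x, y) \<in> ori"
  using below_relpow[of x y] by simp

text \<open>Two geodesics from \<open>p\<close> that enter \<open>q\<close> through different
  neighbours close a square at \<open>q\<close>, whose parallel edges carry the orientation from one
  to the other. Consequently all geodesics between comparable vertices are directed.\<close>

lemma below_last:
  assumes "(p, q) \<in> ori ^^ n" "p \<in> V" "(w, q) \<in> E" "Suc (d p w) = n"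
  shows "below p w \<and> (w, q) \<in> ori"
  using assms
proof (induction n arbitrary: q w)
  case (Suc n)
  obtain x where x: "(p, x) \<in> ori ^^ n" "(x, q) \<in> ori" using Suc.prems by auto
  show ?case
  proof (cases "x = w")
    case True
    then show ?thesis using x by (auto simp: rtrancl_power)
  next
    case False
    have dd: "d p x = n" "d p q = Suc n"
      using ori_relpow_dist[OF x(1)] ori_relpow_dist[OF Suc.prems(1)] Suc.prems(2) by auto
    note e = ori_E[OF x(2)] Suc.prems(3)
    obtain y where y: "(y, x) \<in> E" "(y, w) \<in> E" "d p x = Suc (d p y)"
      using quadrangle[of x q w p] e False dd Suc.prems by auto
    have yq: "y \<noteq> q" using y dd by auto
    have py: "below p y" "(y, x) \<in> ori" using Suc.IH[OF x(1) _ y(1)] y dd Suc.prems by auto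
    have "(y, x) \<in> ori \<longleftrightarrow> (w, q) \<in> ori"
      using square[of y x q w] y e edge_sym yq False by auto
    moreover have "(x, q) \<in> ori \<longleftrightarrow> (y, w) \<in> ori"
      using square[of x q w y] y e edge_sym yq False by auto
    ultimately show ?thesis using py x by auto
  qed
qed simp

lemma below_between:
  assumes "below p q" "p \<in> V" "btw p w q"
  shows "below p w \<and> below w q"
  using assms(3)
proof (induction "d w q" arbitrary: w)
  case 0
  then show ?case using assms below_V[of p q] dist_eq_0[of w q] by (auto simp: btw_def)
next
  case (Suc n)
  have V: "q \<in> V" "w \<in> V" using assms below_V Suc.prems by (auto simp: btw_def)
  have "w \<noteq> q" using Suc.hyps(2) by auto
  obtain u where u: "(w, u) \<in> E" "btw w u q" using btw_first V \<open>w \<noteq> q\<close> by blast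
  have b: "btw p u q" "btw p w u" using btw_trans2[OF Suc.prems u(2)] assms V by auto
  have "n = d u q" using u Suc.hyps(2) dist_edge[OF u(1)] by (auto simp: btw_def)
  then have *: "below p u" "below u q" using Suc.hyps(1) b by auto
  have "Suc (d p w) = d p u" using b(2) dist_edge[OF u(1)] by (auto simp: btw_def)
  then have "below p w" "(w, u) \<in> ori" using below_last[OF below_relpow[OF *(1) assms(2)] assms(2) u(1)] by auto
  then show ?case using * by auto
qed

text \<open>Only the first step, from \<open>x\<close> to \<open>w1\<close>, matters. If it goes
  down, a step from \<open>x\<close> to \<open>w'\<close>, leading towards both \<open>p\<close> and
  \<open>y\<close>, also goes down. When \<open>w'\<close> differs from \<open>w1\<close>, the two
  close a square whose fourth vertex \<open>z\<close> is above \<open>p\<close> by induction, and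
  the square orients the edge from \<open>z\<close> to \<open>w1\<close> upwards.\<close>

lemma up_convex:
  assumes "p \<in> V" "below p x" "below p y" "btw x w y"
  shows "below p w"
  using assms(2-4)
proof (induction "d x y" arbitrary: x w rule: less_induct)
  case less
  have V: "x \<in> V" "y \<in> V" "w \<in> V" using less.prems below_V assms(1) by (auto simp: btw_def)
  show ?case
  proof (cases "w = x")
    case True
    then show ?thesis using less.prems by simp
  next
    case False
    obtain w1 where w1: "(x, w1) \<in> E" "btw x w1 w" using btw_first[of x w] V False by blast
    have b: "btw x w1 y" "btw w1 w y" using btw_trans1[OF less.prems(3) w1(2)] V by auto
    have dl: "d w1 y < d x y" using b(1) dist_edge[OF w1(1)] by (auto simp: btw_def)
    have w1V: "w1 \<in> V" using w1 edge_V by auto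
    have "below p w1"
    proof (cases "(x, w1) \<in> ori")
      case True
      then show ?thesis using less.prems(1) by auto
    next
      case nori: False
      then have ori1: "(w1, x) \<in> ori" using ori_total[OF w1(1)] by auto
      obtain m where m: "btw x m y" "btw x m p" "btw y m p" using median[of x y p] V assms(1) by blast
      have mV: "m \<in> V" using m by (simp add: btw_def)
      have pm: "below p m" "below m x" using below_between[of p x m] less.prems m assms(1) btw_sym by auto
      \<comment> \<open>Otherwise x \<le> y, and every geodesic from \<open>x\<close> to
        \<open>y\<close> starts upwards.\<close>
      have mx: "m \<noteq> x"
      proof
        assume "m = x"
        then have "below x y" using below_between[of p y x] less.prems m assms(1) btw_sym by auto
        then have "below x w1" using below_between b(1) V by blast
        then show False using below_antisym[of x w1] ori1 V edge_irrefl w1(1) by auto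
      qed
      obtain w' where w': "(x, w') \<in> E" "btw x w' m" using btw_first[of x m] V mV mx by blast
      have bw': "below m w'" "below w' x" using below_between[of m x w'] pm mV w' btw_sym by auto
      have w'V: "w' \<in> V" using w' edge_V by auto
      have ori': "(w', x) \<in> ori" using below_edge[OF bw'(2) w'V] dist_edge[OF edge_sym[OF w'(1)]] by simp
      have pw': "below p w'" using pm bw' by auto
      show ?thesis
      proof (cases "w' = w1")
        case True
        then show ?thesis using pw' by simp
      next
        case ne: False
        have b': "btw x w' y" using btw_trans1[OF m(1) w'(2)] V by auto
        obtain z where z: "(z, w1) \<in> E" "(z, w') \<in> E" "btw y z w1" "btw y z w'"
          using quadrangle_btw[of w1 x w' y] w1 w' ne b b' btw_sym edge_sym V by metis
        have dl': "d w' y < d x y" using b' dist_edge[OF w'(1)] by (auto simp: btw_def)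
        have "below p z"
          using less.hyps[OF dl' pw' less.prems(2)] z(4) btw_sym by auto
        have "d y x = d y z + 2"
          using b z(3) dist_edge[OF w1(1)] dist_edge[OF z(1)] dist_sym[of x] dist_sym[of w1 y]
          by (auto simp: btw_def)
        then have "z \<noteq> x" by auto
        then have "(w', x) \<in> ori \<longleftrightarrow> (z, w1) \<in> ori"
          using square[of w' x w1 z] w' w1 z edge_sym ne by auto
        then show ?thesis using ori' \<open>below p z\<close> by auto
      qed
    qed
    then show ?thesis using less.hyps[OF dl] less.prems(2) b(2) by auto
  qed
qed

lemma below_dual: "(x, y) \<in> (ori\<inverse>)\<^sup>* \<longleftrightarrow> below y x"
  by (simp add: rtrancl_converse)

lemma down_convex:
  "p \<in> V \<Longrightarrow> below x p \<Longrightarrow> below y p \<Longrightarrow> btw x w y \<Longrightarrow> below w p"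
  by (rule modular_cx.up_convex[OF dual, unfolded below_dual])

section \<open>Meets, joins and the Helly property\<close>

definition glb :: "'a \<Rightarrow> 'a \<Rightarrow> 'a \<Rightarrow> bool" where
  "glb m x y \<longleftrightarrow> m \<in> V \<and> below m x \<and> below m y \<and> (\<forall>z. below z x \<longrightarrow> below z y \<longrightarrow> below z m)"

definition lub :: "'a \<Rightarrow> 'a \<Rightarrow> 'a \<Rightarrow> bool" where
  "lub m x y \<longleftrightarrow> m \<in> V \<and> below x m \<and> below y m \<and> (\<forall>z. below x z \<longrightarrow> below y z \<longrightarrow> below m z)"

lemma glb_dual: "modular_cx.glb G (ori\<inverse>) = lub"
  unfolding modular_cx.glb_def[OF dual] lub_def below_dual ..

text \<open>The meet of \<open>x\<close> and \<open>y\<close> is the gate of \<open>x\<close> in the principal ideal of \<open>y\<close>.\<close>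

lemma glb_ex_dist:
  assumes "x \<in> V" "y \<in> V" "below z x" "below z y"
  shows "\<exists>m. glb m x y \<and> btw x m y"
proof -
  have "\<exists>g. (g \<in> V \<and> below g y) \<and> (\<forall>g'. g' \<in> V \<and> below g' y \<longrightarrow> d x g \<le> d x g')"
    using assms(2) by (intro ex_has_least_nat[of _ y]) auto
  then obtain g where g: "g \<in> V" "below g y" "\<And>g'. g' \<in> V \<Longrightarrow> below g' y \<Longrightarrow> d x g \<le> d x g'" by blast
  \<comment> \<open>The median of \<open>x\<close>, \<open>g\<close> and \<open>u\<close> belongs to
    the ideal by convexity and lies between \<open>x\<close> and its nearest point \<open>g\<close>,
    so it is \<open>g\<close>.\<close>
  have gate: "btw x g u" if u: "u \<in> V" "below u y" for u
  proof -
    obtain n where n: "btw x n g" "btw x n u" "btw g n u" using median[of x g u] assms g u by blast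
    then have nV: "n \<in> V" by (simp add: btw_def)
    have "below n y" using down_convex[OF assms(2) g(2) u(2) n(3)] .
    then have "d x g \<le> d x n" using g(3) nV by simp
    then have "n = g" using n(1) nV g(1) dist_eq_0[of n g] by (simp add: btw_def)
    then show ?thesis using n by simp
  qed
  have zz: "below z' g \<and> below g x" if "below z' x" "below z' y" for z'
  proof -
    have "z' \<in> V" using that below_V' assms by blast
    then show ?thesis using below_between[OF that(1)] gate[of z'] that btw_sym by blast
  qed
  then have "glb g x y" using g assms unfolding glb_def by blast
  then show ?thesis using gate[of y] assms by blast
qed

lemma glb_unique: "glb m x y \<Longrightarrow> glb m' x y \<Longrightarrow> m = m'"
  unfolding glb_def using below_antisym by blast

lemma glb_btw:
  assumes "glb m x y" "x \<in> V" "y \<in> V"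
  shows "btw x m y"
  using glb_ex_dist[of x y m] glb_unique[OF assms(1)] assms unfolding glb_def by blast

lemma glb_ex: "x \<in> V \<Longrightarrow> y \<in> V \<Longrightarrow> below z x \<Longrightarrow> below z y \<Longrightarrow> \<exists>m. glb m x y"
  using glb_ex_dist by blast

lemma lub_ex: "x \<in> V \<Longrightarrow> y \<in> V \<Longrightarrow> below x z \<Longrightarrow> below y z \<Longrightarrow> \<exists>m. lub m x y"
  using modular_cx.glb_ex[OF dual] unfolding below_dual glb_dual .

lemma lub_btw: "lub m x y \<Longrightarrow> x \<in> V \<Longrightarrow> y \<in> V \<Longrightarrow> btw x m y"
  using modular_cx.glb_btw[OF dual] unfolding below_dual glb_dual .

text \<open>Each of \<open>x\<close>, \<open>y\<close>, \<open>z\<close> is below two of the three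
  bounds, and their median lies between these two, hence in each of the three convex
  filters.\<close>

lemma helly_up:
  assumes V: "x \<in> V" "y \<in> V" "z \<in> V"
    and "below x a" "below y a" "below y b" "below z b" "below x c" "below z c"
  shows "\<exists>m. below x m \<and> below y m \<and> below z m"
proof -
  have "a \<in> V" "b \<in> V" "c \<in> V" using assms below_V by auto
  then obtain m where "btw a m b" "btw a m c" "btw b m c" using median by blast
  then have "below x m" "below y m" "below z m"
    using up_convex[OF V(1), of a c m] up_convex[OF V(2), of a b m] up_convex[OF V(3), of b c m] assms
    by simp_all
  then show ?thesis by blast
qed

end

section \<open>Boolean pairs\<close>

text \<open>The image of the cube under \<open>F\<close>, with the images of cube edges only, serves
  as the subgraph. The graph is arbitrary because the lemma is applied to the 2-subdivision as
  well.\<close>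

lemma boolean_pairI:
  fixes F :: "nat set \<Rightarrow> 'a"
  assumes wf: "pair_wf_digraph G" and V: "F {} \<in> pverts G"
    and inj: "inj_on F (Pow {..<n})"
    and up: "\<And>S i. S \<subseteq> {..<n} \<Longrightarrow> i < n \<Longrightarrow> i \<notin> S \<Longrightarrow> (F S, F (insert i S)) \<in> ori"
    and ori: "\<And>u v. (u, v) \<in> ori \<Longrightarrow> (u, v) \<in> parcs G \<and> (v, u) \<in> parcs G"
  shows "boolean_pair G ori (F {}) (F {..<n})"
proof -
  let ?C = "cube_graph n"
  define FA where "FA = (\<lambda>(S, T). (F S, F T))"
  define B where "B = \<lparr> pverts = F ` pverts ?C, parcs = FA ` parcs ?C \<rparr>"
  have arc: "\<exists>i<n. i \<notin> S \<and> T = insert i S \<or> i \<notin> T \<and> S = insert i T" if "(S, T) \<in> parcs ?C" for S T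
  proof -
    have "card ((S - T) \<union> (T - S)) = 1" and sub: "S \<subseteq> {..<n}" "T \<subseteq> {..<n}"
      using that by (auto simp: cube_graph_def)
    then obtain i where i: "(S - T) \<union> (T - S) = {i}" by (auto simp: card_1_singleton_iff)
    then have "i < n" using sub by blast
    moreover have iff: "(x \<in> S) \<noteq> (x \<in> T) \<longleftrightarrow> x = i" for x
      using i unfolding set_eq_iff by simp blast
    have "i \<notin> S \<and> T = insert i S \<or> i \<notin> T \<and> S = insert i T"
    proof (cases "i \<in> S")
      case True
      then have "i \<notin> T" using iff[of i] by simp
      moreover have "x \<in> S \<longleftrightarrow> x \<in> insert i T" for x using iff[of x] True by auto
      ultimately show ?thesis by blast
    next
      case False
      then have "x \<in> T \<longleftrightarrow> x \<in> insert i S" for x using iff[of x] by auto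
      then show ?thesis using False by blast
    qed
    ultimately show ?thesis by blast
  qed
  have arcI: "(S, insert i S) \<in> parcs ?C" if "S \<subseteq> {..<n}" "i < n" "i \<notin> S" for S i
  proof -
    have "(S - insert i S) \<union> (insert i S - S) = {i}" using that by blast
    then show ?thesis using that by (auto simp: cube_graph_def)
  qed
  have sub: "S \<subseteq> {..<n}" "T \<subseteq> {..<n}" if "(S, T) \<in> parcs ?C" for S T
    using that by (auto simp: cube_graph_def)
  have arcsB: "parcs B \<subseteq> parcs G"
  proof
    fix e assume "e \<in> parcs B"
    then obtain S T where e: "e = (F S, F T)" "(S, T) \<in> parcs ?C" by (auto simp: B_def FA_def)
    obtain i where "i < n" "i \<notin> S \<and> T = insert i S \<or> i \<notin> T \<and> S = insert i T"
      using arc[OF e(2)] by blast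
    then show "e \<in> parcs G" using e(1) sub[OF e(2)] up ori by blast
  qed
  have oriB: "(F S, F (insert i S)) \<in> ori \<inter> parcs B" if "S \<subseteq> {..<n}" "i < n" "i \<notin> S" for S i
    using up[OF that] arcI[OF that] by (force simp: B_def FA_def)
  have chain: "(F S, F (S \<union> D)) \<in> (ori \<inter> parcs B)\<^sup>*" if "finite D" "S \<subseteq> {..<n}" "D \<subseteq> {..<n}" for S D
    using that(1,3)
  proof (induction D)
    case (insert i D)
    then have IH: "(F S, F (S \<union> D)) \<in> (ori \<inter> parcs B)\<^sup>*" by simp
    show ?case
    proof (cases "i \<in> S")
      case True
      then have "S \<union> insert i D = S \<union> D" by blast
      then show ?thesis using IH by simp
    next
      case False
      then have "(F (S \<union> D), F (insert i (S \<union> D))) \<in> ori \<inter> parcs B"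
        using insert.hyps insert.prems that(2) by (intro oriB) auto
      then show ?thesis using IH by (simp add: rtrancl_into_rtrancl)
    qed
  qed simp
  have bot: "(F {}, F S) \<in> (ori \<inter> parcs B)\<^sup>*" and top: "(F S, F {..<n}) \<in> (ori \<inter> parcs B)\<^sup>*"
    if "S \<subseteq> {..<n}" for S
  proof -
    have "finite S" using that finite_subset by blast
    then show "(F {}, F S) \<in> (ori \<inter> parcs B)\<^sup>*" using chain[of S "{}"] that by simp
    have "S \<union> {..<n} = {..<n}" using that by blast
    then show "(F S, F {..<n}) \<in> (ori \<inter> parcs B)\<^sup>*" using chain[of "{..<n}" S] that by simp
  qed
  have FV: "F S \<in> pverts G" if "S \<subseteq> {..<n}" for S
    using bot[OF that]
  proof (cases rule: rtranclE)
    case base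
    then show ?thesis using V by simp
  next
    case (step y)
    then show ?thesis using ori pair_wf_digraph.in_arcsD2[OF wf] by blast
  qed
  have vertsB: "pverts B \<subseteq> pverts G" using FV by (auto simp: B_def cube_graph_def)
  have wfC: "pair_wf_digraph ?C" by unfold_locales (auto simp: cube_graph_def)
  have wfB: "pair_wf_digraph B"
    by unfold_locales (auto simp: B_def FA_def cube_graph_def)
  have subgraph: "subgraph (with_proj B) (with_proj G)"
    using arcsB vertsB wf wfB by (simp add: subgraph_def compatible_def wf_digraph_wp_iff)
  have iso: "digraph_iso (with_proj ?C) (with_proj B)"
    unfolding digraph_iso_def
  proof (intro exI conjI)
    let ?f = "\<lparr> iso_verts = F, iso_arcs = FA, iso_head = snd, iso_tail = fst \<rparr>"
    have "inj_on FA (parcs ?C)"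
    proof (rule inj_onI)
      fix a b assume ab: "a \<in> parcs ?C" "b \<in> parcs ?C" "FA a = FA b"
      obtain S T S' T' where e: "a = (S, T)" "b = (S', T')" by (cases a, cases b)
      then have "F S = F S'" "F T = F T'" using ab(3) by (auto simp: FA_def)
      moreover have "S \<in> Pow {..<n}" "T \<in> Pow {..<n}" "S' \<in> Pow {..<n}" "T' \<in> Pow {..<n}"
        using ab(1,2) sub unfolding e by blast+
      ultimately show "a = b" unfolding e using inj by (simp add: inj_on_eq_iff)
    qed
    then show "pre_digraph.digraph_isomorphism (with_proj ?C) ?f"
      using inj wfC unfolding pre_digraph.digraph_isomorphism_def
      by (auto simp: wf_digraph_wp_iff cube_graph_def FA_def)
    show "with_proj B = app_iso ?f (with_proj ?C)"
      by (simp add: app_iso_def with_proj_def B_def)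
  qed
  have "cube_subgraph B G" unfolding cube_subgraph_def using subgraph iso by blast
  moreover have "F {} \<in> pverts B" "F {..<n} \<in> pverts B" by (auto simp: B_def cube_graph_def)
  moreover have "\<forall>x\<in>pverts B. (F {}, x) \<in> (ori \<inter> parcs B)\<^sup>* \<and> (x, F {..<n}) \<in> (ori \<inter> parcs B)\<^sup>*"
    using bot top by (auto simp: B_def cube_graph_def)
  moreover have "F {..<n} \<in> pverts G" using FV by simp
  ultimately show ?thesis unfolding boolean_pair_def using V by blast
qed

lemma cube_subgraphE:
  fixes B :: "'a pair_pre_digraph"
  assumes "cube_subgraph B G"
  obtains n :: nat and \<phi> :: "nat set \<Rightarrow> 'a" where "pverts B = \<phi> ` Pow {..<n}" "inj_on \<phi> (Pow {..<n})" "parcs B \<subseteq> parcs G"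
    "\<And>S T. S \<subseteq> {..<n} \<Longrightarrow> T \<subseteq> {..<n} \<Longrightarrow> card ((S - T) \<union> (T - S)) = 1 \<Longrightarrow> (\<phi> S, \<phi> T) \<in> parcs B"
proof -
  from assms obtain n f where sub: "subgraph (with_proj B) (with_proj G)"
    and f: "pre_digraph.digraph_isomorphism (with_proj (cube_graph n)) f"
    and B: "with_proj B = app_iso f (with_proj (cube_graph n))"
    unfolding cube_subgraph_def digraph_iso_def by blast
  have tails: "iso_tail f = fst" "iso_head f = snd" and verts: "pverts B = iso_verts f ` pverts (cube_graph n)"
    and arcs: "parcs B = iso_arcs f ` parcs (cube_graph n)"
    using B by (auto simp: app_iso_def with_proj_def)
  have "(iso_verts f S, iso_verts f T) \<in> parcs B" if "(S, T) \<in> parcs (cube_graph n)" for S T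
  proof -
    have "iso_arcs f (S, T) = (iso_verts f S, iso_verts f T)"
      using f that tails unfolding pre_digraph.digraph_isomorphism_def by (auto simp: prod_eq_iff)
    then show ?thesis using arcs that by (metis image_eqI)
  qed
  moreover have "inj_on (iso_verts f) (Pow {..<n})"
    using f by (simp add: pre_digraph.digraph_isomorphism_def cube_graph_def)
  moreover have "parcs B \<subseteq> parcs G" using sub by (simp add: subgraph_def)
  moreover have "pverts B = iso_verts f ` Pow {..<n}" using verts by (simp add: cube_graph_def)
  ultimately show ?thesis by (intro that[of "iso_verts f" n]) (auto simp: cube_graph_def)
qed

context modular_cx
begin

section \<open>Complemented intervals\<close>

lemma between_edge:
  assumes "(x, y) \<in> ori" "below x k" "below k y"
  shows "k = x \<or> k = y"
proof -
  have V: "x \<in> V" "y \<in> V" "k \<in> V" using assms ori_V below_V by blast+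
  have "1 = d x k + d k y"
    using below_dist_add[OF assms(2,3) V(1)] dist_edge[OF ori_E[OF assms(1)]] by simp
  then have "d x k = 0 \<or> d k y = 0" by linarith
  then show ?thesis using dist_eq_0 V by blast
qed

text \<open>The meet of \<open>c\<close> and \<open>x\<close> is \<open>p\<close>, since
  \<open>c\<close> covers \<open>p\<close>. Meet and join both lie on geodesics from
  \<open>c\<close> to \<open>x\<close>, and comparing lengths gives d x j = d p c = 1.\<close>

lemma atom_join:
  assumes "(p, c) \<in> ori" "below p x" "\<not> below c x" "lub j c x"
  shows "(x, j) \<in> ori"
proof -
  have V: "p \<in> V" "c \<in> V" "x \<in> V" "j \<in> V"
    using assms ori_V below_V by (blast, blast, blast, auto simp: lub_def)
  obtain m where m: "glb m c x" using glb_ex[of c x p] V assms by blast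
  then have "below p m" "below m c" "below m x" using assms unfolding glb_def by blast+
  then have "m = p" using between_edge[OF assms(1)] assms(3) by blast
  then have "d c x = d c p + d p x" using glb_btw[OF m V(2,3)] by (simp add: btw_def)
  moreover have "d c x = d c j + d j x" using lub_btw[OF assms(4) V(2,3)] by (simp add: btw_def)
  moreover have "below c j" "below x j" using assms(4) by (auto simp: lub_def)
  then have "d p j = d p c + d c j" "d p j = d p x + d x j"
    using below_dist_add[of p c j] below_dist_add[of p x j] assms V by auto
  moreover have "d p c = 1" using assms(1) ori_E dist_edge by blast
  ultimately have "d x j = 1" using dist_sym[of c p] dist_sym[of j x] by linarith
  then show ?thesis using below_edge[of x j] \<open>below x j\<close> V by blast
qed

text \<open>\<open>cpl p q\<close> says that \<open>q\<close> is the join of the atoms of \<open>[p,q]\<close>, i.e. that this modular lattice is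
  complemented.  Unlike Boolean pairs, this notion passes visibly to subintervals and joins.\<close>

definition cpl :: "'a \<Rightarrow> 'a \<Rightarrow> bool" where
  "cpl p q \<longleftrightarrow> p \<in> V \<and> below p q \<and>
    (\<forall>r. below p r \<longrightarrow> below r q \<longrightarrow> (\<forall>c. (p, c) \<in> ori \<longrightarrow> below c q \<longrightarrow> below c r) \<longrightarrow> r = q)"

lemma cpl_V: "cpl p q \<Longrightarrow> p \<in> V" "cpl p q \<Longrightarrow> q \<in> V" "cpl p q \<Longrightarrow> below p q"
  unfolding cpl_def using below_V by blast+

lemma cpl_refl: "p \<in> V \<Longrightarrow> cpl p p"
  unfolding cpl_def using below_antisym below_V by blast

text \<open>An atom \<open>c\<close> of [p,q] not below \<open>x\<close> gives the atom c \<squnion>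
  x of [x,q]. Thus an \<open>r\<close> above all atoms of [x,q] is above all atoms of [p,q].\<close>

lemma cpl_upper:
  assumes "cpl p q" "below p x" "below x q"
  shows "cpl x q"
  unfolding cpl_def
proof (intro conjI allI impI)
  have V: "p \<in> V" "q \<in> V" "x \<in> V" using cpl_V assms below_V by blast+
  show "x \<in> V" by fact
  show "below x q" by fact
  fix r assume r: "below x r" "below r q" and at: "\<forall>c. (x, c) \<in> ori \<longrightarrow> below c q \<longrightarrow> below c r"
  have "below c r" if c: "(p, c) \<in> ori" "below c q" for c
  proof (cases "below c x")
    case True
    then show ?thesis using r by (blast intro: rtrancl_trans)
  next
    case False
    have cV: "c \<in> V" using c ori_V by blast
    obtain j where j: "lub j c x" using lub_ex[of c x q] cV V assms c by blast
    then have "(x, j) \<in> ori" using atom_join[OF c(1) assms(2) False] by blast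
    moreover have "below j q" "below c j" using j c assms unfolding lub_def by blast+
    ultimately show ?thesis using at by (blast intro: rtrancl_trans)
  qed
  moreover have "below p r" using assms(2) r(1) by (rule rtrancl_trans)
  ultimately show "r = q" using assms(1) r(2) unfolding cpl_def by blast
qed

text \<open>Take \<open>x\<close> as far from \<open>p\<close> as possible among the elements
  meeting \<open>r\<close> in \<open>p\<close>. If x \<squnion> r missed an atom \<open>c\<close>,
  then c \<squnion> x would cover \<open>x\<close> and meet x \<squnion> r only in \<open>x\<close>,
  so it would still meet \<open>r\<close> in \<open>p\<close>.\<close>

lemma complement_ex:
  assumes "cpl p q" "below p r" "below r q"
  shows "\<exists>x. below p x \<and> below x q \<and> glb p x r \<and> lub q x r"
proof -
  have V: "p \<in> V" "q \<in> V" "r \<in> V" using cpl_V assms below_V by blast+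
  define P where "P x \<longleftrightarrow> below p x \<and> below x q \<and> glb p x r" for x
  have "P p" using assms V cpl_V unfolding P_def glb_def by blast
  moreover have "d p x < Suc (d p q)" if "P x" for x
    using below_dist_add[of p x q] that V unfolding P_def by auto
  ultimately obtain x where x: "P x" "\<And>y. P y \<Longrightarrow> d p y \<le> d p x"
    using ex_has_greatest_nat[of P p "d p" "Suc (d p q)"] by (metis less_imp_le)
  then have px: "below p x" "below x q" "glb p x r" by (auto simp: P_def)
  have xV: "x \<in> V" using px below_V V by blast
  obtain j where j: "lub j x r" using lub_ex[of x r q] xV V px assms by blast
  then have jb: "below x j" "below r j" "below j q" "j \<in> V" using px assms unfolding lub_def by blast+
  have "j = q"
  proof (rule ccontr)
    assume "j \<noteq> q"
    then obtain c where c: "(p, c) \<in> ori" "below c q" "\<not> below c j"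
      using assms(1) jb rtrancl_trans[OF px(1) jb(1)] unfolding cpl_def by blast
    have cx: "\<not> below c x" using c(3) jb(1) by (blast intro: rtrancl_trans)
    have cV: "c \<in> V" using c(1) ori_V by blast
    obtain e where e: "lub e c x" using lub_ex[of c x q] cV xV px c by blast
    then have eb: "below c e" "below x e" "below e q" "e \<in> V" using px c unfolding lub_def by blast+
    have xe: "(x, e) \<in> ori" using atom_join[OF c(1) px(1) cx e] .
    have pe: "below p e" using px(1) eb(2) by (rule rtrancl_trans)
    obtain g where g: "glb g e r" using glb_ex[of e r p] eb V pe assms by blast
    obtain k where k: "glb k e j" using glb_ex[of e j x] eb jb by blast
    have "below x k" "below k e" using k eb jb unfolding glb_def by blast+
    moreover have "k \<noteq> e" using k c(3) eb(1) unfolding glb_def by (blast intro: rtrancl_trans)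
    ultimately have kx: "k = x" using between_edge[OF xe] by blast
    have "below g j" using g jb(2) unfolding glb_def by (blast intro: rtrancl_trans)
    then have "below g x" using g k kx unfolding glb_def by blast
    then have "below g p" using g px(3) unfolding glb_def by blast
    moreover have "below p g" using g pe assms(2) unfolding glb_def by blast
    ultimately have "g = p" using below_antisym V by blast
    then have "P e" using g pe eb unfolding P_def by blast
    then have "d p e \<le> d p x" using x by blast
    moreover have "d p e = d p x + 1"
      using below_dist_add[OF px(1) eb(2) V(1)] dist_edge[OF ori_E[OF xe]] by simp
    ultimately show False by simp
  qed
  then show ?thesis using px j by blast
qed

text \<open>Let \<open>r\<close> lie below all coatoms and let \<open>x\<close> be a complement of
  it. If x \<noteq> q, a coatom above \<open>x\<close> is also above \<open>r\<close> and hence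
  above their join \<open>q\<close>, which is absurd; so x = q and r = p.\<close>

lemma cpl_dual1:
  assumes "cpl p q"
  shows "modular_cx.cpl G (ori\<inverse>) q p"
  unfolding modular_cx.cpl_def[OF dual] below_dual
proof (intro conjI allI impI)
  show "q \<in> V" "below p q" using cpl_V assms by blast+
  fix r assume r: "below r q" "below p r" "\<forall>c. (q, c) \<in> ori\<inverse> \<longrightarrow> below p c \<longrightarrow> below r c"
  obtain x where x: "below p x" "below x q" "glb p x r" "lub q x r"
    using complement_ex[OF assms r(2,1)] by blast
  show "r = p"
  proof (cases "x = q")
    case True
    then have "below r p" using x(3) r(1) unfolding glb_def by blast
    then show ?thesis using below_antisym r(2) cpl_V assms by blast
  next
    case False
    then obtain k where k: "below x k" "(k, q) \<in> ori" using x(2) by (blast elim: rtranclE)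
    have "below p k" using x(1) k(1) by (rule rtrancl_trans)
    then have "below r k" using r(3) k(2) by blast
    then have "below q k" using x(4) k(1) unfolding lub_def by blast
    then show ?thesis using k(2) below_antisym[of q k] ori_V[OF k(2)] ori_asym[OF k(2)] by blast
  qed
qed

lemma cpl_dual: "modular_cx.cpl G (ori\<inverse>) q p \<longleftrightarrow> cpl p q"
  using cpl_dual1 modular_cx.cpl_dual1[OF dual, of q p] unfolding converse_converse by blast

lemma cpl_lower:
  assumes "cpl p q" "below p x" "below x q"
  shows "cpl p x"
  using modular_cx.cpl_upper[OF dual, of q p x] assms unfolding cpl_dual below_dual by blast

lemma cpl_sub:
  assumes "cpl a b" "below a x" "below x y" "below y b"
  shows "cpl x y"
  using cpl_upper[OF cpl_lower[OF assms(1) _ assms(4)] assms(2,3)] rtrancl_trans[OF assms(2,3)]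
  by blast

text \<open>For each of the two elements, its meet with \<open>r\<close> contains all its atoms over
  \<open>p\<close> and is therefore the element itself; so \<open>r\<close> bounds both.\<close>

lemma cpl_join:
  assumes "cpl p x" "cpl p y" "lub j x y"
  shows "cpl p j"
  unfolding cpl_def
proof (intro conjI allI impI)
  have V: "p \<in> V" "x \<in> V" "y \<in> V" "j \<in> V" using cpl_V assms unfolding lub_def by blast+
  have j: "below x j" "below y j" using assms(3) unfolding lub_def by blast+
  have pxy: "below p x" "below p y" using assms cpl_V by blast+
  show "p \<in> V" by fact
  show "below p j" using pxy(1) j(1) by (rule rtrancl_trans)
  fix r assume r: "below p r" "below r j" "\<forall>c. (p, c) \<in> ori \<longrightarrow> below c j \<longrightarrow> below c r"
  have rV: "r \<in> V" using r V below_V by blast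
  have "below z r" if z: "cpl p z" "below z j" for z
  proof -
    have zV: "z \<in> V" "below p z" using cpl_V z by blast+
    obtain g where g: "glb g z r" using glb_ex[of z r p] zV rV r by blast
    have "below c g" if "(p, c) \<in> ori" "below c z" for c
      using g r(3) that rtrancl_trans[OF that(2) z(2)] unfolding glb_def by blast
    moreover have "below p g" "below g z" using g zV r(1) unfolding glb_def by blast+
    ultimately have "g = z" using z(1) unfolding cpl_def by blast
    then show ?thesis using g unfolding glb_def by blast
  qed
  then have "below x r" "below y r" using assms j by blast+
  then have "below j r" using assms(3) unfolding lub_def by blast
  then show "r = j" using r(2) below_antisym V by blast
qed

text \<open>The isomorphism may put \<open>p\<close> at any corner \<open>S0\<close>, and isometry
  of the cube is not assumed. By induction on the Hamming distance from \<open>S0\<close>, every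
  vertex of the cube is below \<open>r\<close>. At distance 1 it is an atom. Farther away it has two
  neighbours already below \<open>r\<close>, and it is either below one of them or their
  join.\<close>

lemma boolean_pair_cpl:
  assumes "boolean_pair G ori p q"
  shows "cpl p q"
proof (cases "p = q")
  case True
  then show ?thesis using assms cpl_refl unfolding boolean_pair_def by blast
next
  case False
  then obtain B where B: "cube_subgraph B G" "p \<in> pverts B" "q \<in> pverts B"
      "\<forall>x\<in>pverts B. (p, x) \<in> (ori \<inter> parcs B)\<^sup>* \<and> (x, q) \<in> (ori \<inter> parcs B)\<^sup>*"
    and V: "p \<in> V" "q \<in> V"
    using assms unfolding boolean_pair_def by blast
  obtain n :: nat and \<phi> :: "nat set \<Rightarrow> 'a" where \<phi>: "pverts B = \<phi> ` Pow {..<n}" "inj_on \<phi> (Pow {..<n})" "parcs B \<subseteq> E"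
    "\<And>S T. S \<subseteq> {..<n} \<Longrightarrow> T \<subseteq> {..<n} \<Longrightarrow> card ((S - T) \<union> (T - S)) = 1 \<Longrightarrow> (\<phi> S, \<phi> T) \<in> parcs B"
    by (rule cube_subgraphE[OF B(1)]) (rule that, assumption+)
  obtain S0 where S0: "S0 \<subseteq> {..<n}" "p = \<phi> S0"
    using B(2) unfolding \<phi>(1) by auto
  have mono: "(ori \<inter> parcs B)\<^sup>* \<subseteq> ori\<^sup>*" by (intro rtrancl_mono) blast
  have range: "below p (\<phi> S)" "below (\<phi> S) q" if "S \<subseteq> {..<n}" for S
  proof -
    have "\<phi> S \<in> pverts B" unfolding \<phi>(1) using that by simp
    then have "(p, \<phi> S) \<in> (ori \<inter> parcs B)\<^sup>*" "(\<phi> S, q) \<in> (ori \<inter> parcs B)\<^sup>*" using B(4) by simp_all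
    then show "below p (\<phi> S)" "below (\<phi> S) q" by (simp_all add: subsetD[OF mono])
  qed
  show ?thesis
    unfolding cpl_def
  proof (intro conjI allI impI)
    show "p \<in> V" by fact
    show "below p q" using B mono by blast
    fix r assume r: "below p r" "below r q" "\<forall>c. (p, c) \<in> ori \<longrightarrow> below c q \<longrightarrow> below c r"
    have all: "below (\<phi> S) r" if "S \<subseteq> {..<n}" for S
      using that
    proof (induction "card ((S - S0) \<union> (S0 - S))" arbitrary: S rule: less_induct)
      case less
      let ?D = "(S - S0) \<union> (S0 - S)"
      have "?D \<subseteq> {..<n}" using less.prems S0(1) by (intro Un_least) auto
      then have fin: "finite ?D" by (rule finite_subset) simp
      define flip where "flip i = (if i \<in> S then S - {i} else insert i S)" for i
      have flip: "flip i \<subseteq> {..<n} \<and> (\<phi> S, \<phi> (flip i)) \<in> E \<and> below (\<phi> (flip i)) r"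
        if i: "i \<in> ?D" for i
      proof -
        have T: "flip i \<subseteq> {..<n}" using i less.prems S0 by (auto simp: flip_def)
        have "(flip i - S0) \<union> (S0 - flip i) = ?D - {i}" using i by (auto simp: flip_def)
        then have "card ((flip i - S0) \<union> (S0 - flip i)) < card ?D"
          using i fin by (metis card_Diff1_less)
        then have "below (\<phi> (flip i)) r" using less.hyps T by blast
        moreover have "(S - flip i) \<union> (flip i - S) = {i}" by (auto simp: flip_def)
        then have "(\<phi> S, \<phi> (flip i)) \<in> E" using \<phi>(3) \<phi>(4)[OF less.prems T] by auto
        ultimately show ?thesis using T by blast
      qed
      consider "?D = {}" | i where "?D = {i}" | i j where "i \<in> ?D" "j \<in> ?D" "i \<noteq> j" by blast
      then show ?case
      proof cases
        case 1
        then have "S = S0" by blast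
        then show ?thesis using S0 r(1) by simp
      next
        case 2
        then have "(S0 - S) \<union> (S - S0) = {i}" by blast
        then have "(p, \<phi> S) \<in> E" using \<phi>(3) \<phi>(4)[OF S0(1) less.prems] S0(2) by auto
        moreover have "(\<phi> S, p) \<notin> ori"
          using range(1)[OF less.prems] below_antisym[of p "\<phi> S"] V ori_asym by blast
        ultimately have "(p, \<phi> S) \<in> ori" using ori_total by blast
        then show ?thesis using r(3) range(2)[OF less.prems] by blast
      next
        case 3
        let ?x = "\<phi> S" and ?y = "\<phi> (flip i)" and ?z = "\<phi> (flip j)"
        have y: "flip i \<subseteq> {..<n}" "(?x, ?y) \<in> E" "below ?y r"
          and z: "flip j \<subseteq> {..<n}" "(?x, ?z) \<in> E" "below ?z r"
          using flip[OF 3(1)] flip[OF 3(2)] by blast+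
        have "flip i \<noteq> flip j" using 3(3) by (auto simp: flip_def split: if_splits)
        then have yz: "?y \<noteq> ?z" using inj_onD[OF \<phi>(2), of "flip i" "flip j"] y(1) z(1) by blast
        show ?thesis
        proof (cases "(?x, ?y) \<in> ori \<or> (?x, ?z) \<in> ori")
          case True
          then show ?thesis using y(3) z(3) by (blast intro: converse_rtrancl_into_rtrancl)
        next
          case False
          then have o: "(?y, ?x) \<in> ori" "(?z, ?x) \<in> ori" using ori_total y(2) z(2) by blast+
          then obtain k where k: "lub k ?y ?z" using lub_ex[of ?y ?z ?x] ori_V by blast
          then have kb: "below ?y k" "below ?z k" "below k ?x" "below k r"
            using o y(3) z(3) unfolding lub_def by blast+
          have "k \<noteq> ?y"
          proof
            assume "k = ?y"
            then have "?y = ?z \<or> ?y = ?x" using between_edge[OF o(2)] kb o(1) by blast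
            then show False using yz y(2) edge_irrefl by auto
          qed
          then have "k = ?x" using between_edge[OF o(1) kb(1,3)] by blast
          then show ?thesis using kb(4) by simp
        qed
      qed
    qed
    obtain S1 where "S1 \<subseteq> {..<n}" "q = \<phi> S1"
      using B(3) unfolding \<phi>(1) by auto
    then have "below q r" using all by simp
    then show "r = q" using r(2) below_antisym V by blast
  qed
qed

text \<open>An atom \<open>c\<close> with complement \<open>x\<close> is split off: a cube for [p,x]
  is doubled by joining with \<open>c\<close>, and the new coordinate \<open>n\<close> records
  whether \<open>c\<close> lies below. The order bounds in the conclusion feed the doubling and the
  product cubes in the 2-subdivision.\<close>

lemma cpl_cube:
  assumes "cpl p q"
  shows "\<exists>(n :: nat) F. inj_on F (Pow {..<n}) \<and> F {} = p \<and> F {..<n} = q \<and>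
    (\<forall>S i. S \<subseteq> {..<n} \<longrightarrow> i < n \<longrightarrow> i \<notin> S \<longrightarrow> (F S, F (insert i S)) \<in> ori) \<and>
    (\<forall>S\<subseteq>{..<n}. below p (F S) \<and> below (F S) q)"
  using assms
proof (induction "d p q" arbitrary: q rule: less_induct)
  case less
  have V: "p \<in> V" "q \<in> V" "below p q" using cpl_V less.prems by blast+
  show ?case
  proof (cases "p = q")
    case True
    then show ?thesis by (intro exI[of _ 0] exI[of _ "\<lambda>_. p"]) auto
  next
    case False
    then obtain c where c: "(p, c) \<in> ori" "below c q" using V(3) by (blast elim: converse_rtranclE)
    have cV: "c \<in> V" using c ori_V by blast
    have pc: "below p c" using c by blast
    obtain x where x: "below p x" "below x q" "glb p x c" "lub q x c"
      using complement_ex[OF less.prems pc c(2)] by blast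
    have cx: "\<not> below c x"
    proof
      assume "below c x"
      then have "below c p" using x(3) unfolding glb_def by blast
      then show False using below_antisym[of p c] pc V c(1) ori_asym by blast
    qed
    have "d p x < d p q"
    proof -
      have "x \<noteq> q" using cx c(2) by blast
      then have "d x q \<noteq> 0" using dist_eq_0 below_V x(1) V by blast
      then show ?thesis using below_dist_add[OF x(1,2) V(1)] by simp
    qed
    moreover have "cpl p x" using cpl_lower[OF less.prems x(1,2)] .
    ultimately obtain n :: nat and F where F: "inj_on F (Pow {..<n})" "F {} = p" "F {..<n} = x"
      "\<And>S i. S \<subseteq> {..<n} \<Longrightarrow> i < n \<Longrightarrow> i \<notin> S \<Longrightarrow> (F S, F (insert i S)) \<in> ori"
      "\<And>S. S \<subseteq> {..<n} \<Longrightarrow> below p (F S) \<and> below (F S) x"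
      using less.hyps[of x] by blast
    define J where "J u = (SOME j. lub j c u)" for u
    have J: "lub (J u) c u" if "below p u" "below u x" for u
    proof -
      have "u \<in> V" using that(1) V(1) below_V by blast
      moreover have "below u q" using that(2) x(2) by (rule rtrancl_trans)
      ultimately have "\<exists>j. lub j c u" using lub_ex[of c u q] cV c(2) by blast
      then show ?thesis unfolding J_def by (rule someI_ex)
    qed
    have Jb: "(u, J u) \<in> ori" "below c (J u)" "below (J u) q" "\<And>z. below c z \<Longrightarrow> below u z \<Longrightarrow> below (J u) z"
      if u: "below p u" "below u x" for u
    proof -
      have "\<not> below c u" using cx u(2) by (blast intro: rtrancl_trans)
      then show "(u, J u) \<in> ori" using atom_join[OF c(1) u(1)] J[OF u] by blast
      have "below u q" using u(2) x(2) by (rule rtrancl_trans)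
      then show "below c (J u)" "below (J u) q" "\<And>z. below c z \<Longrightarrow> below u z \<Longrightarrow> below (J u) z"
        using J[OF u] c(2) unfolding lub_def by blast+
    qed
    \<comment> \<open>The join of \<open>u\<close> and \<open>w\<close> lies between
      \<open>u\<close> and \<open>J u\<close> but stays below \<open>x\<close>, so it is
      \<open>u\<close>; by symmetry it is \<open>w\<close>.\<close>
    have Jinj: "u = w" if u: "below p u" "below u x" and w: "below p w" "below w x" and eq: "J u = J w" for u w
    proof -
      have uV: "u \<in> V" "w \<in> V" using u w V(1) below_V by blast+
      obtain k where k: "lub k u w" using lub_ex[OF uV u(2) w(2)] by blast
      have "below u (J u)" "below w (J w)" using Jb(1) u w by blast+
      then have kb: "below u k" "below w k" "below k (J u)" "below k (J w)" "below k x"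
        using k u w eq unfolding lub_def by (blast, blast, metis, metis, blast)
      have "k \<noteq> J u" "k \<noteq> J w"
        using Jb(2)[OF u] Jb(2)[OF w] kb(5) cx by (blast intro: rtrancl_trans)+
      then have "k = u" "k = w"
        using between_edge[OF Jb(1)[OF u] kb(1,3)] between_edge[OF Jb(1)[OF w] kb(2,4)] by blast+
      then show ?thesis by simp
    qed
    \<comment> \<open>Joining with \<open>c\<close> raises every rank over \<open>p\<close> by 1, so
      ranks of images differ by 1 as well.\<close>
    have Jmono: "(J u, J w) \<in> ori" if u: "below p u" "below u x" and w: "below p w" "below w x"
      and uw: "(u, w) \<in> ori" for u w
    proof -
      have "below u (J w)" using uw Jb(1)[OF w] by (blast intro: rtrancl_trans)
      then have le: "below (J u) (J w)" using Jb(2)[OF w] Jb(4)[OF u] by blast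
      have JV: "J u \<in> V" using Jb(1)[OF u] ori_V by blast
      have "below p (J u)" using u(1) Jb(1)[OF u] by (rule rtrancl_into_rtrancl)
      then have "d p (J w) = d p (J u) + d (J u) (J w)" using below_dist_add le V(1) by blast
      moreover have step: "d p z' = d p z + 1" if "below p z" "(z, z') \<in> ori" for z z'
        using below_dist_add[of p z z'] that V(1) dist_edge[OF ori_E[OF that(2)]] by auto
      have "d p (J w) = d p w + 1" "d p (J u) = d p u + 1" "d p w = d p u + 1"
        using step u w uw Jb(1) by blast+
      ultimately have "d (J u) (J w) = 1" by simp
      then show ?thesis using below_edge le JV by blast
    qed
    define H where "H S = (if n \<in> S then J (F (S - {n})) else F S)" for S
    have sub1: "S - {n} \<subseteq> {..<n}" if "S \<subseteq> {..<Suc n}" for S using that by (auto simp: less_Suc_eq)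
    have sub2: "S \<subseteq> {..<n}" if "S \<subseteq> {..<Suc n}" "n \<notin> S" for S using that by (force simp: less_Suc_eq)
    have Hc: "below c (H S) \<longleftrightarrow> n \<in> S" if S: "S \<subseteq> {..<Suc n}" for S
    proof (cases "n \<in> S")
      case True
      then show ?thesis using Jb(2) F(5)[OF sub1[OF S]] by (simp add: H_def)
    next
      case False
      then have "below (H S) x" using F(5)[OF sub2[OF S]] by (simp add: H_def)
      then show ?thesis using cx False by (blast intro: rtrancl_trans)
    qed
    show ?thesis
    proof (intro exI[of _ "Suc n"] exI[of _ H] conjI allI impI)
      show "inj_on H (Pow {..<Suc n})"
      proof (rule inj_onI)
        fix S T assume "S \<in> Pow {..<Suc n}" "T \<in> Pow {..<Suc n}" and eq: "H S = H T"
        then have S: "S \<subseteq> {..<Suc n}" and T: "T \<subseteq> {..<Suc n}" by blast+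
        have nn: "n \<in> S \<longleftrightarrow> n \<in> T" using Hc[OF S] Hc[OF T] eq by simp
        show "S = T"
        proof (cases "n \<in> S")
          case True
          then have "J (F (S - {n})) = J (F (T - {n}))" using eq nn by (simp add: H_def)
          then have "F (S - {n}) = F (T - {n})" using Jinj F(5) sub1[OF S] sub1[OF T] by blast
          then have "S - {n} = T - {n}" using inj_onD[OF F(1)] sub1[OF S] sub1[OF T] by blast
          then show ?thesis using True nn by blast
        next
          case False
          then have "F S = F T" using eq nn by (simp add: H_def)
          then show ?thesis using inj_onD[OF F(1)] sub2[OF S] sub2[OF T] False nn by blast
        qed
      qed
      show "H {} = p" using F(2) by (simp add: H_def)
      have "{..<Suc n} - {n} = {..<n}" by auto
      then have "H {..<Suc n} = J x" using F(3) by (simp add: H_def)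
      moreover have "J x = q"
        using Jb[of x] x c(2) below_antisym[of "J x" q] below_V[of x "J x"] x(4) V below_V[OF x(1)]
        unfolding lub_def by blast
      ultimately show "H {..<Suc n} = q" by simp
    next
      fix S i assume S: "S \<subseteq> {..<Suc n}" and i: "i < Suc n" "i \<notin> S"
      show "(H S, H (insert i S)) \<in> ori"
      proof (cases "i = n")
        case True
        then have "insert i S - {n} = S" using i by blast
        then show ?thesis using True i Jb(1) F(5)[OF sub2[OF S]] by (simp add: H_def)
      next
        case False
        then have "i < n" using i by simp
        show ?thesis
        proof (cases "n \<in> S")
          case True
          have ins: "insert i S - {n} = insert i (S - {n})" using False by blast
          have S': "insert i (S - {n}) \<subseteq> {..<n}" using sub1[OF S] \<open>i < n\<close> by auto
          have "(F (S - {n}), F (insert i (S - {n}))) \<in> ori" using F(4)[OF sub1[OF S] \<open>i < n\<close>] i by blast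
          then show ?thesis
            using True False Jmono F(5)[OF sub1[OF S]] F(5)[OF S'] by (simp add: H_def ins)
        next
          case nS: False
          then show ?thesis using False F(4)[OF sub2[OF S nS] \<open>i < n\<close> i(2)] by (simp add: H_def)
        qed
      qed
    next
      fix S assume S: "S \<subseteq> {..<Suc n}"
      show "below p (H S)" "below (H S) q"
      proof (atomize (full), cases "n \<in> S")
        case True
        then show "below p (H S) \<and> below (H S) q"
          using F(5)[OF sub1[OF S]] Jb(1,3) by (auto simp: H_def intro: rtrancl_into_rtrancl)
      next
        case False
        then show "below p (H S) \<and> below (H S) q"
          using F(5)[OF sub2[OF S False]] x(2) by (auto simp: H_def intro: rtrancl_trans)
      qed
    qed
  qed
qed

lemma cpl_boolean_pair:
  assumes "cpl p q"
  shows "boolean_pair G ori p q"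
proof -
  obtain n :: nat and F where F: "inj_on F (Pow {..<n})" "F {} = p" "F {..<n} = q"
    "\<And>S i. S \<subseteq> {..<n} \<Longrightarrow> i < n \<Longrightarrow> i \<notin> S \<Longrightarrow> (F S, F (insert i S)) \<in> ori"
    using cpl_cube[OF assms] by blast
  have "F {} \<in> V" using F(2) cpl_V assms by blast
  from boolean_pairI[OF wf this F(1,4)] show ?thesis
    using ori_E edge_sym F(2,3) by blast
qed

lemma boolean_pair_iff: "boolean_pair G ori p q \<longleftrightarrow> cpl p q"
  using boolean_pair_cpl cpl_boolean_pair by blast

lemma glbD: "glb m x y \<Longrightarrow> m \<in> V" "glb m x y \<Longrightarrow> below m x" "glb m x y \<Longrightarrow> below m y"
  "glb m x y \<Longrightarrow> below z x \<Longrightarrow> below z y \<Longrightarrow> below z m"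
  by (simp_all add: glb_def)

lemma lubD: "lub m x y \<Longrightarrow> m \<in> V" "lub m x y \<Longrightarrow> below x m" "lub m x y \<Longrightarrow> below y m"
  "lub m x y \<Longrightarrow> below x z \<Longrightarrow> below y z \<Longrightarrow> below m z"
  by (simp_all add: lub_def)

section \<open>Lengths of geodesics\<close>

lemma h_square:
  assumes "(u, v) \<in> E" "(v, v') \<in> E" "(v', u') \<in> E" "(u', u) \<in> E" "u \<noteq> v'" "v \<noteq> u'"
  shows "h {u, v} = h {u', v'}"
proof -
  have cyc: "four_cycle G u v v' u'" by (rule square_cycle[OF assms])
  have "{u, v} \<inter> {v', u'} = {}" using cyc by (auto simp: four_cycle_def)
  then have "({u, v}, {v', u'}) \<in> opposite_edges G"
    unfolding opposite_edges_def mem_Collect_eq prod.case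
    by (intro exI[of _ u] exI[of _ v] exI[of _ v'] exI[of _ u'] conjI cyc) simp_all
  moreover have "{u, v} \<in> graph_edges G" "{v', u'} \<in> graph_edges G"
    using assms(1,3) by (auto simp: graph_edges_def)
  ultimately have "projective G {u, v} {v', u'}" unfolding projective_def by blast
  then have "h {u, v} = h {v', u'}"
    using complex unfolding modular_complex_def orbit_invariant_def by blast
  then show ?thesis by (simp add: insert_commute)
qed

lemma h_pos: "(u, v) \<in> E \<Longrightarrow> 0 < h {u, v}"
  using complex by (auto simp: modular_complex_def graph_edges_def)

primrec hlen :: "'a \<Rightarrow> nat \<Rightarrow> 'a \<Rightarrow> real" where
  "hlen x 0 y = 0"
| "hlen x (Suc n) y = (let w = SOME w. (w, y) \<in> E \<and> d x w = n in hlen x n w + h {w, y})"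

text \<open>The \<open>h\<close>-length of the geodesics from \<open>x\<close> to \<open>y\<close>; by the quadrangle condition all of them have
  the same one.\<close>

definition hdist :: "'a \<Rightarrow> 'a \<Rightarrow> real" where
  "hdist x y = hlen x (d x y) y"

lemma hdist_self [simp]: "hdist x x = 0"
  by (simp add: hdist_def)

text \<open>Different last steps into \<open>y\<close> close a square by the quadrangle condition,
  and its opposite edges have equal length. Hence the predecessor picked by \<open>SOME\<close> in
  \<open>hlen\<close> does not affect the value.\<close>

lemma hdist_step:
  assumes "x \<in> V" "(w, y) \<in> E" "d x y = Suc (d x w)"
  shows "hdist x y = hdist x w + h {w, y}"
  using assms(2,3)
proof (induction "d x w" arbitrary: w y)
  case 0
  let ?P = "\<lambda>w'. (w', y) \<in> E \<and> d x w' = 0"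
  define w0 where "w0 = (SOME w'. ?P w')"
  have "?P w" using 0 by simp
  then have w0: "?P w0" unfolding w0_def by (rule someI)
  then have "w0 = w" using dist_eq_0[OF assms(1)] 0 edge_V(1) by metis
  moreover have "d x y = Suc 0" using 0 by simp
  then have "hdist x y = 0 + h {w0, y}" unfolding hdist_def by (simp add: Let_def w0_def)
  moreover have "hdist x w = 0" using 0(1) by (simp add: hdist_def flip: 0(1))
  ultimately show ?case by simp
next
  case (Suc n)
  let ?P = "\<lambda>w'. (w', y) \<in> E \<and> d x w' = Suc n"
  define w0 where "w0 = (SOME w'. ?P w')"
  have w0: "(w0, y) \<in> E" "d x w0 = Suc n"
    using someI[of ?P w] Suc unfolding w0_def by auto
  have dy: "d x y = Suc (Suc n)" using Suc by simp
  have y: "hdist x y = hdist x w0 + h {w0, y}"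
    unfolding hdist_def dy w0(2) by (simp add: Let_def w0_def)
  show ?case
  proof (cases "w0 = w")
    case True
    then show ?thesis using y by simp
  next
    case False
    obtain z where z: "(z, w0) \<in> E" "(z, w) \<in> E" "d x w0 = Suc (d x z)"
      using quadrangle[of w0 y w x] w0 Suc False assms(1) by auto
    have dz: "n = d x z" using z(3) w0(2) by simp
    have "hdist x w0 = hdist x z + h {z, w0}" "hdist x w = hdist x z + h {z, w}"
      using Suc.hyps(1)[OF dz z(1)] Suc.hyps(1)[OF dz z(2)] w0(2) Suc.hyps(2) dz by auto
    moreover have zy: "z \<noteq> y" using dy dz by auto
    have "h {z, w0} = h {w, y}"
      using h_square[of z w0 y w] z w0(1) Suc.prems(1) edge_sym zy False by blast
    moreover have "h {w0, y} = h {z, w}"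
      using h_square[of w0 y w z] z w0(1) Suc.prems(1) edge_sym zy False by blast
    ultimately show ?thesis using y by simp
  qed
qed

lemma hdist_add:
  assumes "x \<in> V" "y \<in> V" "btw x w y"
  shows "hdist x y = hdist x w + hdist w y"
  using assms(2,3)
proof (induction "d w y" arbitrary: y)
  case 0
  then have "w = y" using dist_eq_0 by (auto simp: btw_def)
  then show ?case by simp
next
  case (Suc n)
  have wV: "w \<in> V" using Suc.prems by (simp add: btw_def)
  have "w \<noteq> y" using Suc.hyps(2) by auto
  then obtain u where u: "(u, y) \<in> E" "btw w u y" using btw_last wV Suc.prems(1) by blast
  have uV: "u \<in> V" using u edge_V by blast
  have b: "btw x u y" "btw x w u" using btw_trans2[OF Suc.prems(2) u(2) assms(1) Suc.prems(1)] .
  have "d u y = 1" using u(1) by (rule dist_edge)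
  then have "n = d w u" "d w y = Suc (d w u)" "d x y = Suc (d x u)"
    using u(2) b(1) Suc.hyps(2) by (auto simp: btw_def)
  then show ?case
    using Suc.hyps(1)[OF _ uV b(2)] hdist_step[OF assms(1) u(1)] hdist_step[OF wV u(1)] by simp
qed

lemma hdist_edge: "(u, v) \<in> E \<Longrightarrow> hdist u v = h {u, v}"
  using hdist_step[of u u v] edge_V[of u v] dist_edge[of u v] by simp

lemma hdist_sym:
  assumes "x \<in> V" "y \<in> V"
  shows "hdist x y = hdist y x"
  using assms(2)
proof (induction "d x y" arbitrary: y)
  case 0
  then show ?case using dist_eq_0 assms(1) by auto
next
  case (Suc n)
  then have "x \<noteq> y" by auto
  then obtain u where u: "(u, y) \<in> E" "btw x u y" using btw_last assms(1) Suc.prems by blast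
  have uV: "u \<in> V" using u edge_V by blast
  have "n = d x u" using u dist_edge[OF u(1)] Suc.hyps(2) by (auto simp: btw_def)
  then have "hdist x u = hdist u x" using Suc.hyps(1) uV by blast
  moreover have "hdist x y = hdist x u + hdist u y" using hdist_add[OF assms(1) Suc.prems u(2)] .
  moreover have "hdist y x = hdist y u + hdist u x"
    using hdist_add[OF Suc.prems assms(1)] u(2) btw_sym by blast
  moreover have "hdist u y = hdist y u"
    using hdist_edge u(1) edge_sym by (metis insert_commute)
  ultimately show ?case by simp
qed

text \<open>By bipartiteness one end is nearer to \<open>x\<close> by one step, so
  \<open>hdist_step\<close> applies in one direction. This supplies the potential for distances in
  the 2-subdivision.\<close>

lemma hdist_edge_diff:
  assumes "x \<in> V" "(u, v) \<in> E"
  shows "\<bar>hdist x u - hdist x v\<bar> = h {u, v}"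
  using dist_edge_cases[OF assms(2,1)]
proof
  assume "d x u = Suc (d x v)"
  then have "hdist x u = hdist x v + h {v, u}"
    using hdist_step[OF assms(1) edge_sym[OF assms(2)]] by blast
  then show ?thesis using h_pos[OF assms(2)] by (simp add: insert_commute)
next
  assume "d x v = Suc (d x u)"
  then have "hdist x v = hdist x u + h {u, v}" using hdist_step[OF assms] by blast
  then show ?thesis using h_pos[OF assms(2)] by simp
qed

lemma hdist_below_step:
  assumes "below p u" "(u, v) \<in> ori" "p \<in> V"
  shows "hdist p v = hdist p u + h {u, v}"
proof (rule hdist_step[OF assms(3) ori_E[OF assms(2)]])
  show "d p v = Suc (d p u)"
    using below_dist_add[OF assms(1) r_into_rtrancl[OF assms(2)] assms(3)]
      dist_edge[OF ori_E[OF assms(2)]] by simp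
qed

lemma hdist_below_mono:
  assumes "below p u" "below u v" "p \<in> V"
  shows "hdist p u \<le> hdist p v" "u \<noteq> v \<Longrightarrow> hdist p u < hdist p v"
proof -
  have "hdist p u \<le> hdist p v \<and> (u = v \<or> hdist p u < hdist p v)"
    using assms(2)
  proof (induction rule: rtrancl_induct)
    case base
    then show ?case by simp
  next
    case (step y z)
    have "hdist p z = hdist p y + h {y, z}"
      using hdist_below_step[OF rtrancl_trans[OF assms(1) step(1)] step(2) assms(3)] .
    then show ?case using step.IH h_pos[OF ori_E[OF step(2)]] by auto
  qed
  then show "hdist p u \<le> hdist p v" "u \<noteq> v \<Longrightarrow> hdist p u < hdist p v" by auto
qed

text \<open>Meet and join lie on geodesics from \<open>x\<close> to \<open>y\<close>, so both routes
  have length \<open>hdist x y\<close>; the rest is additivity over \<open>p\<close>.\<close>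

lemma hdist_modular:
  assumes "p \<in> V" "below p x" "below p y" "glb m x y" "lub j x y"
  shows "hdist p m + hdist p j = hdist p x + hdist p y"
proof -
  have V: "x \<in> V" "y \<in> V" "m \<in> V" "j \<in> V"
    using below_V[OF assms(2,1)] below_V[OF assms(3,1)] glbD(1)[OF assms(4)] lubD(1)[OF assms(5)]
    by simp_all
  have b: "below p m" "below m x" "below m y" "below x j" "below y j"
    using glbD(4)[OF assms(4,2,3)] glbD(2,3)[OF assms(4)] lubD(2,3)[OF assms(5)] by simp_all
  have "hdist p x = hdist p m + hdist m x"
    by (rule hdist_add[OF assms(1) V(1) below_btw[OF b(1,2) assms(1)]])
  moreover have "hdist p y = hdist p m + hdist m y"
    by (rule hdist_add[OF assms(1) V(2) below_btw[OF b(1,3) assms(1)]])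
  moreover have "hdist p j = hdist p x + hdist x j"
    by (rule hdist_add[OF assms(1) V(4) below_btw[OF assms(2) b(4) assms(1)]])
  moreover have "hdist p j = hdist p y + hdist y j"
    by (rule hdist_add[OF assms(1) V(4) below_btw[OF assms(3) b(5) assms(1)]])
  moreover have "hdist x y = hdist x m + hdist m y"
    by (rule hdist_add[OF V(1,2) glb_btw[OF assms(4) V(1,2)]])
  moreover have "hdist x y = hdist x j + hdist j y"
    by (rule hdist_add[OF V(1,2) lub_btw[OF assms(5) V(1,2)]])
  moreover have "hdist x m = hdist m x" by (rule hdist_sym[OF V(1,3)])
  moreover have "hdist j y = hdist y j" by (rule hdist_sym[OF V(4,2)])
  ultimately show ?thesis by linarith
qed

end

section \<open>Neighborhood semilattices and L-convexity\<close>

lemma boolean_pair_rtrancl: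
  fixes G :: "'a pair_pre_digraph"
  assumes "boolean_pair G ori p q"
  shows "(p, q) \<in> ori\<^sup>*"
proof (cases "p = q")
  case False
  then obtain B :: "'a pair_pre_digraph" where "(p, q) \<in> (ori \<inter> parcs B)\<^sup>*"
    using assms unfolding boolean_pair_def by blast
  moreover have "(ori \<inter> parcs B)\<^sup>* \<subseteq> ori\<^sup>*" by (rule rtrancl_mono) simp
  ultimately show ?thesis by blast
qed simp

context modular_cx
begin

lemma lub_dual: "modular_cx.lub G (ori\<inverse>) = glb"
  unfolding modular_cx.lub_def[OF dual] glb_def below_dual ..

lemma cpl_meet:
  assumes "cpl x p" "cpl y p" "glb m x y"
  shows "cpl m p"
  using modular_cx.cpl_join[OF dual, unfolded cpl_dual lub_dual, OF assms] .

lemma hdist_above_mono: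
  assumes "below u p" "below v u" "p \<in> V"
  shows "hdist p u \<le> hdist p v" "u \<noteq> v \<Longrightarrow> hdist p u < hdist p v"
  using modular_cx.hdist_below_mono[OF dual, unfolded below_dual, OF assms] by blast+

lemma hdist_modular_below:
  assumes "p \<in> V" "below x p" "below y p" "glb m x y" "lub j x y"
  shows "hdist p m + hdist p j = hdist p x + hdist p y"
  using modular_cx.hdist_modular[OF dual, unfolded below_dual glb_dual lub_dual,
      OF assms(1-3,5,4)] by simp

section \<open>Order and cubes of the 2-subdivision\<close>

abbreviation "G2 \<equiv> subdiv_graph G ori"
abbreviation "ori2 \<equiv> subdiv_ori G ori"

lemma subdiv_verts: "(a, b) \<in> pverts G2 \<longleftrightarrow> cpl a b"
  by (simp add: subdiv_graph_def boolean_pair_iff)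

lemma subdiv_arcs: "((a, b), (a', b')) \<in> parcs G2 \<longleftrightarrow>
    cpl a b \<and> cpl a' b' \<and> (a = a' \<and> (b, b') \<in> E \<or> b = b' \<and> (a, a') \<in> E)"
  by (simp add: subdiv_graph_def boolean_pair_iff)

lemma subdiv_ori_iff: "((a, b), (a', b')) \<in> ori2 \<longleftrightarrow>
    cpl a b \<and> cpl a' b' \<and> (a = a' \<and> (b, b') \<in> ori \<or> b = b' \<and> (a', a) \<in> ori)"
  unfolding subdiv_ori_def mem_Collect_eq prod.case subdiv_arcs
  using ori_E edge_sym by blast

lemma wf_subdiv: "pair_wf_digraph G2"
  by unfold_locales (auto simp: subdiv_graph_def)

lemma subdiv_ori_arcs: "(u, v) \<in> ori2 \<Longrightarrow> (u, v) \<in> parcs G2 \<and> (v, u) \<in> parcs G2"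
  using ori_E edge_sym by (cases u, cases v) (simp only: subdiv_ori_iff subdiv_arcs, blast)

lemma subdiv_below_imp:
  "(x, y) \<in> ori2\<^sup>* \<Longrightarrow> below (fst y) (fst x) \<and> below (snd x) (snd y)"
proof (induction rule: rtrancl_induct)
  case (step y z)
  have "fst y = fst z \<and> (snd y, snd z) \<in> ori \<or> snd y = snd z \<and> (fst z, fst y) \<in> ori"
    using step(2) subdiv_ori_iff[of "fst y" "snd y" "fst z" "snd z"] unfolding prod.collapse by blast
  then show ?case
    using step.IH by (metis converse_rtrancl_into_rtrancl rtrancl_into_rtrancl)
qed simp

lemma subdiv_below_snd:
  assumes "cpl a b'" "below a b" "below b b'"
  shows "((a, b), (a, b')) \<in> ori2\<^sup>*"
  using assms(3,2)
proof (induction rule: converse_rtrancl_induct)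
  case (step y z)
  have z: "below a z" using step.prems step(1) by (rule rtrancl_into_rtrancl)
  have yb: "below y b'" using step(1,2) by (rule converse_rtrancl_into_rtrancl)
  have "cpl a y" using cpl_lower[OF assms(1) step.prems yb] .
  moreover have "cpl a z" using cpl_lower[OF assms(1) z step(2)] .
  ultimately have "((a, y), (a, z)) \<in> ori2" using step(1) subdiv_ori_iff by blast
  then show ?case using step.IH[OF z] by (rule converse_rtrancl_into_rtrancl)
qed simp

lemma subdiv_below_fst:
  assumes "cpl a' b" "below a' a" "below a b"
  shows "((a, b), (a', b)) \<in> ori2\<^sup>*"
  using assms(2,3)
proof (induction rule: rtrancl_induct)
  case (step y z)
  have y: "below y b" using step(2) step.prems by (rule converse_rtrancl_into_rtrancl)
  have az: "below a' z" using step(1,2) by (rule rtrancl_into_rtrancl)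
  have "cpl z b" using cpl_upper[OF assms(1) az step.prems] .
  moreover have "cpl y b" using cpl_upper[OF assms(1) step(1) y] .
  ultimately have "((z, b), (y, b)) \<in> ori2" using step(2) subdiv_ori_iff by blast
  then show ?case using step.IH[OF y] by (rule converse_rtrancl_into_rtrancl)
qed simp

text \<open>With \<open>subdiv_below_imp\<close> this identifies the order as inclusion of
  intervals. The path raises the upper end first and then lowers the lower end; all pairs on it are
  subintervals of [a',b'] and so remain Boolean.\<close>

lemma subdiv_belowI:
  assumes "cpl a' b'" "below a' a" "below a b" "below b b'"
  shows "((a, b), (a', b')) \<in> ori2\<^sup>*"
proof -
  have "below a b'" using assms(3,4) by (rule rtrancl_trans)
  from subdiv_below_fst[OF assms(1,2) this]
  have "((a, b'), (a', b')) \<in> ori2\<^sup>*" .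
  moreover have "((a, b), (a, b')) \<in> ori2\<^sup>*"
    using subdiv_below_snd[OF cpl_upper[OF assms(1,2) \<open>below a b'\<close>] assms(3,4)] .
  ultimately show ?thesis by (rule rtrancl_trans[rotated])
qed

definition nbhd :: "'a \<Rightarrow> ('a \<times> 'a) set" where
  "nbhd p = {(a, b). cpl a b \<and> below a p \<and> below p b}"

text \<open>A cube for [p,b] and a cube for [a,p] in the reversed order multiply to a cube of the
  2-subdivision, because all mixed pairs are subintervals of [a,b].\<close>

lemma subdiv_boolean_pair:
  assumes "cpl a b" "below a p" "below p b"
  shows "boolean_pair G2 ori2 (p, p) (a, b)"
proof -
  have pV: "p \<in> V" using below_V[OF assms(2)] cpl_V[OF assms(1)] by blast
  have "cpl p b" using cpl_upper[OF assms] .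
  then obtain n :: nat and F where F: "inj_on F (Pow {..<n})" "F {} = p" "F {..<n} = b"
    "\<And>S i. S \<subseteq> {..<n} \<Longrightarrow> i < n \<Longrightarrow> i \<notin> S \<Longrightarrow> (F S, F (insert i S)) \<in> ori"
    "\<And>S. S \<subseteq> {..<n} \<Longrightarrow> below p (F S) \<and> below (F S) b"
    using cpl_cube[of p b] by blast
  have "cpl a p" using cpl_lower[OF assms] .
  then have "modular_cx.cpl G (ori\<inverse>) p a" by (simp add: cpl_dual)
  then obtain m :: nat and F' where F': "inj_on F' (Pow {..<m})" "F' {} = p" "F' {..<m} = a"
    "\<And>S i. S \<subseteq> {..<m} \<Longrightarrow> i < m \<Longrightarrow> i \<notin> S \<Longrightarrow> (F' S, F' (insert i S)) \<in> ori\<inverse>"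
    "\<And>S. S \<subseteq> {..<m} \<Longrightarrow> below (F' S) p \<and> below a (F' S)"
    using modular_cx.cpl_cube[OF dual, unfolded below_dual, of p a] by blast
  \<comment> \<open>Indices below \<open>n\<close> move the upper end; the index n + k moves the
    lower end along its coordinate \<open>k\<close>.\<close>
  define lo hi where "lo S = {i. n + i \<in> S}" and "hi S = S \<inter> {..<n}" for S :: "nat set"
  define H where "H S = (F' (lo S), F (hi S))" for S
  have lo: "lo S \<subseteq> {..<m}" if "S \<subseteq> {..<n + m}" for S using that by (auto simp: lo_def)
  have hi: "hi S \<subseteq> {..<n}" for S by (auto simp: hi_def)
  have cplH: "cpl (F' T) (F U)" if "T \<subseteq> {..<m}" "U \<subseteq> {..<n}" for T U
    using cpl_sub[OF assms(1)] F'(5)[OF that(1)] F(5)[OF that(2)] by (blast intro: rtrancl_trans)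
  have "boolean_pair G2 ori2 (H {}) (H {..<n + m})"
  proof (rule boolean_pairI[OF wf_subdiv])
    show "H {} \<in> pverts G2" using cplH[of "{}" "{}"] by (simp add: H_def lo_def hi_def subdiv_verts)
    show "inj_on H (Pow {..<n + m})"
    proof (rule inj_onI)
      fix S T assume S: "S \<in> Pow {..<n + m}" and T: "T \<in> Pow {..<n + m}" and eq: "H S = H T"
      have "F' (lo S) = F' (lo T)" "F (hi S) = F (hi T)" using eq by (simp_all add: H_def)
      moreover have "lo S \<in> Pow {..<m}" "lo T \<in> Pow {..<m}" "hi S \<in> Pow {..<n}" "hi T \<in> Pow {..<n}"
        using lo hi S T by simp_all
      ultimately have "lo S = lo T" "hi S = hi T"
        using inj_onD[OF F'(1)] inj_onD[OF F(1)] by simp_all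
      then have "x \<in> S \<longleftrightarrow> x \<in> T" for x
      proof (cases "x < n")
        case True
        then show ?thesis using \<open>hi S = hi T\<close> by (auto simp: hi_def set_eq_iff)
      next
        case False
        then show ?thesis
          using arg_cong[OF \<open>lo S = lo T\<close>, of "\<lambda>X. x - n \<in> X"] by (simp add: lo_def)
      qed
      then show "S = T" by blast
    qed
    fix S i assume S: "S \<subseteq> {..<n + m}" and i: "i < n + m" "i \<notin> S"
    show "(H S, H (insert i S)) \<in> ori2"
    proof (cases "i < n")
      case True
      have "lo (insert i S) = lo S" using True by (auto simp: lo_def)
      moreover have hi': "hi (insert i S) = insert i (hi S)" using True by (auto simp: hi_def)
      moreover have "(F (hi S), F (insert i (hi S))) \<in> ori"
        using F(4)[OF hi True] i by (simp add: hi_def)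
      ultimately show ?thesis
        using cplH[OF lo[OF S] hi] cplH[OF lo[OF S] hi[of "insert i S"]]
        unfolding H_def subdiv_ori_iff by simp
    next
      case False
      define k where "k = i - n"
      have k: "i = n + k" "k < m" "k \<notin> lo S" using False i by (auto simp: k_def lo_def)
      have hi': "hi (insert i S) = hi S" using False by (auto simp: hi_def)
      have lo': "lo (insert i S) = insert k (lo S)" using k by (auto simp: lo_def)
      have "(F' (insert k (lo S)), F' (lo S)) \<in> ori" using F'(4)[OF lo[OF S] k(2,3)] by simp
      moreover have "insert k (lo S) \<subseteq> {..<m}" using lo[OF S] k by simp
      ultimately show ?thesis
        using cplH[OF lo[OF S] hi] cplH[OF _ hi]
        unfolding H_def subdiv_ori_iff lo' hi' by simp
    qed
  qed (rule subdiv_ori_arcs)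
  moreover have "lo {} = {}" "hi {} = {}" "lo {..<n + m} = {..<m}" "hi {..<n + m} = {..<n}"
    by (auto simp: lo_def hi_def)
  ultimately show ?thesis using F(2,3) F'(2,3) by (simp add: H_def)
qed

lemma Lplus_subdiv:
  assumes "p \<in> V"
  shows "Lplus G2 ori2 (p, p) = nbhd p"
proof -
  have "(a, b) \<in> nbhd p" if bp: "boolean_pair G2 ori2 (p, p) (a, b)" for a b
  proof -
    have ab: "cpl a b" using bp by (simp add: boolean_pair_def subdiv_verts)
    have "((p, p), (a, b)) \<in> ori2\<^sup>*" using bp by (rule boolean_pair_rtrancl)
    from subdiv_below_imp[OF this] ab show ?thesis by (simp add: nbhd_def)
  qed
  moreover have "boolean_pair G2 ori2 (p, p) (a, b)" if "(a, b) \<in> nbhd p" for a b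
    using that subdiv_boolean_pair by (simp add: nbhd_def)
  ultimately show ?thesis unfolding Lplus_def by auto
qed

abbreviation "NL p \<equiv> nbhd_semilattice G ori p"

lemma nbhd_semilattice_simps:
  "p \<in> V \<Longrightarrow> carrier (NL p) = nbhd p" "eq (NL p) = (=)" "le (NL p) x y \<longleftrightarrow> (x, y) \<in> ori2\<^sup>*"
  by (simp_all add: nbhd_semilattice_def Lplus_order_def Lplus_subdiv)

lemma nbhd_le_iff:
  assumes "(a, b) \<in> nbhd p" "(a', b') \<in> nbhd p"
  shows "le (NL p) (a, b) (a', b') \<longleftrightarrow> below a' a \<and> below b b'"
proof -
  have "cpl a' b'" "below a b" using assms unfolding nbhd_def by (simp_all add: rtrancl_trans[of a p])
  then show ?thesis
    using subdiv_below_imp[of "(a, b)" "(a', b')"] subdiv_belowI[of a' b' a b]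
    unfolding nbhd_semilattice_simps by auto
qed

lemma nbhd_V:
  assumes "(a, b) \<in> nbhd p" "p \<in> V"
  shows "a \<in> V" "b \<in> V" "below a p" "below p b" "cpl a b"
  using assms cpl_V unfolding nbhd_def by auto

lemma nbhd_down:
  assumes "(a, b) \<in> nbhd p" "below a a'" "below a' p" "below p b'" "below b' b"
  shows "(a', b') \<in> nbhd p"
  using cpl_sub[of a b a' b'] assms rtrancl_trans[OF assms(3,4)] by (simp add: nbhd_def)

text \<open>The meet is the intersection of the two intervals: it still contains \<open>p\<close>
  and is a subinterval of the first.\<close>

lemma nbhd_meet:
  assumes "p \<in> V" "(a1, b1) \<in> nbhd p" "(a2, b2) \<in> nbhd p" "lub a a1 a2" "glb b b1 b2"
  shows "greatest (NL p) (a, b) (Lower (NL p) {(a1, b1), (a2, b2)})"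
proof -
  note V = nbhd_V[OF assms(2,1)] nbhd_V[OF assms(3,1)]
  have ab: "(a, b) \<in> nbhd p"
    by (rule nbhd_down[OF assms(2) lubD(2)[OF assms(4)] lubD(4)[OF assms(4) V(3,8)]
      glbD(4)[OF assms(5) V(4,9)] glbD(2)[OF assms(5)]])
  have in_Lower: "(c, e) \<in> Lower (NL p) {(a1, b1), (a2, b2)} \<longleftrightarrow>
      (c, e) \<in> nbhd p \<and> below a1 c \<and> below e b1 \<and> below a2 c \<and> below e b2" for c e
    using nbhd_le_iff[OF _ assms(2), of c e] nbhd_le_iff[OF _ assms(3), of c e] assms(2,3)
    by (auto simp: Lower_def nbhd_semilattice_simps(1)[OF assms(1)])
  show ?thesis
    unfolding greatest_def
  proof (intro conjI ballI)
    show "Lower (NL p) {(a1, b1), (a2, b2)} \<subseteq> carrier (NL p)" by (rule Lower_closed)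
    show "(a, b) \<in> Lower (NL p) {(a1, b1), (a2, b2)}"
      unfolding in_Lower using ab lubD(2,3)[OF assms(4)] glbD(2,3)[OF assms(5)] by simp
    fix x assume x: "x \<in> Lower (NL p) {(a1, b1), (a2, b2)}"
    obtain c e where ce: "x = (c, e)" by (cases x)
    have *: "(c, e) \<in> nbhd p" "below a1 c" "below e b1" "below a2 c" "below e b2"
      using x unfolding ce in_Lower by simp_all
    show "le (NL p) x (a, b)"
      unfolding ce nbhd_le_iff[OF *(1) ab]
      using lubD(4)[OF assms(4) *(2,4)] glbD(4)[OF assms(5) *(3,5)] by simp
  qed
qed

lemma nbhd_meet_ex:
  assumes "p \<in> V" "(a1, b1) \<in> nbhd p" "(a2, b2) \<in> nbhd p"
  shows "\<exists>a b. lub a a1 a2 \<and> glb b b1 b2"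
proof -
  note V = nbhd_V[OF assms(2,1)] nbhd_V[OF assms(3,1)]
  show ?thesis using lub_ex[OF V(1,6,3,8)] glb_ex[OF V(2,7,4,9)] by blast
qed

lemma nbhd_lower_semilattice:
  assumes "p \<in> V"
  shows "lower_semilattice (NL p)"
proof
  note simps = nbhd_semilattice_simps(1)[OF assms] nbhd_semilattice_simps(2)
  fix x y z w
  show "eq (NL p) x x" by (simp add: simps)
  show "eq (NL p) x y \<Longrightarrow> eq (NL p) y x" by (simp add: simps)
  show "eq (NL p) x y \<Longrightarrow> eq (NL p) y z \<Longrightarrow> eq (NL p) x z" by (simp add: simps)
  show "le (NL p) x x" by (simp add: nbhd_semilattice_simps)
  show "le (NL p) x y \<Longrightarrow> le (NL p) y z \<Longrightarrow> le (NL p) x z"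
    unfolding nbhd_semilattice_simps by (rule rtrancl_trans)
  show "eq (NL p) x y \<Longrightarrow> eq (NL p) z w \<Longrightarrow> le (NL p) x z = le (NL p) y w" by (simp add: simps)
  show "eq (NL p) = (=)" by (simp add: simps)
  {
    assume x: "x \<in> carrier (NL p)" and y: "y \<in> carrier (NL p)"
    obtain a b a' b' where e: "x = (a, b)" "y = (a', b')" by (cases x, cases y)
    have n: "(a, b) \<in> nbhd p" "(a', b') \<in> nbhd p" using x y unfolding simps e by simp_all
    show "\<exists>s. greatest (NL p) s (Lower (NL p) {x, y})"
      unfolding e using nbhd_meet_ex[OF assms n] nbhd_meet[OF assms n] by blast
    assume "le (NL p) x y" "le (NL p) y x"
    then have b: "below a' a" "below a a'" "below b b'" "below b' b"
      unfolding e nbhd_le_iff[OF n] nbhd_le_iff[OF n(2,1)] by simp_all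
    then have "a = a'" "b = b'"
      using below_antisym[OF b(2,1)] below_antisym[OF b(3,4)] nbhd_V[OF n(1) assms] by simp_all
    then show "eq (NL p) x y" unfolding e simps by simp
  }
qed

lemma edge_weight_subdiv:
  "edge_weight (subdiv_length h) ((a, b), (a, b')) = h {b, b'} / 2"
  "a \<noteq> a' \<Longrightarrow> edge_weight (subdiv_length h) ((a, b), (a', b)) = h {a, a'} / 2"
  by (auto simp: edge_weight_def subdiv_length_def is_singleton_def)

lemma subdiv_walk_snd:
  assumes "cpl a c" "below a b" "below p b" "below b c" "p \<in> V"
  shows "weighted_walk G2 (edge_weight (subdiv_length h)) (a, c) ((hdist p c - hdist p b) / 2) (a, b)"
  using assms(4,1)
proof (induction rule: rtrancl_induct)
  case base
  then show ?case by (auto intro!: weighted_walk_Nil simp: subdiv_verts)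
next
  case (step y z)
  have ay: "below a y" using assms(2) step(1) by (rule rtrancl_trans)
  have cy: "cpl a y" using cpl_lower[OF step.prems ay] step(2) by blast
  have arc: "((a, z), (a, y)) \<in> parcs G2"
    unfolding subdiv_arcs using cy step.prems edge_sym[OF ori_E[OF step(2)]] by simp
  have "hdist p z = hdist p y + h {y, z}"
    using hdist_below_step[OF rtrancl_trans[OF assms(3) step(1)] step(2) assms(5)] .
  then have "(hdist p z - hdist p b) / 2 =
      edge_weight (subdiv_length h) ((a, z), (a, y)) + (hdist p y - hdist p b) / 2"
    unfolding edge_weight_subdiv by (simp add: insert_commute field_simps)
  then show ?case
    using weighted_walk_Cons[where w = "edge_weight (subdiv_length h)", OF arc step.IH[OF cy]]
    by (simp only:)
qed

lemma subdiv_walk_fst: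
  assumes "cpl a b" "below c b" "below c p" "below a c" "p \<in> V"
  shows "weighted_walk G2 (edge_weight (subdiv_length h)) (a, b) ((hdist p a - hdist p c) / 2) (c, b)"
  using assms(4,1)
proof (induction rule: converse_rtrancl_induct)
  case base
  then show ?case by (auto intro!: weighted_walk_Nil simp: subdiv_verts)
next
  case (step y z)
  have zb: "below z b" using step(2) assms(2) by (rule rtrancl_trans)
  have cz: "cpl z b" using cpl_upper[OF step.prems _ zb] step(1) by blast
  have e: "(y, z) \<in> E" using ori_E[OF step(1)] .
  have ne: "y \<noteq> z" using e edge_irrefl by blast
  have arc: "((y, b), (z, b)) \<in> parcs G2"
    unfolding subdiv_arcs using cz step.prems e by simp
  have "hdist p y = hdist p z + h {z, y}"
    using modular_cx.hdist_below_step[OF dual, unfolded below_dual,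
        OF rtrancl_trans[OF step(2) assms(3)] _ assms(5), of y] step(1) by simp
  then have "(hdist p y - hdist p c) / 2 =
      edge_weight (subdiv_length h) ((y, b), (z, b)) + (hdist p z - hdist p c) / 2"
    unfolding edge_weight_subdiv(2)[OF ne] by (simp add: insert_commute field_simps)
  then show ?case
    using weighted_walk_Cons[where w = "edge_weight (subdiv_length h)", OF arc step.IH[OF cz]]
    by (simp only:)
qed

text \<open>The right-hand side is a potential, since an edge of the 2-subdivision moves one end
  along an edge of \<open>G\<close> and has half its length. It is attained by the walk that brings
  first the upper and then the lower end to \<open>p\<close>.\<close>

lemma nbhd_valuation_eq:
  assumes "p \<in> V" "(a, b) \<in> nbhd p"
  shows "nbhd_valuation G ori h p (a, b) = (hdist p a + hdist p b) / 2"
proof -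
  note n = nbhd_V[OF assms(2,1)]
  let ?w = "edge_weight (subdiv_length h)"
  let ?f = "\<lambda>x. (hdist p (fst x) + hdist p (snd x)) / 2"
  have "graph_dist G2 ?w (a, b) (p, p) = ?f (a, b) - ?f (p, p)"
  proof (rule graph_dist_potential[OF wf_subdiv])
    have "weighted_walk G2 ?w (a, b) ((hdist p b - hdist p p) / 2) (a, p)"
      using subdiv_walk_snd[OF n(5,3) rtrancl_refl n(4) assms(1)] .
    moreover have "weighted_walk G2 ?w (a, p) ((hdist p a - hdist p p) / 2) (p, p)"
      using subdiv_walk_fst[OF cpl_lower[OF n(5,3,4)] rtrancl_refl rtrancl_refl n(3) assms(1)] .
    ultimately have "weighted_walk G2 ?w (a, b)
        ((hdist p b - hdist p p) / 2 + (hdist p a - hdist p p) / 2) (p, p)"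
      by (rule weighted_walk_trans)
    moreover have "(hdist p b - hdist p p) / 2 + (hdist p a - hdist p p) / 2 = ?f (a, b) - ?f (p, p)"
      by simp
    ultimately show "weighted_walk G2 ?w (a, b) (?f (a, b) - ?f (p, p)) (p, p)"
      by (simp only:)
  next
    fix x y assume xy: "(x, y) \<in> parcs G2"
    obtain c e c' e' where x: "x = (c, e)" and y: "y = (c', e')" by (cases x, cases y)
    have "c = c' \<and> (e, e') \<in> E \<or> e = e' \<and> (c, c') \<in> E"
      using xy unfolding x y subdiv_arcs by simp
    then show "?f x \<le> ?f y + ?w (x, y)"
    proof
      assume *: "c = c' \<and> (e, e') \<in> E"
      then have "\<bar>hdist p e - hdist p e'\<bar> = h {e, e'}" using hdist_edge_diff assms(1) by blast
      moreover have "?w (x, y) = h {e, e'} / 2" using * edge_weight_subdiv(1) unfolding x y by simp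
      ultimately show ?thesis unfolding x y using * by (simp add: field_simps)
    next
      assume *: "e = e' \<and> (c, c') \<in> E"
      then have "\<bar>hdist p c - hdist p c'\<bar> = h {c, c'}" using hdist_edge_diff assms(1) by blast
      moreover have "c \<noteq> c'" using * edge_irrefl by blast
      then have "?w (x, y) = h {c, c'} / 2" using * edge_weight_subdiv(2) unfolding x y by simp
      ultimately show ?thesis unfolding x y using * by (simp add: field_simps)
    qed
  qed
  then show ?thesis by (simp add: nbhd_valuation_def)
qed

lemma lub_ex3:
  assumes "x \<in> V" "y \<in> V" "z \<in> V" "below x a" "below y a" "below y b" "below z b" "below x c" "below z c"
  shows "\<exists>j k. lub j x y \<and> lub k j z"
proof -
  obtain m where m: "below x m" "below y m" "below z m" using helly_up[OF assms] by blast
  obtain j where j: "lub j x y" using lub_ex[OF assms(1,2) m(1,2)] by blast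
  have "\<exists>k. lub k j z" using lub_ex[OF lubD(1)[OF j] assms(3) lubD(4)[OF j m(1,2)] m(3)] .
  then show ?thesis using j by blast
qed

lemma glb_ex3:
  assumes "x \<in> V" "y \<in> V" "z \<in> V" "below a x" "below a y" "below b y" "below b z" "below c x" "below c z"
  shows "\<exists>j k. glb j x y \<and> glb k j z"
  using modular_cx.lub_ex3[OF dual, unfolded below_dual lub_dual, OF assms] .

text \<open>A bounded pair has as join the span from the meet of the lower ends to the join of the
  upper ends, Boolean as a subinterval of the bound. Its valuation identity adds the one for
  \<open>hdist p\<close> above \<open>p\<close> to the one below \<open>p\<close>. Triples use the
  Helly property for both ends.\<close>

lemma nbhd_valued_semilattice:
  assumes pV: "p \<in> V"
  shows "valued_semilattice (NL p) (nbhd_valuation G ori h p)"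
proof -
  interpret lower_semilattice "NL p" by (rule nbhd_lower_semilattice[OF pV])
  note carr = nbhd_semilattice_simps(1)[OF pV]
  note val = nbhd_valuation_eq[OF pV]
  show ?thesis
  proof unfold_locales
    show "finite (carrier (NL p))"
      unfolding carr
    proof (rule finite_subset)
      show "nbhd p \<subseteq> V \<times> V" using nbhd_V(1,2)[OF _ pV] by auto
      show "finite (V \<times> V)" using finite_V by simp
    qed
  next
    fix x y assume lt: "x \<sqsubset>\<^bsub>NL p\<^esub> y" and x: "x \<in> carrier (NL p)" and y: "y \<in> carrier (NL p)"
    obtain a b a' b' where e: "x = (a, b)" "y = (a', b')" by (cases x, cases y)
    have n: "(a, b) \<in> nbhd p" "(a', b') \<in> nbhd p" using x y unfolding carr e by simp_all
    note V = nbhd_V[OF n(1) pV] nbhd_V[OF n(2) pV]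
    have "below a' a" "below b b'" "a \<noteq> a' \<or> b \<noteq> b'"
      using lt unfolding lless_eq e nbhd_le_iff[OF n] by auto
    then show "nbhd_valuation G ori h p x < nbhd_valuation G ori h p y"
      unfolding e val[OF n(1)] val[OF n(2)]
      using hdist_above_mono[OF V(3) _ pV, of a'] hdist_below_mono[OF V(4) _ pV, of b'] by force
  next
    fix x y z assume c: "x \<in> carrier (NL p)" "y \<in> carrier (NL p)" "z \<in> carrier (NL p)"
      and up: "x \<sqsubseteq>\<^bsub>NL p\<^esub> z" "y \<sqsubseteq>\<^bsub>NL p\<^esub> z"
    obtain a1 b1 a2 b2 a3 b3 where e: "x = (a1, b1)" "y = (a2, b2)" "z = (a3, b3)"
      by (cases x, cases y, cases z)
    have n: "(a1, b1) \<in> nbhd p" "(a2, b2) \<in> nbhd p" "(a3, b3) \<in> nbhd p"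
      using c unfolding carr e by simp_all
    note V = nbhd_V[OF n(1) pV] nbhd_V[OF n(2) pV]
    have le: "below a3 a1" "below b1 b3" "below a3 a2" "below b2 b3"
      using up unfolding e nbhd_le_iff[OF n(1,3)] nbhd_le_iff[OF n(2,3)] by simp_all
    obtain ja where ja: "glb ja a1 a2" using glb_ex[OF V(1,6) le(1,3)] by blast
    obtain jb where jb: "lub jb b1 b2" using lub_ex[OF V(2,7) le(2,4)] by blast
    obtain ma mb where m: "lub ma a1 a2" "glb mb b1 b2" using nbhd_meet_ex[OF pV n(1,2)] by blast
    have j: "(ja, jb) \<in> nbhd p"
      by (rule nbhd_down[OF n(3) glbD(4)[OF ja le(1,3)] rtrancl_trans[OF glbD(2)[OF ja] V(3)]
        rtrancl_trans[OF V(4) lubD(2)[OF jb]] lubD(4)[OF jb le(2,4)]])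
    have mgr: "greatest (NL p) (ma, mb) (Lower (NL p) {x, y})"
      unfolding e by (rule nbhd_meet[OF pV n(1,2) m])
    have mn: "(ma, mb) \<in> nbhd p" using greatest_closed[OF mgr] unfolding carr .
    have meet: "x \<sqinter>\<^bsub>NL p\<^esub> y = (ma, mb)"
    proof (rule le_antisym)
      have "x \<sqinter>\<^bsub>NL p\<^esub> y \<in> Lower (NL p) {x, y}"
        using c meet_left[OF c(1,2)] meet_right[OF c(1,2)] by (auto simp: Lower_def)
      then show "x \<sqinter>\<^bsub>NL p\<^esub> y \<sqsubseteq>\<^bsub>NL p\<^esub> (ma, mb)" by (rule greatest_le[OF mgr])
      have "(ma, mb) \<in> Lower (NL p) {x, y}" using mgr by (rule greatest_mem)
      then show "(ma, mb) \<sqsubseteq>\<^bsub>NL p\<^esub> x \<sqinter>\<^bsub>NL p\<^esub> y"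
        using c Lower_memD[of "(ma, mb)" "NL p" "{x, y}" x] Lower_memD[of "(ma, mb)" "NL p" "{x, y}" y]
        by (intro meet_le) simp_all
      show "x \<sqinter>\<^bsub>NL p\<^esub> y \<in> carrier (NL p)" using meet_closed[OF c(1,2)] .
      show "(ma, mb) \<in> carrier (NL p)" unfolding carr by (rule mn)
    qed
    show "\<exists>j\<in>carrier (NL p). x \<sqsubseteq>\<^bsub>NL p\<^esub> j \<and> y \<sqsubseteq>\<^bsub>NL p\<^esub> j \<and>
        (\<forall>w\<in>carrier (NL p). x \<sqsubseteq>\<^bsub>NL p\<^esub> w \<longrightarrow> y \<sqsubseteq>\<^bsub>NL p\<^esub> w \<longrightarrow> j \<sqsubseteq>\<^bsub>NL p\<^esub> w) \<and>
        nbhd_valuation G ori h p j + nbhd_valuation G ori h p (x \<sqinter>\<^bsub>NL p\<^esub> y) =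
        nbhd_valuation G ori h p x + nbhd_valuation G ori h p y"
    proof (intro bexI[of _ "(ja, jb)"] conjI ballI impI)
      show "(ja, jb) \<in> carrier (NL p)" unfolding carr by (rule j)
      show "x \<sqsubseteq>\<^bsub>NL p\<^esub> (ja, jb)" "y \<sqsubseteq>\<^bsub>NL p\<^esub> (ja, jb)"
        unfolding e nbhd_le_iff[OF n(1) j] nbhd_le_iff[OF n(2) j]
        using glbD(2,3)[OF ja] lubD(2,3)[OF jb] by simp_all
      show "(ja, jb) \<sqsubseteq>\<^bsub>NL p\<^esub> w"
        if w: "w \<in> carrier (NL p)" "x \<sqsubseteq>\<^bsub>NL p\<^esub> w" "y \<sqsubseteq>\<^bsub>NL p\<^esub> w" for w
      proof -
        obtain a b :: 'a where w': "w = (a, b)" by (cases w)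
        have nw: "(a, b) \<in> nbhd p" using w(1) unfolding carr w' .
        have "below a a1" "below b1 b" "below a a2" "below b2 b"
          using w(2,3) unfolding w' e nbhd_le_iff[OF n(1) nw] nbhd_le_iff[OF n(2) nw] by simp_all
        then show ?thesis
          unfolding w' nbhd_le_iff[OF j nw] using glbD(4)[OF ja] lubD(4)[OF jb] by simp
      qed
      show "nbhd_valuation G ori h p (ja, jb) + nbhd_valuation G ori h p (x \<sqinter>\<^bsub>NL p\<^esub> y) =
          nbhd_valuation G ori h p x + nbhd_valuation G ori h p y"
        unfolding meet unfolding e val[OF j] val[OF mn] val[OF n(1)] val[OF n(2)]
        using hdist_modular[OF pV V(4,9) m(2) jb] hdist_modular_below[OF pV V(3,8) ja m(1)]
        by (simp add: field_simps)
    qed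
  next
    fix x y z
    assume c: "x \<in> carrier (NL p)" "y \<in> carrier (NL p)" "z \<in> carrier (NL p)"
      and ex: "\<exists>a\<in>carrier (NL p). x \<sqsubseteq>\<^bsub>NL p\<^esub> a \<and> y \<sqsubseteq>\<^bsub>NL p\<^esub> a"
        "\<exists>a\<in>carrier (NL p). y \<sqsubseteq>\<^bsub>NL p\<^esub> a \<and> z \<sqsubseteq>\<^bsub>NL p\<^esub> a"
        "\<exists>a\<in>carrier (NL p). x \<sqsubseteq>\<^bsub>NL p\<^esub> a \<and> z \<sqsubseteq>\<^bsub>NL p\<^esub> a"
    obtain a1 b1 a2 b2 a3 b3 where e: "x = (a1, b1)" "y = (a2, b2)" "z = (a3, b3)"
      by (cases x, cases y, cases z)
    have n: "(a1, b1) \<in> nbhd p" "(a2, b2) \<in> nbhd p" "(a3, b3) \<in> nbhd p"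
      using c unfolding carr e by simp_all
    note V = nbhd_V[OF n(1) pV] nbhd_V[OF n(2) pV] nbhd_V[OF n(3) pV]
    have bound: "\<exists>a b. (a, b) \<in> nbhd p \<and> below a c \<and> below a c' \<and> below f b \<and> below f' b"
      if bnd: "\<exists>u\<in>carrier (NL p). (c, f) \<sqsubseteq>\<^bsub>NL p\<^esub> u \<and> (c', f') \<sqsubseteq>\<^bsub>NL p\<^esub> u"
        and cf: "(c, f) \<in> nbhd p" "(c', f') \<in> nbhd p" for c f c' f'
    proof -
      obtain u where u: "u \<in> nbhd p" "(c, f) \<sqsubseteq>\<^bsub>NL p\<^esub> u" "(c', f') \<sqsubseteq>\<^bsub>NL p\<^esub> u"
        using bnd unfolding carr by blast
      obtain a b where "u = (a, b)" by (cases u)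
      then have ab: "(a, b) \<in> nbhd p" "(c, f) \<sqsubseteq>\<^bsub>NL p\<^esub> (a, b)" "(c', f') \<sqsubseteq>\<^bsub>NL p\<^esub> (a, b)"
        using u by simp_all
      then show ?thesis
        using nbhd_le_iff[OF cf(1) ab(1)] nbhd_le_iff[OF cf(2) ab(1)] by blast
    qed
    obtain a12 b12 where u12: "(a12, b12) \<in> nbhd p" "below a12 a1" "below a12 a2" "below b1 b12" "below b2 b12"
      using bound[OF ex(1)[unfolded e] n(1,2)] by blast
    obtain a23 b23 where u23: "(a23, b23) \<in> nbhd p" "below a23 a2" "below a23 a3" "below b2 b23" "below b3 b23"
      using bound[OF ex(2)[unfolded e] n(2,3)] by blast
    obtain a13 b13 where u13: "(a13, b13) \<in> nbhd p" "below a13 a1" "below a13 a3" "below b1 b13" "below b3 b13"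
      using bound[OF ex(3)[unfolded e] n(1,3)] by blast
    obtain a' a where a: "glb a' a1 a2" "glb a a' a3"
      using glb_ex3[OF V(1,6,11) u12(2,3) u23(2,3) u13(2,3)] by blast
    obtain b' b where b: "lub b' b1 b2" "lub b b' b3"
      using lub_ex3[OF V(2,7,12) u12(4,5) u23(4,5) u13(4,5)] by blast
    have sub: "cpl c f" if "(a0, b0) \<in> nbhd p" "below a0 c" "below c p" "below p f" "below f b0" for a0 b0 c f
      using nbhd_down[OF that] unfolding nbhd_def by simp
    \<comment> \<open>Every mixed interval from a lower end \<open>ai\<close> to an upper end
      \<open>bj\<close> is Boolean, being inside a pairwise bound. Meets over the lower ends and
      then joins over the upper ends give [a,b].\<close>
    have ca: "cpl a f" if "cpl a1 f" "cpl a2 f" "cpl a3 f" for f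
      using cpl_meet[OF cpl_meet[OF that(1,2) a(1)] that(3) a(2)] .
    have "cpl a b1"
      by (rule ca[OF V(5) sub[OF u12(1,3) V(8,4) u12(4)] sub[OF u13(1,3) V(13,4) u13(4)]])
    moreover have "cpl a b2"
      by (rule ca[OF sub[OF u12(1,2) V(3,9) u12(5)] V(10) sub[OF u23(1,3) V(13,9) u23(4)]])
    moreover have "cpl a b3"
      by (rule ca[OF sub[OF u13(1,2) V(3,14) u13(5)] sub[OF u23(1,2) V(8,14) u23(5)] V(15)])
    ultimately have cab: "cpl a b"
      using cpl_join[OF cpl_join[OF _ _ b(1)] _ b(2)] by blast
    have le: "below a a1" "below a a2" "below a a3" "below b1 b" "below b2 b" "below b3 b"
      using rtrancl_trans[OF glbD(2)[OF a(2)] glbD(2)[OF a(1)]]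
        rtrancl_trans[OF glbD(2)[OF a(2)] glbD(3)[OF a(1)]] glbD(3)[OF a(2)]
        rtrancl_trans[OF lubD(2)[OF b(1)] lubD(2)[OF b(2)]]
        rtrancl_trans[OF lubD(3)[OF b(1)] lubD(2)[OF b(2)]] lubD(3)[OF b(2)] by simp_all
    have nab: "(a, b) \<in> nbhd p"
      using cab rtrancl_trans[OF le(1) V(3)] rtrancl_trans[OF V(4) le(4)] by (simp add: nbhd_def)
    show "\<exists>u\<in>carrier (NL p). x \<sqsubseteq>\<^bsub>NL p\<^esub> u \<and> y \<sqsubseteq>\<^bsub>NL p\<^esub> u \<and> z \<sqsubseteq>\<^bsub>NL p\<^esub> u"
    proof (intro bexI[of _ "(a, b)"] conjI)
      show "(a, b) \<in> carrier (NL p)" unfolding carr by (rule nab)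
      show "x \<sqsubseteq>\<^bsub>NL p\<^esub> (a, b)" "y \<sqsubseteq>\<^bsub>NL p\<^esub> (a, b)" "z \<sqsubseteq>\<^bsub>NL p\<^esub> (a, b)"
        unfolding e nbhd_le_iff[OF n(1) nab] nbhd_le_iff[OF n(2) nab] nbhd_le_iff[OF n(3) nab]
        using le by simp_all
    qed
  qed
qed

section \<open>Paths of Boolean steps and descent\<close>

definition adj :: "'a \<Rightarrow> 'a \<Rightarrow> bool" where
  "adj x y \<longleftrightarrow> cpl x y \<or> cpl y x"

lemma adj_V: "adj x y \<Longrightarrow> x \<in> V" "adj x y \<Longrightarrow> y \<in> V"
  unfolding adj_def using cpl_V by blast+

lemma adj_sym: "adj x y \<longleftrightarrow> adj y x"
  by (auto simp: adj_def)

text \<open>The upper end of an edge is itself an atom of the interval that the edge spans. So paths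
  of the graph are paths of Boolean steps.\<close>

lemma edge_adj:
  assumes "(u, v) \<in> E"
  shows "adj u v"
proof -
  have "cpl x y" if xy: "(x, y) \<in> ori" for x y
    unfolding cpl_def
  proof (intro conjI allI impI)
    show "x \<in> V" using ori_V xy by blast
    show "below x y" using xy by (rule r_into_rtrancl)
    fix r assume "below x r" "below r y" "\<forall>c. (x, c) \<in> ori \<longrightarrow> below c y \<longrightarrow> below c r"
    then have "below y r" using xy by simp
    then show "r = y" using below_antisym[OF \<open>below r y\<close>] below_V[OF \<open>below x r\<close> \<open>x \<in> V\<close>] by simp
  qed
  then show ?thesis using ori_total[OF assms] unfolding adj_def by blast
qed

lemma nbhd_coord_adj:
  assumes "(a', b') \<in> nbhd r" "below a' a" "below a b" "below b b'" "c \<in> {a, b}" "c' \<in> {a', b'}"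
  shows "adj c c'"
proof -
  have cp: "cpl a' b'" using assms(1) by (simp add: nbhd_def)
  have b: "below a b'" "below a' b" using assms(2-4) by (blast intro: rtrancl_trans)+
  have "cpl a' a" using cpl_lower[OF cp assms(2) b(1)] .
  moreover have "cpl a b'" using cpl_upper[OF cp assms(2) b(1)] .
  moreover have "cpl a' b" using cpl_lower[OF cp b(2) assms(4)] .
  moreover have "cpl b b'" using cpl_upper[OF cp b(2) assms(4)] .
  ultimately show ?thesis using assms(5,6) unfolding adj_def by auto
qed

lemma adj_nbhd:
  assumes "adj r c"
  shows "\<exists>a b. (a, b) \<in> nbhd r \<and> (a = r \<and> b = c \<or> a = c \<and> b = r)"
proof (cases "cpl r c")
  case True
  then show ?thesis using cpl_V(3) unfolding nbhd_def by blast
next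
  case False
  then have "cpl c r" using assms unfolding adj_def by blast
  then show ?thesis using cpl_V(3) unfolding nbhd_def by blast
qed

definition lt_step :: "('a \<Rightarrow> real) \<Rightarrow> real \<Rightarrow> 'a rel" where
  "lt_step g M = {(x, y). adj x y \<and> g y < M}"

definition le_step :: "('a \<Rightarrow> real) \<Rightarrow> real \<Rightarrow> 'a rel" where
  "le_step g M = {(x, y). adj x y \<and> g y \<le> M}"

text \<open>A peak \<open>r\<close> of a path can be bypassed: the connecting chain in \<open>\<L>\<^sup>*\<^sub>r\<close> projects to \<open>\<Gamma>\<close>, because
  comparable elements of \<open>\<L>\<^sup>*\<^sub>r\<close> have pairwise adjacent coordinates and a pair with mean value below \<open>M\<close>
  has a coordinate with value below \<open>M\<close>.\<close>

lemma bypass_peak: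
  assumes L: "L_convex G ori h g" and c: "adj r c1" "adj r c2"
    and g: "g r = M" "g c1 \<le> M" "g c2 < M"
  shows "(c1, c2) \<in> (lt_step g M)\<^sup>*"
proof -
  have rV: "r \<in> V" using adj_V c by blast
  let ?v = "nbhd_valuation G ori h r" and ?f = "subdiv_ext g"
  interpret S: valued_semilattice "NL r" ?v by (rule nbhd_valued_semilattice[OF rV])
  note carr = nbhd_semilattice_simps(1)[OF rV]
  obtain a1 b1 where x1: "(a1, b1) \<in> nbhd r" "a1 = r \<and> b1 = c1 \<or> a1 = c1 \<and> b1 = r"
    using adj_nbhd[OF c(1)] by blast
  obtain a2 b2 where x2: "(a2, b2) \<in> nbhd r" "a2 = r \<and> b2 = c2 \<or> a2 = c2 \<and> b2 = r"
    using adj_nbhd[OF c(2)] by blast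
  have sub: "submodular (NL r) ?v (\<lambda>x. ereal (?f x))" using L rV unfolding L_convex_def by blast
  have f: "?f (a1, b1) \<le> M" "?f (a2, b2) < M" using x1(2) x2(2) g by (auto simp: subdiv_ext_def)
  have chain: "((a1, b1), (a2, b2)) \<in> (S.level_step ?f M)\<^sup>*"
    using S.level_connected[OF sub _ _ f] x1(1) x2(1) unfolding carr by blast
  \<comment> \<open>The invariant follows one coordinate only. Whichever coordinate was reached, it
    is adjacent to both coordinates of the next element, so one of value below \<open>M\<close> can
    be chosen.\<close>
  have "\<exists>e. (e = fst z \<or> e = snd z) \<and> (c1, e) \<in> (lt_step g M)\<^sup>*"
    if "((a1, b1), z) \<in> (S.level_step ?f M)\<^sup>*" for z
    using that
  proof (induction rule: rtrancl_induct)
    case base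
    have "c1 = fst (a1, b1) \<or> c1 = snd (a1, b1)" using x1(2) by auto
    then show ?case by blast
  next
    case (step y z)
    obtain e where e: "e = fst y \<or> e = snd y" "(c1, e) \<in> (lt_step g M)\<^sup>*" using step.IH by blast
    obtain a b a' b' where yz: "y = (a, b)" "z = (a', b')" by (cases y, cases z)
    have n: "(a, b) \<in> nbhd r" "(a', b') \<in> nbhd r"
      and comp: "le (NL r) (a, b) (a', b') \<or> le (NL r) (a', b') (a, b)" and fz: "?f (a', b') < M"
      using step(2) unfolding S.level_step_def yz carr by simp_all
    have ab: "below a b" "below a' b'" using cpl_V(3) n unfolding nbhd_def by blast+
    have "g a' < M \<or> g b' < M" using fz by (auto simp: subdiv_ext_def)
    then obtain e' where e': "e' \<in> {a', b'}" "g e' < M" by blast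
    have ee: "e \<in> {a, b}" using e(1) yz by simp
    have "adj e e'"
      using comp
    proof
      assume "le (NL r) (a, b) (a', b')"
      then have "below a' a" "below b b'" unfolding nbhd_le_iff[OF n] by simp_all
      then show ?thesis using nbhd_coord_adj[OF n(2) _ ab(1) _ ee e'(1)] by simp
    next
      assume "le (NL r) (a', b') (a, b)"
      then have "below a a'" "below b' b" unfolding nbhd_le_iff[OF n(2,1)] by simp_all
      then show ?thesis using nbhd_coord_adj[OF n(1) _ ab(2) _ e'(1) ee] adj_sym by simp
    qed
    then have "(e, e') \<in> lt_step g M" using e'(2) by (simp add: lt_step_def)
    then have "(c1, e') \<in> (lt_step g M)\<^sup>*" using e(2) by (rule rtrancl_into_rtrancl[rotated])
    moreover have "e' = fst z \<or> e' = snd z" using e'(1) yz by simp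
    ultimately show ?case by blast
  qed
  from this[OF chain] obtain e where e: "e = a2 \<or> e = b2" "(c1, e) \<in> (lt_step g M)\<^sup>*" by auto
  \<comment> \<open>The projected chain may end at \<open>r\<close> instead of \<open>c2\<close>;
    one further step then leads to \<open>c2\<close>.\<close>
  then have "e = c2 \<or> e = r" using x2(2) by blast
  moreover have "(r, c2) \<in> lt_step g M" using c(2) g(3) by (simp add: lt_step_def)
  ultimately show ?thesis using e(2) by (metis rtrancl_into_rtrancl)
qed

text \<open>The path is repaired from its far end. If \<open>z\<close> has value \<open>M\<close>,
  the repaired rest leaves it through some \<open>w\<close> of value below \<open>M\<close>, and the
  peak \<open>z\<close> is bypassed from \<open>x\<close> to \<open>w\<close>; \<open>x\<close> may
  itself have value \<open>M\<close>.\<close>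

lemma remove_peaks:
  assumes "L_convex G ori h g" "(x, y) \<in> (le_step g M)\<^sup>*" "g x \<le> M" "g y < M"
  shows "(x, y) \<in> (lt_step g M)\<^sup>*"
  using assms(2,3)
proof (induction rule: converse_rtrancl_induct)
  case (step x z)
  have xz: "adj x z" "g z \<le> M" using step(1) by (simp_all add: le_step_def)
  have zy: "(z, y) \<in> (lt_step g M)\<^sup>*" using step.IH xz(2) .
  show ?case
  proof (cases "g z < M")
    case True
    then have "(x, z) \<in> lt_step g M" using xz(1) by (simp add: lt_step_def)
    then show ?thesis using zy by (rule converse_rtrancl_into_rtrancl)
  next
    case False
    then have gz: "g z = M" using xz(2) by simp
    then have "z \<noteq> y" using assms(4) by auto
    with zy obtain w where w: "(z, w) \<in> lt_step g M" "(w, y) \<in> (lt_step g M)\<^sup>*"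
      by (cases rule: converse_rtranclE) auto
    have zw: "adj z w" "g w < M" using w(1) by (simp_all add: lt_step_def)
    have "(x, w) \<in> (lt_step g M)\<^sup>*"
      using bypass_peak[OF assms(1) _ zw(1) gz step.prems zw(2)] xz(1) adj_sym by simp
    then show ?thesis using w(2) by (rule rtrancl_trans)
  qed
qed simp

theorem local_min_imp_global_min:
  assumes L: "L_convex G ori h g" and pV: "p \<in> V" and qV: "q \<in> V"
    and loc: "\<And>w. adj p w \<Longrightarrow> g p \<le> g w"
  shows "g p \<le> g q"
proof (rule ccontr)
  assume "\<not> g p \<le> g q"
  then have lt: "g q < g p" by simp
  define A where "A = {M \<in> g ` V. g p \<le> M \<and> (p, q) \<in> (le_step g M)\<^sup>*}"
  have finV: "finite (g ` V)" using finite_V by simp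
  have finA: "finite A" using finV unfolding A_def by simp
  have "E \<subseteq> le_step g (Max (g ` V))"
  proof
    fix e assume e: "e \<in> E"
    obtain u v where uv: "e = (u, v)" by (cases e)
    then have "adj u v" "v \<in> V" using e edge_adj edge_V by blast+
    then show "e \<in> le_step g (Max (g ` V))" using finV uv by (simp add: le_step_def)
  qed
  then have "(p, q) \<in> (le_step g (Max (g ` V)))\<^sup>*" using reach[OF pV qV] rtrancl_mono by blast
  moreover have "Max (g ` V) \<in> g ` V" using finV pV by (intro Max_in) auto
  moreover have "g p \<le> Max (g ` V)" using finV pV by simp
  ultimately have "A \<noteq> {}" unfolding A_def by blast
  define M where "M = Min A"
  have "M \<in> A" unfolding M_def using finA \<open>A \<noteq> {}\<close> by (rule Min_in)
  then have M: "g p \<le> M" "(p, q) \<in> (le_step g M)\<^sup>*" unfolding A_def by blast+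
  have path: "(p, q) \<in> (lt_step g M)\<^sup>*" using remove_peaks[OF L M(2,1)] lt M(1) by simp
  show False
  proof (cases "M = g p")
    case True
    have "p \<noteq> q" using lt by auto
    with path obtain w where "(p, w) \<in> lt_step g M" by (cases rule: converse_rtranclE) auto
    then show False using loc[of w] True by (simp add: lt_step_def)
  next
    case False
    \<comment> \<open>As \<open>g\<close> has finitely many values, staying below \<open>M\<close>
      means staying at or below the next smaller value, which then belongs to
      \<open>A\<close>.\<close>
    define S where "S = {m \<in> g ` V. m < M}"
    have finS: "finite S" using finV unfolding S_def by simp
    have pS: "g p \<in> S" using M(1) False pV unfolding S_def by simp
    have "Max S \<in> S" using finS pS by (intro Max_in) auto
    then have MS: "Max S \<in> g ` V" "Max S < M" unfolding S_def by blast+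
    have "lt_step g M \<subseteq> le_step g (Max S)"
    proof
      fix e assume e: "e \<in> lt_step g M"
      obtain u v where uv: "e = (u, v)" by (cases e)
      then have v: "adj u v" "g v < M" using e by (simp_all add: lt_step_def)
      then have "g v \<in> S" using adj_V(2) unfolding S_def by blast
      then show "e \<in> le_step g (Max S)" using finS v(1) uv by (simp add: le_step_def)
    qed
    then have "(p, q) \<in> (le_step g (Max S))\<^sup>*" using path rtrancl_mono by blast
    moreover have "g p \<le> Max S" using finS pS by simp
    ultimately have "Max S \<in> A" using MS(1) unfolding A_def by blast
    then have "M \<le> Max S" unfolding M_def using finA by simp
    then show False using MS(2) by simp
  qed
qed

end

theorem theorem4p11:
  fixes G :: "'a pair_pre_digraph" and ori :: "'a rel" and h :: "'a set \<Rightarrow> real"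
    and g :: "'a \<Rightarrow> real" and p :: 'a
  assumes "modular_complex G ori h"
    and "L_convex G ori h g"
    and "p \<in> pverts G"
  shows "((\<forall>q\<in>pverts G. g p \<le> g q) \<longleftrightarrow>
          (\<forall>q\<in>pverts G. boolean_pair G ori p q \<or> boolean_pair G ori q p \<longrightarrow> g p \<le> g q)) \<and>
         ((\<forall>q\<in>pverts G. boolean_pair G ori p q \<or> boolean_pair G ori q p \<longrightarrow> g p \<le> g q) \<longleftrightarrow>
          (g p = Min (g ` Lplus G ori p) \<and> g p = Min (g ` Lminus G ori p)))"
proof -
  interpret modular_cx G ori h by unfold_locales (rule assms(1))
  have "(\<forall>q\<in>V. g p \<le> g q) \<longleftrightarrow>
      (\<forall>q\<in>V. boolean_pair G ori p q \<or> boolean_pair G ori q p \<longrightarrow> g p \<le> g q)"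
  proof (intro iffI ballI)
    fix q assume q: "q \<in> V"
      and loc: "\<forall>q\<in>V. boolean_pair G ori p q \<or> boolean_pair G ori q p \<longrightarrow> g p \<le> g q"
    have "g p \<le> g w" if "adj p w" for w
      using loc adj_V(2)[OF that] that unfolding adj_def boolean_pair_iff by blast
    then show "g p \<le> g q" using local_min_imp_global_min[OF assms(2,3) q] by blast
  qed blast
  moreover have Min_iff: "g p = Min (g ` A) \<longleftrightarrow> (\<forall>q\<in>A. g p \<le> g q)" if "A \<subseteq> V" "p \<in> A" for A
  proof -
    have fin: "finite (g ` A)" using finite_subset[OF that(1) finite_V] by simp
    show ?thesis
    proof
      assume "g p = Min (g ` A)"
      then show "\<forall>q\<in>A. g p \<le> g q" using fin by simp
    next
      assume "\<forall>q\<in>A. g p \<le> g q"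
      then show "g p = Min (g ` A)" using fin that(2) by (intro Min_eqI[symmetric]) auto
    qed
  qed
  have "Lplus G ori p \<subseteq> V" "p \<in> Lplus G ori p" "Lminus G ori p \<subseteq> V" "p \<in> Lminus G ori p"
    using assms(3) unfolding Lplus_def Lminus_def boolean_pair_def by blast+
  note Min_iff[OF this(1,2)] Min_iff[OF this(3,4)]
  then have "(\<forall>q\<in>V. boolean_pair G ori p q \<or> boolean_pair G ori q p \<longrightarrow> g p \<le> g q) \<longleftrightarrow>
      (g p = Min (g ` Lplus G ori p) \<and> g p = Min (g ` Lminus G ori p))"
    unfolding Lplus_def Lminus_def boolean_pair_def by blast
  ultimately show ?thesis by blast
qed

end
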